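(* Let $E\subset\mathfrak{LC}$ have $L^1_{loc}$-equicontinuous $m$-bounds, with associated suitable set of moduli of continuity $\Theta$ and associated suitable set of radii $\mathcal R$. Let $\mathcal T$ be any of the topologies $\sigma_\Theta$, $\mathcal T_{\Theta\mathcal R}$, $\mathcal T_\Theta$ or $\mathcal T_B$. Assume that $(f_n)_{n\ge1}\subset E$ converges to $f$ in $(\mathfrak{LC},\mathcal T)$ and $(z_n)_{n\ge1}\subset X$ converges to $z\in X$, as $n\to\infty$. Then the mild solutions $u(t,f_n,z_n)$ converge uniformly as $n\to\infty$ to the mild solution $u(t,f,z)$ on every time-interval $[0,T]\subset I_{f,z}$.
   Context: Setting. $M,N\ge 1$; $U\subset\mathbb R^M$ is a bounded, open, connected set with sufficiently smooth boundary; $|y|=|y_1|+\dots+|y_N|$ on $\mathbb R^N$; $B_j\subset\mathbb R^N$ is the closed ball of radius $j$ centered at $0$; $L^1_{loc}$ is the space of locally integrable functions $\mathbb R\to\mathbb R$; $\mathbb N=\{1,2,\dots\}$; $I=[q_1,q_2]$ always has rational endpoints $q_1<q_2$. One fixes Neumann, Robin or Dirichlet boundary conditions: for $1\le i\le N$, $\alpha_i(x)y_i+\kappa\,\partial y_i/\partial n=0$ on $\partial U$, with $\kappa=0,\alpha_i\equiv1$ (Dirichlet), $\kappa=1,\alpha_i\equiv 0$ (Neumann), or $\kappa=1$ and $\alpha_i:\partial U\to\mathbb R$ nonnegative and sufficiently regular (Robin). Put $Y=C(\overline U)$, $X=C(\overline U,\mathbb R^N)$ in the Neumann/Robin case, and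 $Y=C_0(\overline U)$, $X=C_0(\overline U,\mathbb R^N)$ (continuous functions vanishing on $\partial U$) in the Dirichlet case. $\|z\|=\sup_{x\in\overline U}|z(x)|$; $\mathcal B_j=C(\overline U,B_j)$ and $\mathcal B_j^X=\mathcal B_j\cap X$ (same notation for any real radius). Semigroup. $A_i$ is the closure in $Y$ of $A_i^0z_i=\Delta z_i$ with domain $\{z_i\in C^2(U)\cap C^1(\overline U): \Delta z_i\in C(\overline U),\ \alpha_i z_i+\partial z_i/\partial n=0 \text{ on }\partial U\}$ (Neumann/Robin), resp. $\{z_i\in C^2(U)\cap C_0(\overline U):\Delta z_i\in C_0(\overline U)\}$ (Dirichlet). It is a known fact (the regularity of $\partial U$ and $\alpha_i$ is assumed sufficient for it) that $A_i$ is sectorial and generates a strongly continuous analytic semigroup $(e^{tA_i})_{t\ge0}$ on $Y$, with $e^{tA_i}$ compact for $t>0$ and $\|e^{tA_i}\|\le1$. Then $A=\prod_{i=1}^N A_i$ on $X=Y^N$, $e^{tA}=\prod_i e^{tA_i}$, and $\|e^{tA}\|\le N$ for all $t\ge0$ in the operator norm associated to $\|\cdot\|$. Carathéodory maps. $f:\mathbb R\times\overline U\times\mathbb R^N\to\mathbb R^N$ is in $\mathfrak{SC}$ if it is Borel measurable; for every compact $K\subset\mathbb R^N$ there is a nonnegative $m^K\in L^1_{loc}$ (an $m$-bound on $K$) with, for a.e. $t$, $|f(t,x,y)|\le m^K(t)$ for all $x\in\overline U$, $y\in K$; and for a.e. $t$ the map $f(t,\cdot,\cdot)$ is continuous. $f\in\mathfrak{LC}$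 if moreover for every compact $K$ there is a nonnegative $l^K\in L^1_{loc}$ such that for a.e. $t$, $|f(t,x,y_1)-f(t,x,y_2)|\le l^K(t)|y_1-y_2|$ for all $x\in\overline U$, $y_1,y_2\in K$. Functions differing on a negligible set are identified. In the Dirichlet case it is a standing assumption that all maps $f$ considered satisfy $f(t,x,0)=0$ for all $t\in\mathbb R$, $x\in\partial U$. Set $\tilde f(t,z)(x)=f(t,x,z(x))$ for $z\in C(\overline U,\mathbb R^N)$. The optimal $m$-bound of $f$ on $B_j$ is $m_f^j(t)=\sup_{x\in\overline U,\,y\in B_j}|f(t,x,y)|$. $E\subset\mathfrak{LC}$ has $L^1_{loc}$-equicontinuous $m$-bounds if for every $j\in\mathbb N$ there is a set $S^j\subset L^1_{loc}$ of $m$-bounds on $B_j$ of the functions of $E$ (containing one for each $f\in E$) such that for all $r,\varepsilon>0$ there is $\delta>0$ with $\sup_{m\in S^j}\int_{t_1}^{t_2}m<\varepsilon$ whenever $-r\le t_1\le t_2\le r$, $t_2-t_1<\delta$. Associated $\Theta=(\Theta_1,\Theta_2)$ and $\mathcal R$. For such $E$, $j\in\mathbb N$, $I=[q_1,q_2]$, integer $\nu\ge1$ with $q_1+1/\nu<q_2$, and $s\ge0$: $\theta_j^I(s)=2N\sup_{t\in I,\,g\in E}\int_t^{t+s}m_g^j$; $\theta^{I,\nu}(s)=\sup\{\|e^{tA}-e^{(t+r)A}\|: t\in[1/\nu,q_2-q_1],\ r\in[0,s]\}$; $\theta_j^{I,\nu}(s)=j\,\theta^{I,\nu}(s)+\theta_j^I(s)+\theta^{I,\nu}(s)\sup_{g\in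 E}\int_I m_g^j$; $R_j^I=Nj+N\sup_{g\in E}\int_I m_g^j$. Then $\Theta_1=\{\theta_j^I\}$, $\Theta_2=\{\theta_j^{I,\nu}\}$, $\mathcal R=\{R_j^I\}$. Sets. $\mathcal H_j^I$ is the set of $v\in C(I,\mathcal B_j)$ such that for every integer $\nu\ge1$ with $q_1+1/\nu<q_2$: $\|v(t_1)-v(t_2)\|\le\theta_j^{I,\nu}(|t_1-t_2|)+\theta_j^I(1/\nu)$ for all $t_1,t_2\in[q_1+1/\nu,q_2]$. $\mathcal K_j^I$ is the set of $v\in C(I,\mathcal B_j)$ such that for every $J=[r_1,r_2]\subseteq I$ with rational endpoints and every integer $\nu\ge1$ with $r_1+1/\nu<r_2$: (i) $\|v(t_1)-v(t_2)\|\le\theta_j^{J,\nu}(|t_1-t_2|)+\theta_j^J(1/\nu)$ for all $t_1,t_2\in[r_1+1/\nu,r_2]$; (ii) $\mathrm d\big(v(t),e^{\frac1\nu A}\mathcal B^X_{R_j^J}\big)\le\theta_j^J(1/\nu)$ for all $t\in[r_1+1/\nu,r_2]$, where $\mathrm d(z,F)=\inf_{\tilde z\in F}\|z-\tilde z\|$. Topologies on $\mathfrak{SC}$ (restricted to $\mathfrak{LC}$), generated by the indicated seminorms over $j\in\mathbb N$ and $I=[q_1,q_2]$ with rational endpoints: $\mathcal T_B$: $\sup_{v\in C(I,\mathcal B_j)}\int_I\|\tilde f(s,v(s))\|ds$; $\mathcal T_\Theta$: $\sup_{v\in\mathcal H_j^I}\int_I\|\tilde f(s,v(s))\|ds$;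 $\sigma_\Theta$: $\sup_{v\in\mathcal H_j^I}\|\int_I\tilde f(s,v(s))ds\|$; $\mathcal T_{\Theta\mathcal R}$: $\sup_{v\in\mathcal K_j^I}\int_I\|\tilde f(s,v(s))\|ds$. Mild solutions. For $f\in\mathfrak{LC}$, $z\in X$, a mild solution on $[0,\delta]$ of $u'=Au+\tilde f(t,u)$, $u(0)=z$, is $u\in C([0,\delta],X)$ with $u(t)=e^{tA}z+\int_0^t e^{(t-s)A}\tilde f(s,u(s))\,ds$ for $t\in[0,\delta]$ (Bochner integral); it is unique when it exists. $I_{f,z}$ is the union of all $[0,\delta]$ on which a mild solution exists and $u(\cdot,f,z)$ is the resulting maximal mild solution on $I_{f,z}$. Uniform convergence on $[0,T]$ means that $u(\cdot,f_n,z_n)$ is defined on $[0,T]$ for all large $n$ and $\sup_{t\in[0,T]}\|u(t,f_n,z_n)-u(t,f,z)\|\to0$. *)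

theory Defs
  imports "HOL-Analysis.Analysis" "HOL-Probability.Discrete_Topology"
begin

section \<open>Continuous functions on the closure of a domain\<close>

text \<open>
  Bounded functions on \<open>\<real>\<^sup>M\<close> (no continuity: the argument carries the discrete topology) form a
  Banach space under the library's sup norm. \<open>C(closure U)\<close> is realised as the closed subspace of
  those that are continuous on \<open>closure U\<close> and, to make the representative unique, zero elsewhere.
\<close>

type_synonym ('m, 'b) bfun = "(real ^ 'm) discrete \<Rightarrow>\<^sub>C 'b"

definition ev :: "('m::finite, 'b::metric_space) bfun \<Rightarrow> real ^ 'm \<Rightarrow> 'b" where
  "ev z x = apply_bcontfun z (discrete x)"

definition CU :: "(real ^ 'm) set \<Rightarrow> ('m::finite, 'b::real_normed_vector) bfun set" where
  "CU U = {z. continuous_on (closure U) (ev z) \<and> (\<forall>x. x \<notin> closure U \<longrightarrow> ev z x = 0)}"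

definition norm1 :: "real ^ 'n \<Rightarrow> real" where
  "norm1 y = (\<Sum>i\<in>UNIV. \<bar>y $ i\<bar>)"

definition cball1 :: "real \<Rightarrow> (real ^ 'n) set" where
  "cball1 r = {y. norm1 y \<le> r}"

text \<open>
  The norm of \<open>C(closure U, \<real>\<^sup>N)\<close>, built from the 1-norm of \<open>\<real>\<^sup>N\<close>. It is equivalent, but not equal, to
  the library norm of the type; the latter is used below only for notions (continuity, Bochner
  integrability) that do not change under an equivalent norm. For scalar functions both agree.
\<close>

definition xnorm :: "(real ^ 'm) set \<Rightarrow> ('m::finite, real ^ 'n) bfun \<Rightarrow> real" where
  "xnorm U z = (SUP x\<in>closure U. norm1 (ev z x))"

definition CB :: "(real ^ 'm) set \<Rightarrow> real \<Rightarrow> ('m::finite, real ^ 'n) bfun set" where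
  "CB U r = {z \<in> CU U. \<forall>x\<in>closure U. ev z x \<in> cball1 r}"


section \<open>Boundary conditions and the heat semigroup\<close>

text \<open>\<open>Robin \<alpha>\<close> carries the coefficients \<open>\<alpha> i x\<close>, \<open>i\<close> being the component and \<open>x\<close> a boundary point.\<close>

datatype ('i, 'p) bc = Dirichlet | Neumann | Robin "'i \<Rightarrow> 'p \<Rightarrow> real"

fun bc_coeff :: "('i, 'p) bc \<Rightarrow> 'i \<Rightarrow> 'p \<Rightarrow> real" where
  "bc_coeff Dirichlet i x = 1"
| "bc_coeff Neumann i x = 0"
| "bc_coeff (Robin \<alpha>) i x = \<alpha> i x"

definition admissible_bc :: "(real ^ 'm) set \<Rightarrow> ('n, real ^ 'm) bc \<Rightarrow> bool" where
  "admissible_bc U bc \<longleftrightarrow>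
     (\<forall>\<alpha>. bc = Robin \<alpha> \<longrightarrow>
        (\<forall>i. continuous_on (frontier U) (\<alpha> i) \<and> (\<forall>x\<in>frontier U. 0 \<le> \<alpha> i x)))"

text \<open>The spaces \<open>Y\<close> (for \<open>'b = real\<close>) and \<open>X\<close> (for \<open>'b = real ^ 'n\<close>).\<close>

definition state_space ::
    "(real ^ 'm) set \<Rightarrow> ('n, real ^ 'm) bc \<Rightarrow> ('m::finite, 'b::real_normed_vector) bfun set" where
  "state_space U bc = {z \<in> CU U. bc = Dirichlet \<longrightarrow> (\<forall>x\<in>frontier U. ev z x = 0)}"

text \<open>
  \<open>\<phi>\<close> is a local \<open>C\<^sup>1\<close> defining function of \<open>U\<close> near \<open>x\<close>, and \<open>n\<close> is its normalised gradient at \<open>x\<close>.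
\<close>

definition outward_normal :: "(real ^ 'm) set \<Rightarrow> real ^ 'm \<Rightarrow> real ^ 'm \<Rightarrow> bool" where
  "outward_normal U x n \<longleftrightarrow>
     norm n = 1 \<and>
     (\<exists>V \<phi> D. open V \<and> x \<in> V \<and>
        (\<forall>p\<in>V. GDERIV \<phi> p :> D p) \<and> continuous_on V D \<and>
        U \<inter> V = {p \<in> V. \<phi> p < 0} \<and> frontier U \<inter> V = {p \<in> V. \<phi> p = 0} \<and>
        (\<exists>c>0. D x = c *\<^sub>R n))"

definition C1_boundary :: "(real ^ 'm) set \<Rightarrow> bool" where
  "C1_boundary U \<longleftrightarrow> (\<forall>x\<in>frontier U. \<exists>n. outward_normal U x n)"

text \<open>
  The graph of \<open>A\<^sub>i\<^sup>0\<close>. \<open>D\<close> and \<open>H\<close> are the gradient and the Hessian of \<open>z\<close> in \<open>U\<close>; in the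
  Neumann and Robin cases \<open>D\<close> has to extend continuously to \<open>closure U\<close>, and the normal derivative
  at the boundary is taken from this extension.
\<close>

definition laplace_graph ::
    "(real ^ 'm) set \<Rightarrow> ('n, real ^ 'm) bc \<Rightarrow> 'n \<Rightarrow> (('m::finite, real) bfun \<times> ('m, real) bfun) set"
  where
  "laplace_graph U bc i =
     {(z, w). z \<in> state_space U bc \<and> w \<in> state_space U bc \<and>
        (\<exists>D H. (\<forall>x\<in>U. GDERIV (ev z) x :> D x) \<and>
               (\<forall>x\<in>U. (D has_derivative (\<lambda>h. H x *v h)) (at x)) \<and>
               continuous_on U H \<and>
               (\<forall>x\<in>U. ev w x = trace (H x)) \<and>
               (bc \<noteq> Dirichlet \<longrightarrow>
                  continuous_on (closure U) D \<and>
                  (\<forall>x\<in>frontier U. \<forall>n. outward_normal U x n \<longrightarrow>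
                      bc_coeff bc i x * ev z x + D x \<bullet> n = 0)))}"

text \<open>
  Operators on a closed subspace \<open>S\<close> of a real normed space are given by their graphs. Sectoriality
  refers to the complexification: \<open>z + \<i> w\<close> is represented by the pair \<open>z\<close>, \<open>w\<close>, and the two equations
  are the real and imaginary parts of \<open>(\<lambda> - A)(z + \<i> w) = g + \<i> h\<close>.
\<close>

definition sectorial_on :: "'a::real_normed_vector set \<Rightarrow> ('a \<times> 'a) set \<Rightarrow> bool" where
  "sectorial_on S A \<longleftrightarrow>
     (\<exists>\<omega> M \<phi>::real. pi / 2 < \<phi> \<and> \<phi> < pi \<and> 0 < M \<and>
       (\<forall>l::complex. l \<noteq> of_real \<omega> \<and> \<bar>Arg (l - of_real \<omega>)\<bar> < \<phi> \<longrightarrow>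
          (\<forall>g\<in>S. \<forall>h\<in>S. \<exists>z Az w Aw. (z, Az) \<in> A \<and> (w, Aw) \<in> A \<and>
              Re l *\<^sub>R z - Im l *\<^sub>R w - Az = g \<and> Re l *\<^sub>R w + Im l *\<^sub>R z - Aw = h) \<and>
          (\<forall>z Az w Aw. (z, Az) \<in> A \<and> (w, Aw) \<in> A \<longrightarrow>
              cmod (l - of_real \<omega>) * (norm z + norm w) \<le>
                M * (norm (Re l *\<^sub>R z - Im l *\<^sub>R w - Az) +
                     norm (Re l *\<^sub>R w + Im l *\<^sub>R z - Aw)))))"

definition C0_semigroup_on ::
    "'a::real_normed_vector set \<Rightarrow> (real \<Rightarrow> 'a \<Rightarrow> 'a) \<Rightarrow> bool" where
  "C0_semigroup_on S T \<longleftrightarrow>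
     (\<forall>t\<ge>0. T t ` S \<subseteq> S) \<and>
     (\<forall>t\<ge>0. \<forall>x\<in>S. \<forall>y\<in>S. \<forall>a b. T t (a *\<^sub>R x + b *\<^sub>R y) = a *\<^sub>R T t x + b *\<^sub>R T t y) \<and>
     (\<forall>t\<ge>0. \<exists>M. \<forall>x\<in>S. norm (T t x) \<le> M * norm x) \<and>
     (\<forall>x\<in>S. T 0 x = x) \<and>
     (\<forall>s\<ge>0. \<forall>t\<ge>0. \<forall>x\<in>S. T (s + t) x = T s (T t x)) \<and>
     (\<forall>x\<in>S. ((\<lambda>t. T t x) \<longlongrightarrow> x) (at_right 0))"

definition generator_on ::
    "'a::real_normed_vector set \<Rightarrow> (real \<Rightarrow> 'a \<Rightarrow> 'a) \<Rightarrow> ('a \<times> 'a) set" where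
  "generator_on S T =
     {(x, y). x \<in> S \<and> y \<in> S \<and> ((\<lambda>h. (T h x - x) /\<^sub>R h) \<longlongrightarrow> y) (at_right 0)}"

text \<open>
  \<open>T\<close> is \<open>t \<mapsto> exp(t A\<^sub>i)\<close> on \<open>Y\<close>, with \<open>A\<^sub>i\<close> the closure of \<open>A\<^sub>i\<^sup>0\<close>; it is determined on \<open>Y\<close> by its
  generator. Existence of such a \<open>T\<close>, sectoriality, compactness and contractivity are exactly what
  a sufficiently smooth boundary and sufficiently regular coefficients are meant to provide.
  (The semigroup generated by a sectorial operator is analytic.)
\<close>

definition heat_semigroup ::
    "(real ^ 'm) set \<Rightarrow> ('n, real ^ 'm) bc \<Rightarrow> 'n \<Rightarrow>
     (real \<Rightarrow> ('m::finite, real) bfun \<Rightarrow> ('m, real) bfun) \<Rightarrow> bool" where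
  "heat_semigroup U bc i T \<longleftrightarrow>
     sectorial_on (state_space U bc) (closure (laplace_graph U bc i)) \<and>
     C0_semigroup_on (state_space U bc) T \<and>
     generator_on (state_space U bc) T = closure (laplace_graph U bc i) \<and>
     (\<forall>t>0. compact (closure (T t ` (state_space U bc \<inter> cball 0 1)))) \<and>
     (\<forall>t\<ge>0. \<forall>z\<in>state_space U bc. norm (T t z) \<le> norm z)"

definition component :: "'n::finite \<Rightarrow> ('m::finite, real ^ 'n) bfun \<Rightarrow> ('m, real) bfun" where
  "component i z = Bcontfun (\<lambda>d. apply_bcontfun z d $ i)"

lemma ev_component: "ev (component i z) x = ev z x $ i"
proof -
  have "bounded ((\<lambda>y. y $ i) ` range (apply_bcontfun z))"
    by (intro bounded_linear_image bounded_apply_bcontfun bounded_linear_vec_nth)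
  then have "(\<lambda>d. apply_bcontfun z d $ i) \<in> bcontfun"
    by (auto simp: bcontfun_def image_image intro!: continuous_intros)
  then show ?thesis
    by (simp add: component_def ev_def Bcontfun_inverse)
qed

definition tuple :: "('n::finite \<Rightarrow> ('m::finite, real) bfun) \<Rightarrow> ('m, real ^ 'n) bfun" where
  "tuple w = Bcontfun (\<lambda>d. \<chi> i. apply_bcontfun (w i) d)"

lemma ev_tuple: "ev (tuple w) x = (\<chi> i. ev (w i) x)"
proof -
  have "norm (\<chi> i. apply_bcontfun (w i) d) \<le> (\<Sum>i\<in>UNIV. norm (w i))" for d
  proof -
    have "norm (\<chi> i. apply_bcontfun (w i) d) \<le> (\<Sum>i\<in>UNIV. \<bar>apply_bcontfun (w i) d\<bar>)"
      using norm_le_l1_cart[of "\<chi> i. apply_bcontfun (w i) d"] by simp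
    also have "\<dots> \<le> (\<Sum>i\<in>UNIV. norm (w i))"
      by (intro sum_mono) (metis norm_bounded real_norm_def)
    finally show ?thesis .
  qed
  then have "bounded (range (\<lambda>d. \<chi> i. apply_bcontfun (w i) d))"
    by (auto simp: bounded_iff)
  then have "(\<lambda>d. \<chi> i. apply_bcontfun (w i) d) \<in> bcontfun"
    by (auto simp: bcontfun_def intro!: continuous_intros)
  then show ?thesis
    by (simp add: tuple_def ev_def Bcontfun_inverse)
qed

text \<open>\<open>exp(t A)\<close>, the product of the semigroups \<open>T i\<close>.\<close>

definition etA ::
    "('n::finite \<Rightarrow> real \<Rightarrow> ('m::finite, real) bfun \<Rightarrow> ('m, real) bfun) \<Rightarrow> real \<Rightarrow>
     ('m, real ^ 'n) bfun \<Rightarrow> ('m, real ^ 'n) bfun" where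
  "etA T t z = tuple (\<lambda>i. T i t (component i z))"

definition opnorm ::
    "(real ^ 'm) set \<Rightarrow> ('n, real ^ 'm) bc \<Rightarrow>
     (('m::finite, real ^ 'n) bfun \<Rightarrow> ('m, real ^ 'n) bfun) \<Rightarrow> real" where
  "opnorm U bc L = (SUP z\<in>{z \<in> state_space U bc. xnorm U z \<le> 1}. xnorm U (L z))"


section \<open>Caratheodory maps\<close>

text \<open>
  Maps are not quotiented by equality up to null sets: bounds, seminorms and mild solutions below do
  not change when a map is altered for \<open>t\<close> in a null set. Values of \<open>f t x y\<close> at \<open>x \<notin> closure U\<close> play no role.
\<close>

type_synonym ('m, 'n) cmap = "real \<Rightarrow> real ^ 'm \<Rightarrow> real ^ 'n \<Rightarrow> real ^ 'n"

definition L1loc :: "(real \<Rightarrow> real) set" where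
  "L1loc = {m. \<forall>a b. set_integrable lebesgue {a..b} m}"

definition m_bound ::
    "(real ^ 'm) set \<Rightarrow> (real ^ 'n) set \<Rightarrow> ('m::finite, 'n::finite) cmap \<Rightarrow> (real \<Rightarrow> real) \<Rightarrow> bool" where
  "m_bound U K f m \<longleftrightarrow>
     m \<in> L1loc \<and> (\<forall>t. 0 \<le> m t) \<and>
     (AE t in lebesgue. \<forall>x\<in>closure U. \<forall>y\<in>K. norm1 (f t x y) \<le> m t)"

definition l_bound ::
    "(real ^ 'm) set \<Rightarrow> (real ^ 'n) set \<Rightarrow> ('m::finite, 'n::finite) cmap \<Rightarrow> (real \<Rightarrow> real) \<Rightarrow> bool" where
  "l_bound U K f l \<longleftrightarrow>
     l \<in> L1loc \<and> (\<forall>t. 0 \<le> l t) \<and>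
     (AE t in lebesgue. \<forall>x\<in>closure U. \<forall>y1\<in>K. \<forall>y2\<in>K.
        norm1 (f t x y1 - f t x y2) \<le> l t * norm1 (y1 - y2))"

definition SC :: "(real ^ 'm) set \<Rightarrow> ('m::finite, 'n::finite) cmap set" where
  "SC U = {f.
     (\<lambda>(t, x, y). f t x y) \<in> borel_measurable (restrict_space borel (UNIV \<times> closure U \<times> UNIV)) \<and>
     (\<forall>K. compact K \<longrightarrow> (\<exists>m. m_bound U K f m)) \<and>
     (AE t in lebesgue. continuous_on (closure U \<times> UNIV) (\<lambda>(x, y). f t x y))}"

definition LC :: "(real ^ 'm) set \<Rightarrow> ('m::finite, 'n::finite) cmap set" where
  "LC U = {f \<in> SC U. \<forall>K. compact K \<longrightarrow> (\<exists>l. l_bound U K f l)}"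

definition bc_compatible ::
    "(real ^ 'm) set \<Rightarrow> ('n, real ^ 'm) bc \<Rightarrow> ('m::finite, 'n::finite) cmap \<Rightarrow> bool" where
  "bc_compatible U bc f \<longleftrightarrow> (bc = Dirichlet \<longrightarrow> (\<forall>t. \<forall>x\<in>frontier U. f t x 0 = 0))"

text \<open>
  The superposition map \<open>z \<mapsto> f(t, \<cdot>, z(\<cdot>))\<close>. It is the intended function whenever \<open>f(t, \<cdot>, \<cdot>)\<close> is
  continuous, see the lemma; for the remaining null set of times its value may be arbitrary.
\<close>

definition nem ::
    "(real ^ 'm) set \<Rightarrow> ('m::finite, 'n::finite) cmap \<Rightarrow> real \<Rightarrow> ('m, real ^ 'n) bfun \<Rightarrow>
     ('m, real ^ 'n) bfun" where
  "nem U f t z =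
     Bcontfun (\<lambda>d. let x = of_discrete d in if x \<in> closure U then f t x (ev z x) else 0)"

lemma ev_nem:
  assumes "bounded U" "continuous_on (closure U \<times> UNIV) (\<lambda>(x, y). f t x y)" "z \<in> CU U"
  shows "ev (nem U f t z) x = (if x \<in> closure U then f t x (ev z x) else 0)"
proof -
  let ?g = "\<lambda>x. f t x (ev z x)"
  let ?h = "\<lambda>d. let x = of_discrete d in if x \<in> closure U then ?g x else 0"
  have "continuous_on (closure U) (\<lambda>x. (\<lambda>(x, y). f t x y) (x, ev z x))"
    using assms(3)
    by (intro continuous_on_compose2[OF assms(2)] continuous_intros) (auto simp: CU_def)
  then have "continuous_on (closure U) ?g"
    by simp
  then have "bounded (?g ` closure U)"
    using assms(1) compact_continuous_image compact_imp_bounded by (metis compact_closure)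
  then have "bounded (insert 0 (?g ` closure U))"
    by simp
  then have "bounded (range ?h)"
    by (rule bounded_subset) (auto simp: Let_def)
  moreover have "continuous_on UNIV ?h"
    by (simp add: continuous_on_open_vimage open_discrete)
  ultimately have "?h \<in> bcontfun"
    by (simp add: bcontfun_def)
  then show ?thesis
    by (simp add: ev_def nem_def Bcontfun_inverse discrete_inverse)
qed

definition opt_bound ::
    "(real ^ 'm) set \<Rightarrow> nat \<Rightarrow> ('m::finite, 'n::finite) cmap \<Rightarrow> real \<Rightarrow> real" where
  "opt_bound U j f t = (SUP (x, y)\<in>closure U \<times> cball1 (real j). norm1 (f t x y))"

definition equicontinuous_m_bounds ::
    "(real ^ 'm) set \<Rightarrow> ('m::finite, 'n::finite) cmap set \<Rightarrow> bool" where
  "equicontinuous_m_bounds U E \<longleftrightarrow>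
     (\<forall>j::nat. 1 \<le> j \<longrightarrow> (\<exists>S.
        (\<forall>m\<in>S. \<exists>f\<in>E. m_bound U (cball1 (real j)) f m) \<and>
        (\<forall>f\<in>E. \<exists>m\<in>S. m_bound U (cball1 (real j)) f m) \<and>
        (\<forall>r>0. \<forall>\<epsilon>>0. \<exists>\<delta>>0. \<forall>t1 t2.
           - r \<le> t1 \<and> t1 \<le> t2 \<and> t2 \<le> r \<and> t2 - t1 < \<delta> \<longrightarrow>
           (SUP m\<in>S. ereal (LINT t:{t1..t2}|lebesgue. m t)) < ereal \<epsilon>)))"


section \<open>Moduli of continuity and radii\<close>

text \<open>
  An interval \<open>I = [q\<^sub>1, q\<^sub>2]\<close> is passed as its two endpoints. The real suprema are finite if \<open>E\<close> is
  nonempty and has equicontinuous m-bounds and the operators \<open>exp(t A)\<close> are uniformly bounded.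
\<close>

definition theta ::
    "(real ^ 'm) set \<Rightarrow> ('m::finite, 'n::finite) cmap set \<Rightarrow> nat \<Rightarrow> real \<Rightarrow> real \<Rightarrow> real \<Rightarrow> real" where
  "theta U E j q1 q2 s =
     2 * real CARD('n) *
       (SUP (t, g)\<in>{q1..q2} \<times> E. LINT \<tau>:{t..t + s}|lebesgue. opt_bound U j g \<tau>)"

definition theta_sg ::
    "(real ^ 'm) set \<Rightarrow> ('n::finite, real ^ 'm) bc \<Rightarrow>
     ('n \<Rightarrow> real \<Rightarrow> ('m::finite, real) bfun \<Rightarrow> ('m, real) bfun) \<Rightarrow>
     real \<Rightarrow> real \<Rightarrow> nat \<Rightarrow> real \<Rightarrow> real" where
  "theta_sg U bc T q1 q2 \<nu> s =
     (SUP (t, r)\<in>{1 / real \<nu>..q2 - q1} \<times> {0..s}. opnorm U bc (\<lambda>z. etA T t z - etA T (t + r) z))"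

definition theta_nu ::
    "(real ^ 'm) set \<Rightarrow> ('n::finite, real ^ 'm) bc \<Rightarrow>
     ('n \<Rightarrow> real \<Rightarrow> ('m::finite, real) bfun \<Rightarrow> ('m, real) bfun) \<Rightarrow> ('m, 'n) cmap set \<Rightarrow>
     nat \<Rightarrow> real \<Rightarrow> real \<Rightarrow> nat \<Rightarrow> real \<Rightarrow> real" where
  "theta_nu U bc T E j q1 q2 \<nu> s =
     real j * theta_sg U bc T q1 q2 \<nu> s + theta U E j q1 q2 s +
     theta_sg U bc T q1 q2 \<nu> s * (SUP g\<in>E. LINT \<tau>:{q1..q2}|lebesgue. opt_bound U j g \<tau>)"

definition radius ::
    "(real ^ 'm) set \<Rightarrow> ('m::finite, 'n::finite) cmap set \<Rightarrow> nat \<Rightarrow> real \<Rightarrow> real \<Rightarrow> real" where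
  "radius U E j q1 q2 =
     real CARD('n) * real j +
     real CARD('n) * (SUP g\<in>E. LINT \<tau>:{q1..q2}|lebesgue. opt_bound U j g \<tau>)"

text \<open>
  Elements of \<open>C(I, \<cdot>)\<close> are functions on \<open>\<real>\<close> of which only the restriction to \<open>I\<close> matters.
\<close>

definition CI :: "(real ^ 'm) set \<Rightarrow> nat \<Rightarrow> real \<Rightarrow> real \<Rightarrow> (real \<Rightarrow> ('m::finite, real ^ 'n::finite) bfun) set"
  where "CI U j q1 q2 = {v. continuous_on {q1..q2} v \<and> (\<forall>t\<in>{q1..q2}. v t \<in> CB U (real j))}"

definition moduli_cond ::
    "(real ^ 'm) set \<Rightarrow> ('n::finite, real ^ 'm) bc \<Rightarrow>
     ('n \<Rightarrow> real \<Rightarrow> ('m::finite, real) bfun \<Rightarrow> ('m, real) bfun) \<Rightarrow> ('m, 'n) cmap set \<Rightarrow>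
     nat \<Rightarrow> real \<Rightarrow> real \<Rightarrow> nat \<Rightarrow> (real \<Rightarrow> ('m, real ^ 'n) bfun) \<Rightarrow> bool" where
  "moduli_cond U bc T E j q1 q2 \<nu> v \<longleftrightarrow>
     (\<forall>t1\<in>{q1 + 1 / real \<nu>..q2}. \<forall>t2\<in>{q1 + 1 / real \<nu>..q2}.
        xnorm U (v t1 - v t2)
          \<le> theta_nu U bc T E j q1 q2 \<nu> \<bar>t1 - t2\<bar> + theta U E j q1 q2 (1 / real \<nu>))"

definition HI ::
    "(real ^ 'm) set \<Rightarrow> ('n::finite, real ^ 'm) bc \<Rightarrow>
     ('n \<Rightarrow> real \<Rightarrow> ('m::finite, real) bfun \<Rightarrow> ('m, real) bfun) \<Rightarrow> ('m, 'n) cmap set \<Rightarrow>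
     nat \<Rightarrow> real \<Rightarrow> real \<Rightarrow> (real \<Rightarrow> ('m, real ^ 'n) bfun) set" where
  "HI U bc T E j q1 q2 =
     {v \<in> CI U j q1 q2. \<forall>\<nu>\<ge>1. q1 + 1 / real \<nu> < q2 \<longrightarrow> moduli_cond U bc T E j q1 q2 \<nu> v}"

definition xdist ::
    "(real ^ 'm) set \<Rightarrow> ('m::finite, real ^ 'n) bfun \<Rightarrow> ('m, real ^ 'n) bfun set \<Rightarrow> real" where
  "xdist U z F = (INF w\<in>F. xnorm U (z - w))"

definition KI ::
    "(real ^ 'm) set \<Rightarrow> ('n::finite, real ^ 'm) bc \<Rightarrow>
     ('n \<Rightarrow> real \<Rightarrow> ('m::finite, real) bfun \<Rightarrow> ('m, real) bfun) \<Rightarrow> ('m, 'n) cmap set \<Rightarrow>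
     nat \<Rightarrow> real \<Rightarrow> real \<Rightarrow> (real \<Rightarrow> ('m, real ^ 'n) bfun) set" where
  "KI U bc T E j q1 q2 =
     {v \<in> CI U j q1 q2. \<forall>r1\<in>\<rat>. \<forall>r2\<in>\<rat>. q1 \<le> r1 \<and> r1 < r2 \<and> r2 \<le> q2 \<longrightarrow>
        (\<forall>\<nu>\<ge>1. r1 + 1 / real \<nu> < r2 \<longrightarrow>
           moduli_cond U bc T E j r1 r2 \<nu> v \<and>
           (\<forall>t\<in>{r1 + 1 / real \<nu>..r2}.
              xdist U (v t) (etA T (1 / real \<nu>) ` (CB U (radius U E j r1 r2) \<inter> state_space U bc))
                \<le> theta U E j r1 r2 (1 / real \<nu>)))}"


section \<open>Bochner integral\<close>

text \<open>
  The library's \<open>has_bochner_integral\<close> demands a separable value type, which the ambient space of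
  bounded functions is not (\<open>C(closure U)\<close> is). This is the same definition by approximation with
  simple functions, with measurability of the integrand replaced by measurability of the distances.
\<close>

definition bochner_on ::
    "real set \<Rightarrow> (real \<Rightarrow> 'a::real_normed_vector) \<Rightarrow> 'a \<Rightarrow> bool" where
  "bochner_on J g w \<longleftrightarrow>
     (\<exists>s::nat \<Rightarrow> real \<Rightarrow> 'a.
        (\<forall>k. Bochner_Integration.simple_bochner_integrable (lebesgue_on J) (s k)) \<and>
        (\<forall>k. (\<lambda>t. norm (g t - s k t)) \<in> borel_measurable (lebesgue_on J)) \<and>
        (\<lambda>k. \<integral>\<^sup>+ t. ennreal (norm (g t - s k t)) \<partial>lebesgue_on J) \<longlonglongrightarrow> 0 \<and>
        (\<lambda>k. Bochner_Integration.simple_bochner_integral (lebesgue_on J) (s k)) \<longlonglongrightarrow> w)"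

definition bochner_integral :: "real set \<Rightarrow> (real \<Rightarrow> 'a::real_normed_vector) \<Rightarrow> 'a" where
  "bochner_integral J g = (THE w. bochner_on J g w)"


section \<open>Topologies\<close>

definition seminorm_topology :: "'a::minus set \<Rightarrow> ('a \<Rightarrow> real) set \<Rightarrow> 'a topology" where
  "seminorm_topology S P =
     topology_generated_by {{g \<in> S. p (g - f) < e} | f p e. f \<in> S \<and> p \<in> P \<and> 0 < e}"

definition T_of ::
    "(real ^ 'm) set \<Rightarrow> (nat \<Rightarrow> real \<Rightarrow> real \<Rightarrow> (real \<Rightarrow> ('m::finite, real ^ 'n::finite) bfun) set) \<Rightarrow>
     ('m, 'n) cmap topology" where
  "T_of U V = subtopology (seminorm_topology (SC U)
     {\<lambda>f. SUP v\<in>V j q1 q2. LINT s:{q1..q2}|lebesgue. xnorm U (nem U f s (v s)) | j q1 q2.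
        1 \<le> j \<and> q1 \<in> \<rat> \<and> q2 \<in> \<rat> \<and> q1 < q2}) (LC U)"

definition sigma_of ::
    "(real ^ 'm) set \<Rightarrow> (nat \<Rightarrow> real \<Rightarrow> real \<Rightarrow> (real \<Rightarrow> ('m::finite, real ^ 'n::finite) bfun) set) \<Rightarrow>
     ('m, 'n) cmap topology" where
  "sigma_of U V = subtopology (seminorm_topology (SC U)
     {\<lambda>f. SUP v\<in>V j q1 q2. xnorm U (bochner_integral {q1..q2} (\<lambda>s. nem U f s (v s))) | j q1 q2.
        1 \<le> j \<and> q1 \<in> \<rat> \<and> q2 \<in> \<rat> \<and> q1 < q2}) (LC U)"

definition topology_B :: "(real ^ 'm) set \<Rightarrow> ('m::finite, 'n::finite) cmap topology" where
  "topology_B U = T_of U (CI U)"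

definition topology_Theta ::
    "(real ^ 'm) set \<Rightarrow> ('n::finite, real ^ 'm) bc \<Rightarrow>
     ('n \<Rightarrow> real \<Rightarrow> ('m::finite, real) bfun \<Rightarrow> ('m, real) bfun) \<Rightarrow> ('m, 'n) cmap set \<Rightarrow>
     ('m, 'n) cmap topology" where
  "topology_Theta U bc T E = T_of U (HI U bc T E)"

definition topology_sigma_Theta ::
    "(real ^ 'm) set \<Rightarrow> ('n::finite, real ^ 'm) bc \<Rightarrow>
     ('n \<Rightarrow> real \<Rightarrow> ('m::finite, real) bfun \<Rightarrow> ('m, real) bfun) \<Rightarrow> ('m, 'n) cmap set \<Rightarrow>
     ('m, 'n) cmap topology" where
  "topology_sigma_Theta U bc T E = sigma_of U (HI U bc T E)"

definition topology_Theta_R ::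
    "(real ^ 'm) set \<Rightarrow> ('n::finite, real ^ 'm) bc \<Rightarrow>
     ('n \<Rightarrow> real \<Rightarrow> ('m::finite, real) bfun \<Rightarrow> ('m, real) bfun) \<Rightarrow> ('m, 'n) cmap set \<Rightarrow>
     ('m, 'n) cmap topology" where
  "topology_Theta_R U bc T E = T_of U (KI U bc T E)"


section \<open>Mild solutions\<close>

definition mild_solution ::
    "(real ^ 'm) set \<Rightarrow> ('n::finite, real ^ 'm) bc \<Rightarrow>
     ('n \<Rightarrow> real \<Rightarrow> ('m::finite, real) bfun \<Rightarrow> ('m, real) bfun) \<Rightarrow> ('m, 'n) cmap \<Rightarrow>
     ('m, real ^ 'n) bfun \<Rightarrow> real \<Rightarrow> (real \<Rightarrow> ('m, real ^ 'n) bfun) \<Rightarrow> bool" where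
  "mild_solution U bc T f z \<delta> u \<longleftrightarrow>
     continuous_on {0..\<delta>} u \<and> (\<forall>t\<in>{0..\<delta>}. u t \<in> state_space U bc) \<and>
     (\<forall>t\<in>{0..\<delta>}. \<exists>w. bochner_on {0..t} (\<lambda>s. etA T (t - s) (nem U f s (u s))) w \<and>
        u t = etA T t z + w)"

definition existence_interval ::
    "(real ^ 'm) set \<Rightarrow> ('n::finite, real ^ 'm) bc \<Rightarrow>
     ('n \<Rightarrow> real \<Rightarrow> ('m::finite, real) bfun \<Rightarrow> ('m, real) bfun) \<Rightarrow> ('m, 'n) cmap \<Rightarrow>
     ('m, real ^ 'n) bfun \<Rightarrow> real set" where
  "existence_interval U bc T f z = \<Union> {{0..\<delta>} | \<delta>. 0 < \<delta> \<and> (\<exists>u. mild_solution U bc T f z \<delta> u)}"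

text \<open>Well defined on the existence interval, because mild solutions on \<open>[0, \<delta>]\<close> are unique.\<close>

definition mild_sol ::
    "(real ^ 'm) set \<Rightarrow> ('n::finite, real ^ 'm) bc \<Rightarrow>
     ('n \<Rightarrow> real \<Rightarrow> ('m::finite, real) bfun \<Rightarrow> ('m, real) bfun) \<Rightarrow> ('m, 'n) cmap \<Rightarrow>
     ('m, real ^ 'n) bfun \<Rightarrow> real \<Rightarrow> ('m, real ^ 'n) bfun" where
  "mild_sol U bc T f z t =
     (THE w. \<exists>\<delta> u. 0 < \<delta> \<and> t \<in> {0..\<delta>} \<and> mild_solution U bc T f z \<delta> u \<and> w = u t)"

definition uniformly_converge_on ::
    "(real ^ 'm) set \<Rightarrow> ('n::finite, real ^ 'm) bc \<Rightarrow>
     ('n \<Rightarrow> real \<Rightarrow> ('m::finite, real) bfun \<Rightarrow> ('m, real) bfun) \<Rightarrow>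
     (nat \<Rightarrow> ('m, 'n) cmap) \<Rightarrow> (nat \<Rightarrow> ('m, real ^ 'n) bfun) \<Rightarrow>
     ('m, 'n) cmap \<Rightarrow> ('m, real ^ 'n) bfun \<Rightarrow> real \<Rightarrow> bool" where
  "uniformly_converge_on U bc T fn zn f z \<tau> \<longleftrightarrow>
     (\<forall>\<^sub>F n in sequentially. {0..\<tau>} \<subseteq> existence_interval U bc T (fn n) (zn n)) \<and>
     (\<lambda>n. SUP t\<in>{0..\<tau>}. xnorm U (mild_sol U bc T (fn n) (zn n) t - mild_sol U bc T f z t))
        \<longlonglongrightarrow> 0"

end

theory Submission
  imports Defs
begin

text \<open>
  Cut off in the state variable \<open>y\<close>, the equation of \<open>f\<^sub>n\<close> is globally Lipschitz, so it has a mild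
  solution \<open>u\<^sub>n\<close> on any \<open>[0, b]\<close>; these are uniformly bounded by some \<open>j\<close> and lie in \<open>\<K>\<^sub>j\<close> on every
  subinterval, because the cut-off forcing is bounded by the optimal m-bound of \<open>f\<^sub>n\<close>. Since \<open>\<K>\<^sub>j\<close> is
  contained in \<open>\<H>\<^sub>j\<close>, convergence in any of the four topologies forces the integrals of
  \<open>G\<^sub>n(s) = (f\<^sub>n - f)(s, u\<^sub>n(s))\<close> over rational intervals to vanish in the limit. Compactness makes
  \<open>exp(t A)\<close> norm continuous away from \<open>t = 0\<close>, so in the convolution of \<open>exp(t A)\<close> with \<open>G\<^sub>n\<close> the operator may be
  frozen on the pieces of a fine rational grid, while the last short piece is small by the
  equicontinuity of the m-bounds; hence these convolutions tend to \<open>0\<close> uniformly. Gronwall's inequality with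
  the Lipschitz bound of \<open>f\<close> then gives \<open>u\<^sub>n \<rightarrow> u\<close> as long as \<open>u\<^sub>n\<close> has not met the cut-off, and the
  estimate itself prevents \<open>u\<^sub>n\<close> from meeting it.
\<close>

section \<open>Continuous functions on the closure of the domain\<close>

text \<open>The seminorms test \<open>fn n - f\<close> only on curves from a class fixed by one
  radius \<open>j\<close>, while the curves of interest are solutions that change with
  \<open>n\<close> and are not known to exist on the whole interval. So \<open>j\<close> has to be
  found before \<open>n\<close>. The cut-off at level \<open>R\<close>, one more than a bound for
  the limit solution, takes values in a ball of radius \<open>k\<close> with
  \<open>CARD('n) * R \<le> k\<close>; the integrals of the optimal m-bounds on that ball are
  bounded uniformly over \<open>E\<close>, and this yields a \<open>j \<ge> k\<close> that bounds
  every truncated solution. Gronwall's constant is chosen before \<open>n\<close> for the same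
  reason: the first exit time through \<open>R\<close> depends on \<open>n\<close>. The weakest of
  the topologies controls only the norm of an integral, never the integral of a norm. The operator
  must therefore leave the integral over each grid cell, and the mass of \<open>G\<close> may enter
  only with a small factor. The ambient space of bounded functions is not separable. Sampling
  operators of finite rank replace separability: they approximate the identity on \<open>X\<close>
  strongly and depend on finitely many point evaluations.\<close>

lemma ev_simps [simp]:
  "ev (a + b) x = ev a x + ev b x" "ev (a - b) x = ev a x - ev b x"
  "ev (c *\<^sub>R a) x = c *\<^sub>R ev a x" "ev 0 x = 0" "ev (- a) x = - ev a x"
  for a b :: "('m::finite, 'b::real_normed_vector) bfun"
  by (simp_all add: ev_def)

lemma ev_sum: "ev (sum f A) x = (\<Sum>i\<in>A. ev (f i) x)"
  for f :: "'i \<Rightarrow> ('m::finite, 'b::real_normed_vector) bfun"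
  by (induction A rule: infinite_finite_induct) auto

lemma ev_eqI:
  assumes "\<And>x. ev a x = ev b x"
  shows "a = b"
proof (rule bcontfun_eqI)
  fix d show "apply_bcontfun a d = apply_bcontfun b d"
    using assms[of "of_discrete d"] by (simp add: ev_def of_discrete_inverse)
qed

lemma norm_ev_le: "norm (ev z x) \<le> norm z"
  unfolding ev_def by (rule norm_bounded)

lemma norm_le_ev:
  fixes z :: "('m::finite, 'b::real_normed_vector) bfun"
  assumes "\<And>x. norm (ev z x) \<le> B"
  shows "norm z \<le> B"
proof (rule norm_bound)
  fix d show "norm (apply_bcontfun z d) \<le> B"
    using assms[of "of_discrete d"] by (simp add: ev_def of_discrete_inverse)
qed

lemma bounded_linear_ev:
  "bounded_linear (\<lambda>z::('m::finite, 'b::real_normed_vector) bfun. ev z x)"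
  by (rule bounded_linear_intro[where K=1]) (auto simp: norm_ev_le)

lemma ev_tendsto:
  fixes w :: "'i \<Rightarrow> ('m::finite, 'b::real_normed_vector) bfun"
  assumes "(w \<longlongrightarrow> z) F"
  shows "((\<lambda>k. ev (w k) x) \<longlongrightarrow> ev z x) F"
  using bounded_linear.tendsto[OF bounded_linear_ev assms] .

lemma norm1_nonneg [simp]: "0 \<le> norm1 y"
  by (simp add: norm1_def sum_nonneg)

lemma norm1_zero [simp]: "norm1 0 = 0"
  by (simp add: norm1_def)

lemma norm1_triangle: "norm1 (a + b) \<le> norm1 a + norm1 b"
  unfolding norm1_def sum.distrib[symmetric] by (intro sum_mono) auto

lemma norm1_scaleR: "norm1 (c *\<^sub>R a) = \<bar>c\<bar> * norm1 a"
  by (simp add: norm1_def abs_mult sum_distrib_left)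

lemma norm_le_norm1: "norm y \<le> norm1 y"
  unfolding norm1_def by (rule norm_le_l1_cart)

lemma component_le_norm1: "\<bar>y $ i\<bar> \<le> norm1 y"
  unfolding norm1_def by (rule member_le_sum) auto

lemma norm1_le_norm: "norm1 y \<le> real CARD('n) * norm y" for y :: "real ^ 'n"
proof -
  have "norm1 y \<le> (\<Sum>i\<in>(UNIV::'n set). norm y)"
    unfolding norm1_def by (intro sum_mono component_le_norm_cart)
  then show ?thesis by simp
qed

lemma continuous_on_norm1 [continuous_intros]:
  "continuous_on S f \<Longrightarrow> continuous_on S (\<lambda>x. norm1 (f x))"
  unfolding norm1_def by (intro continuous_intros)

lemma borel_measurable_norm1 [measurable]: "norm1 \<in> borel_measurable borel"
  by (intro borel_measurable_continuous_onI continuous_intros)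

lemma compact_cball1: "compact (cball1 r :: (real ^ 'n) set)"
proof -
  have "closed (cball1 r :: (real ^ 'n) set)"
    unfolding cball1_def by (intro closed_Collect_le continuous_intros)
  moreover have "bounded (cball1 r :: (real ^ 'n) set)"
    unfolding cball1_def by (rule boundedI[where B=r]) (use norm_le_norm1 order_trans in blast)
  ultimately show ?thesis by (simp add: compact_eq_bounded_closed)
qed

text \<open>Completeness of Lebesgue measure. Superposition maps and the identities between
  integrands are known only almost everywhere, so measurability has to survive changes on null
  sets.\<close>

lemma borel_measurable_lebesgue_on_AE:
  fixes f :: "real \<Rightarrow> 'b::euclidean_space"
  assumes "f \<in> borel_measurable (lebesgue_on S)" "S \<in> sets lebesgue"
    and "AE x in lebesgue_on S. f x = g x"
  shows "g \<in> borel_measurable (lebesgue_on S)"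
proof (rule borel_measurable_if_D, rule borel_measurable_AE)
  show "(\<lambda>x. if x \<in> S then f x else 0) \<in> borel_measurable lebesgue"
    using assms by (simp add: borel_measurable_if_I)
  show "AE x in lebesgue. (if x \<in> S then f x else 0) = (if x \<in> S then g x else 0)"
    using assms(3) assms(2) by (auto simp: AE_restrict_space_iff)
qed

lemma AE_lebesgue_on: "AE t in lebesgue. P t \<Longrightarrow> J \<in> sets lebesgue \<Longrightarrow> AE t in lebesgue_on J. P t"
  by (auto simp: AE_restrict_space_iff elim: eventually_mono)

lemma AE_lebesgue_on_mono:
  assumes "AE t in lebesgue_on J. P t" "J \<in> sets lebesgue" "J' \<in> sets lebesgue" "J' \<subseteq> J"
  shows "AE t in lebesgue_on J'. P t"
  using assms by (auto simp: AE_restrict_space_iff elim: eventually_mono)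

lemma AE_mem_lebesgue_on: "AE t in lebesgue_on J. t \<in> J"
  using AE_space[of "lebesgue_on J"] by simp

lemma integrable_lebesgue_on_mono:
  fixes g :: "real \<Rightarrow> 'b::euclidean_space"
  assumes "integrable (lebesgue_on J) g" "J \<in> sets lebesgue" "J' \<in> sets lebesgue" "J' \<subseteq> J"
  shows "integrable (lebesgue_on J') g"
proof -
  have "set_integrable lebesgue J g"
    using assms by (simp add: set_integrable_def integrable_restrict_space)
  then have "set_integrable lebesgue J' g"
    using assms by (auto intro: set_integrable_subset)
  then show ?thesis
    using assms by (simp add: set_integrable_def integrable_restrict_space)
qed

lemma integrable_lebesgue_on_iff:
  fixes g :: "real \<Rightarrow> 'b::euclidean_space"
  shows "J \<in> sets lebesgue \<Longrightarrow> integrable (lebesgue_on J) g \<longleftrightarrow> set_integrable lebesgue J g"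
  by (simp add: set_integrable_def integrable_restrict_space)

lemma set_lebesgue_integral_eq:
  fixes g :: "real \<Rightarrow> 'b::euclidean_space"
  shows "J \<in> sets lebesgue \<Longrightarrow> (LINT t:J|lebesgue. g t) = (LINT t|lebesgue_on J. g t)"
  by (simp add: set_lebesgue_integral_def integral_restrict_space)

text \<open>Continuity on the carrier is free because its topology is discrete; compactness of
  \<open>closure U\<close> supplies the bound.\<close>

lemma CU_I:
  fixes h :: "real ^ 'm \<Rightarrow> 'b::real_normed_vector"
  assumes "bounded U" "continuous_on (closure U) h"
  shows "\<exists>w\<in>CU U. \<forall>x. ev w x = (if x \<in> closure U then h x else 0)"
proof -
  let ?h = "\<lambda>d. if of_discrete d \<in> closure U then h (of_discrete d) else 0"
  have "bounded (h ` closure U)"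
    using assms compact_continuous_image compact_imp_bounded by (metis compact_closure)
  then have "bounded (insert 0 (h ` closure U))"
    by simp
  then have "bounded (range ?h)"
    by (rule bounded_subset) auto
  moreover have "continuous_on UNIV ?h"
    by (simp add: continuous_on_open_vimage open_discrete)
  ultimately have "?h \<in> bcontfun"
    by (simp add: bcontfun_def)
  then have "ev (Bcontfun ?h) x = (if x \<in> closure U then h x else 0)" for x
    by (simp add: ev_def Bcontfun_inverse discrete_inverse)
  moreover from this have "Bcontfun ?h \<in> CU U"
    using assms(2) by (simp add: CU_def)
  ultimately show ?thesis by blast
qed

locale state_domain =
  fixes U :: "(real ^ 'm::finite) set" and bc :: "('n::finite, real ^ 'm) bc"
  assumes bounded_U: "bounded U" and nonempty_U: "U \<noteq> {}"
begin

abbreviation X :: "('m, real ^ 'n) bfun set" where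
  "X \<equiv> state_space U bc"

lemma closure_nonempty: "closure U \<noteq> {}"
  using nonempty_U by simp

lemma compact_clU: "compact (closure U)"
  using bounded_U by (simp add: compact_closure)

lemma bdd_xnorm: "bdd_above ((\<lambda>x. norm1 (ev z x)) ` S)" for z :: "('m, real ^ 'n) bfun"
proof (rule bdd_aboveI2)
  fix x show "norm1 (ev z x) \<le> real CARD('n) * norm z"
    by (rule order_trans[OF norm1_le_norm]) (simp add: mult_left_mono norm_ev_le)
qed

lemma norm1_ev_le: "x \<in> closure U \<Longrightarrow> norm1 (ev z x) \<le> xnorm U z" for z :: "('m, real ^ 'n) bfun"
  unfolding xnorm_def by (rule cSUP_upper[OF _ bdd_xnorm])

lemma xnorm_leI: "(\<And>x. x \<in> closure U \<Longrightarrow> norm1 (ev z x) \<le> B) \<Longrightarrow> xnorm U z \<le> B"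
  for z :: "('m, real ^ 'n) bfun"
  unfolding xnorm_def by (rule cSUP_least[OF closure_nonempty])

lemma xnorm_nonneg [simp]: "0 \<le> xnorm U z" for z :: "('m, real ^ 'n) bfun"
proof -
  obtain x where "x \<in> closure U" using closure_nonempty by (metis ex_in_conv)
  from norm1_ev_le[OF this, of z] show ?thesis
    using norm1_nonneg[of "ev z x"] by linarith
qed

lemma xnorm_zero [simp]: "xnorm U (0::('m, real ^ 'n) bfun) = 0"
  using xnorm_leI[of 0 0] xnorm_nonneg[of 0] by simp

lemma xnorm_triangle: "xnorm U (a + b) \<le> xnorm U a + xnorm U b" for a :: "('m, real ^ 'n) bfun"
proof (rule xnorm_leI)
  fix x assume x: "x \<in> closure U"
  show "norm1 (ev (a + b) x) \<le> xnorm U a + xnorm U b"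
    using norm1_triangle[of "ev a x" "ev b x"] norm1_ev_le[OF x, of a] norm1_ev_le[OF x, of b] by simp
qed

lemma xnorm_scaleR: "xnorm U (c *\<^sub>R a) = \<bar>c\<bar> * xnorm U a" for a :: "('m, real ^ 'n) bfun"
proof (rule antisym)
  show le: "xnorm U (c *\<^sub>R a) \<le> \<bar>c\<bar> * xnorm U a" for c and a :: "('m, real ^ 'n) bfun"
    by (rule xnorm_leI) (simp add: norm1_scaleR mult_left_mono norm1_ev_le)
  show "\<bar>c\<bar> * xnorm U a \<le> xnorm U (c *\<^sub>R a)"
  proof (cases "c = 0")
    case False
    have "xnorm U ((1 / c) *\<^sub>R (c *\<^sub>R a)) \<le> \<bar>1 / c\<bar> * xnorm U (c *\<^sub>R a)"
      by (rule le)
    with False show ?thesis by (simp add: field_simps)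
  qed simp
qed

lemma xnorm_minus [simp]: "xnorm U (- a) = xnorm U a" for a :: "('m, real ^ 'n) bfun"
  using xnorm_scaleR[of "-1" a] by simp

lemma xnorm_diff: "xnorm U (a - b) \<le> xnorm U a + xnorm U b" for a :: "('m, real ^ 'n) bfun"
  using xnorm_triangle[of a "- b"] by simp

lemma xnorm_commute: "xnorm U (a - b) = xnorm U (b - a)" for a :: "('m, real ^ 'n) bfun"
  using xnorm_minus[of "a - b"] by simp

lemma xnorm_abs_diff: "\<bar>xnorm U a - xnorm U b\<bar> \<le> xnorm U (a - b)" for a :: "('m, real ^ 'n) bfun"
  using xnorm_triangle[of "a - b" b] xnorm_triangle[of "b - a" a] xnorm_commute[of a b] by simp

lemma xnorm_le_norm: "xnorm U z \<le> real CARD('n) * norm z" for z :: "('m, real ^ 'n) bfun"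
proof (rule xnorm_leI)
  fix x
  show "norm1 (ev z x) \<le> real CARD('n) * norm z"
    by (rule order_trans[OF norm1_le_norm]) (simp add: mult_left_mono norm_ev_le)
qed

text \<open>The library norm also sees points outside \<open>closure U\<close>, where
  \<open>xnorm\<close> is blind; membership in \<open>CU U\<close> makes the values there
  zero.\<close>

lemma norm_le_xnorm: "z \<in> CU U \<Longrightarrow> norm z \<le> xnorm U z" for z :: "('m, real ^ 'n) bfun"
proof (rule norm_le_ev)
  fix x assume "z \<in> CU U"
  then show "norm (ev z x) \<le> xnorm U z"
    by (cases "x \<in> closure U")
      (auto simp: CU_def intro: order_trans[OF norm_le_norm1 norm1_ev_le])
qed

lemma continuous_on_xnorm [continuous_intros]:
  fixes h :: "'t::topological_space \<Rightarrow> ('m, real ^ 'n) bfun"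
  assumes "continuous_on S h"
  shows "continuous_on S (\<lambda>t. xnorm U (h t))"
proof -
  have "(real CARD('n))-lipschitz_on UNIV (xnorm U :: ('m, real ^ 'n) bfun \<Rightarrow> real)"
    by (rule lipschitz_onI)
      (auto simp: dist_norm intro: order_trans[OF xnorm_abs_diff xnorm_le_norm])
  then have "continuous_on UNIV (xnorm U :: ('m, real ^ 'n) bfun \<Rightarrow> real)"
    by (rule lipschitz_on_continuous_on)
  then show ?thesis
    using continuous_on_compose2[OF _ assms] by blast
qed

lemma X_CU: "z \<in> X \<Longrightarrow> z \<in> CU U"
  by (simp add: state_space_def)

lemma X_zero [simp]: "0 \<in> X"
  by (simp add: state_space_def CU_def)

lemma X_add: "a \<in> X \<Longrightarrow> b \<in> X \<Longrightarrow> a + b \<in> X"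
  by (auto simp: state_space_def CU_def intro: continuous_intros)

lemma X_scaleR: "a \<in> X \<Longrightarrow> c *\<^sub>R a \<in> X"
  by (auto simp: state_space_def CU_def intro: continuous_intros)

lemma X_diff: "a \<in> X \<Longrightarrow> b \<in> X \<Longrightarrow> a - b \<in> X"
  by (auto simp: state_space_def CU_def intro: continuous_intros)

lemma X_sum: "(\<And>i. i \<in> A \<Longrightarrow> f i \<in> X) \<Longrightarrow> sum f A \<in> X"
  by (induction A rule: infinite_finite_induct) (auto intro: X_add)

lemma X_outside: "z \<in> X \<Longrightarrow> x \<notin> closure U \<Longrightarrow> ev z x = 0"
  by (simp add: state_space_def CU_def)

lemma X_eqI: "a \<in> X \<Longrightarrow> b \<in> X \<Longrightarrow> (\<And>x. x \<in> closure U \<Longrightarrow> ev a x = ev b x) \<Longrightarrow> a = b"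
  by (rule ev_eqI) (metis X_outside)

lemma X_closed_seq:
  assumes w: "\<And>k. w k \<in> X" and lim: "w \<longlonglongrightarrow> z"
  shows "z \<in> X"
proof -
  have ul: "uniform_limit (closure U) (\<lambda>k x. ev (w k) x) (ev z) sequentially"
  proof (rule uniform_limitI)
    fix e :: real assume "0 < e"
    from tendstoD[OF lim this] show "\<forall>\<^sub>F k in sequentially. \<forall>x\<in>closure U. dist (ev (w k) x) (ev z x) < e"
      by eventually_elim (auto simp: dist_norm simp flip: ev_simps intro: le_less_trans[OF norm_ev_le])
  qed
  have "continuous_on (closure U) (ev z)"
    by (rule uniform_limit_theorem[OF _ ul]) (use w in \<open>auto simp: state_space_def CU_def\<close>)
  moreover have "ev z x = 0" if "\<And>k. ev (w k) x = 0" for x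
    using ev_tendsto[OF lim, of x] that by (simp add: LIMSEQ_const_iff)
  ultimately show ?thesis
    using w by (auto simp: state_space_def CU_def)
qed

lemma closed_X: "closed X"
  unfolding closed_sequential_limits using X_closed_seq by blast

text \<open>
  A partition of unity \<open>\<phi>\<close> on \<open>closure U\<close> with centres \<open>D0\<close>; for Dirichlet conditions only the bumps with centres in
  \<open>D\<close> vanish on the boundary, and the others have their centres near the boundary, where elements of \<open>X\<close> are small.
\<close>

lemma partition_of_unity:
  assumes "0 < e"
  obtains D0 D :: "(real ^ 'm) set" and \<phi> :: "real ^ 'm \<Rightarrow> real ^ 'm \<Rightarrow> real"
  where "finite D0" "D \<subseteq> D0" "D \<subseteq> closure U"
    and "\<And>d. d \<in> D0 \<Longrightarrow> continuous_on (closure U) (\<phi> d)"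
    and "\<And>d x. d \<in> D0 \<Longrightarrow> x \<in> closure U \<Longrightarrow> 0 \<le> \<phi> d x"
    and "\<And>x. x \<in> closure U \<Longrightarrow> (\<Sum>d\<in>D0. \<phi> d x) = 1"
    and "\<And>d x. d \<in> D0 \<Longrightarrow> \<phi> d x \<noteq> 0 \<Longrightarrow> dist x d < e"
    and "\<And>d x. bc = Dirichlet \<Longrightarrow> d \<in> D \<Longrightarrow> x \<in> frontier U \<Longrightarrow> \<phi> d x = 0"
    and "\<And>d. d \<in> D0 - D \<Longrightarrow> bc = Dirichlet \<and> (\<exists>y\<in>frontier U. dist y d < e)"
proof -
  obtain D0 where D0: "finite D0" "D0 \<subseteq> closure U" "closure U \<subseteq> (\<Union>d\<in>D0. ball d e)"
    using compactE_image[OF compact_clU, of "closure U" "\<lambda>d. ball d e"] assms by force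
  define \<psi> where "\<psi> d x = max 0 (e - dist x d)" for d x :: "real ^ 'm"
  define \<sigma> where "\<sigma> x = (\<Sum>d\<in>D0. \<psi> d x)" for x
  have \<sigma>: "0 < \<sigma> x" if x: "x \<in> closure U" for x
  proof -
    obtain d where "d \<in> D0" "dist x d < e"
      using D0(3) x by (auto simp: dist_commute)
    then show ?thesis
      unfolding \<sigma>_def by (intro sum_pos2[OF D0(1)]) (auto simp: \<psi>_def)
  qed
  define \<phi> where "\<phi> d x = \<psi> d x / \<sigma> x" for d x
  \<comment> \<open>The tent at \<open>d\<close> is positive exactly at distance less than
    \<open>e\<close> from \<open>d\<close>, so it vanishes on the boundary precisely when no
    boundary point is that close.\<close>
  define D where "D = {d \<in> D0. bc = Dirichlet \<longrightarrow> (\<forall>y\<in>frontier U. e \<le> dist y d)}"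
  show thesis
  proof
    show "finite D0" "D \<subseteq> D0" "D \<subseteq> closure U"
      using D0 by (auto simp: D_def)
    show "continuous_on (closure U) (\<phi> d)" for d
      unfolding \<phi>_def using \<sigma> unfolding \<sigma>_def \<psi>_def
      by (intro continuous_intros) (simp add: less_imp_neq[symmetric] order_less_imp_not_eq2)
    show "0 \<le> \<phi> d x" if "x \<in> closure U" for d x
      using \<sigma>[OF that] by (simp add: \<phi>_def \<psi>_def)
    show "(\<Sum>d\<in>D0. \<phi> d x) = 1" if "x \<in> closure U" for x
      using \<sigma>[OF that] by (simp add: \<phi>_def sum_divide_distrib[symmetric] \<sigma>_def)
    show "dist x d < e" if "\<phi> d x \<noteq> 0" for d x
      using that by (auto simp: \<phi>_def \<psi>_def max_def split: if_splits)
    show "\<phi> d x = 0" if "bc = Dirichlet" "d \<in> D" "x \<in> frontier U" for d x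
      using that by (auto simp: \<phi>_def \<psi>_def D_def)
    show "bc = Dirichlet \<and> (\<exists>y\<in>frontier U. dist y d < e)" if "d \<in> D0 - D" for d
      using that by (auto simp: D_def not_le)
  qed
qed

text \<open>The operator samples \<open>z\<close> at the centres and interpolates with the bumps; an
  index \<open>p\<close> pairs a centre with a coordinate. The weights are nonnegative with sum at
  most 1, which gives the contraction bound. The error at \<open>x\<close> is a weighted average of
  differences between \<open>ev z x\<close> and values of \<open>z\<close> at points closer than
  \<open>2 * e\<close>.\<close>

lemma finite_rank_step:
  assumes "0 < e"
  shows "\<exists>A b. finite A \<and> (\<forall>p\<in>A. fst p \<in> closure U \<and> b p \<in> X) \<and>
    (\<forall>z\<in>X. norm (\<Sum>p\<in>A. (ev z (fst p) $ snd p) *\<^sub>R b p) \<le> norm z) \<and>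
    (\<forall>z\<in>X. \<forall>\<eta>\<ge>0. (\<forall>x\<in>closure U. \<forall>y\<in>closure U. dist x y < 2 * e \<longrightarrow> norm (ev z x - ev z y) \<le> \<eta>) \<longrightarrow>
       norm ((\<Sum>p\<in>A. (ev z (fst p) $ snd p) *\<^sub>R b p) - z) \<le> \<eta>)"
proof -
  obtain D0 D and \<phi> :: "real ^ 'm \<Rightarrow> real ^ 'm \<Rightarrow> real" where D: "finite D0" "D \<subseteq> D0" "D \<subseteq> closure U"
    and cont: "\<And>d. d \<in> D0 \<Longrightarrow> continuous_on (closure U) (\<phi> d)"
    and nn: "\<And>d x. d \<in> D0 \<Longrightarrow> x \<in> closure U \<Longrightarrow> 0 \<le> \<phi> d x"
    and one: "\<And>x. x \<in> closure U \<Longrightarrow> (\<Sum>d\<in>D0. \<phi> d x) = 1"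
    and loc: "\<And>d x. d \<in> D0 \<Longrightarrow> \<phi> d x \<noteq> 0 \<Longrightarrow> dist x d < e"
    and fr: "\<And>d x. bc = Dirichlet \<Longrightarrow> d \<in> D \<Longrightarrow> x \<in> frontier U \<Longrightarrow> \<phi> d x = 0"
    and drop: "\<And>d. d \<in> D0 - D \<Longrightarrow> bc = Dirichlet \<and> (\<exists>y\<in>frontier U. dist y d < e)"
    by (rule partition_of_unity[OF assms]) (rule that)
  have fin: "finite D" using D finite_subset by blast
  define P where "P p w \<longleftrightarrow> w \<in> CU U \<and>
      (\<forall>x. ev w x = (if x \<in> closure U then \<phi> (fst p) x *\<^sub>R axis (snd p) (1::real) else 0))"
    for p :: "(real ^ 'm) \<times> 'n" and w
  define b where "b p = (SOME w. P p w)" for p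
  have P: "P p (b p)" if p: "p \<in> D \<times> UNIV" for p
  proof -
    have "continuous_on (closure U) (\<lambda>x. \<phi> (fst p) x *\<^sub>R axis (snd p) (1::real))"
      using cont[of "fst p"] p D(2) by (auto intro!: continuous_intros)
    from CU_I[OF bounded_U this] have "\<exists>w. P p w"
      by (auto simp: P_def)
    then show ?thesis
      unfolding b_def by (rule someI_ex)
  qed
  have evb: "ev (b p) x = (if x \<in> closure U then \<phi> (fst p) x *\<^sub>R axis (snd p) 1 else 0)"
    if "p \<in> D \<times> UNIV" for p x
    using P[OF that] by (simp add: P_def)
  define Q where "Q z = (\<Sum>p\<in>D \<times> UNIV. (ev z (fst p) $ snd p) *\<^sub>R b p)" for z
  have bX: "b p \<in> X" if "p \<in> D \<times> UNIV" for p
  proof -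
    have "b p \<in> CU U" using P[OF that] by (simp add: P_def)
    moreover have "ev (b p) x = 0" if "bc = Dirichlet" "x \<in> frontier U" for x
      using evb[OF \<open>p \<in> _\<close>, of x] fr[OF that(1) _ that(2), of "fst p"] \<open>p \<in> _\<close> by auto
    ultimately show ?thesis by (simp add: state_space_def)
  qed
  have evQ: "ev (Q z) x = (\<Sum>d\<in>D. \<phi> d x *\<^sub>R ev z d)" if "x \<in> closure U" for z x
  proof -
    have "ev (Q z) x = (\<Sum>d\<in>D. \<Sum>i\<in>UNIV. (ev z d $ i) *\<^sub>R (\<phi> d x *\<^sub>R axis i 1))"
      unfolding Q_def ev_sum sum.cartesian_product
      by (rule sum.cong) (use that in \<open>auto simp: evb\<close>)
    also have "\<dots> = (\<Sum>d\<in>D. \<phi> d x *\<^sub>R ev z d)"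
    proof (rule sum.cong[OF refl])
      fix d
      have "(\<Sum>i\<in>UNIV. (ev z d $ i) *\<^sub>R (\<phi> d x *\<^sub>R axis i 1)) = \<phi> d x *\<^sub>R (\<Sum>i\<in>UNIV. (ev z d $ i) *s axis i 1)"
        by (simp add: scaleR_sum_right scalar_mult_eq_scaleR mult.commute)
      also have "\<dots> = \<phi> d x *\<^sub>R ev z d"
        by (simp only: basis_expansion)
      finally show "(\<Sum>i\<in>UNIV. (ev z d $ i) *\<^sub>R (\<phi> d x *\<^sub>R axis i 1)) = \<phi> d x *\<^sub>R ev z d" .
    qed
    finally show ?thesis .
  qed
  have QX: "Q z \<in> X" for z
    unfolding Q_def by (intro X_sum X_scaleR bX)
  have "norm (Q z) \<le> norm z" for z
  proof (rule norm_le_ev)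
    fix x show "norm (ev (Q z) x) \<le> norm z"
    proof (cases "x \<in> closure U")
      case True
      have "norm (ev (Q z) x) \<le> (\<Sum>d\<in>D. norm (\<phi> d x *\<^sub>R ev z d))"
        unfolding evQ[OF True] by (rule norm_sum)
      also have "\<dots> \<le> (\<Sum>d\<in>D. \<phi> d x * norm z)"
      proof (rule sum_mono)
        fix d assume "d \<in> D"
        then have "0 \<le> \<phi> d x" using nn[OF _ True] D(2) by blast
        then show "norm (\<phi> d x *\<^sub>R ev z d) \<le> \<phi> d x * norm z"
          by (simp add: mult_left_mono norm_ev_le)
      qed
      also have "\<dots> \<le> (\<Sum>d\<in>D0. \<phi> d x * norm z)"
        using D(1,2) by (rule sum_mono2) (simp add: nn[OF _ True])
      also have "\<dots> = norm z"
        using one[OF True] by (simp add: sum_distrib_right[symmetric])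
      finally show ?thesis .
    qed (use X_outside[OF QX] in simp)
  qed
  moreover have "norm (Q z - z) \<le> \<eta>" if z: "z \<in> X" and "0 \<le> \<eta>"
    and osc: "\<And>x y. x \<in> closure U \<Longrightarrow> y \<in> closure U \<Longrightarrow> dist x y < 2 * e \<Longrightarrow> norm (ev z x - ev z y) \<le> \<eta>"
    for z \<eta>
  proof (rule norm_le_ev)
    fix x show "norm (ev (Q z - z) x) \<le> \<eta>"
    proof (cases "x \<in> closure U")
      case True
      \<comment> \<open>The dropped bumps stay in the sum with sampled value 0. The weights then
        still sum to 1, and \<open>ev z x\<close> can be moved into the average.\<close>
      define c where "c d = (if d \<in> D then ev z d else 0)" for d
      have "ev (Q z - z) x = (\<Sum>d\<in>D0. \<phi> d x *\<^sub>R c d) - (\<Sum>d\<in>D0. \<phi> d x) *\<^sub>R ev z x"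
      proof -
        have "(\<Sum>d\<in>D0. \<phi> d x *\<^sub>R c d) = (\<Sum>d\<in>D. \<phi> d x *\<^sub>R ev z d)"
          using D by (intro sum.mono_neutral_cong_right) (auto simp: c_def)
        then show ?thesis using evQ[OF True] one[OF True] by simp
      qed
      also have "\<dots> = (\<Sum>d\<in>D0. \<phi> d x *\<^sub>R (c d - ev z x))"
        by (simp add: scaleR_diff_right sum_subtractf scaleR_sum_left)
      finally have "norm (ev (Q z - z) x) \<le> (\<Sum>d\<in>D0. norm (\<phi> d x *\<^sub>R (c d - ev z x)))"
        by (simp only: norm_sum)
      also have "\<dots> \<le> (\<Sum>d\<in>D0. \<phi> d x * \<eta>)"
      proof (rule sum_mono)
        fix d assume d: "d \<in> D0"
        show "norm (\<phi> d x *\<^sub>R (c d - ev z x)) \<le> \<phi> d x * \<eta>"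
        proof (cases "\<phi> d x = 0")
          case False
          have lx: "dist x d < e" using loc[OF d False] .
          have "norm (c d - ev z x) \<le> \<eta>"
          proof (cases "d \<in> D")
            case dD: True
            then show ?thesis
              using osc[of d x] True D(3) lx assms by (auto simp: c_def dist_commute)
          next
            case False
            then obtain y where y: "bc = Dirichlet" "y \<in> frontier U" "dist y d < e"
              using drop d by blast
            \<comment> \<open>The sampled value 0 is the value of \<open>z\<close> at the boundary
              point \<open>y\<close>; passing from \<open>x\<close> to \<open>y\<close> through
              \<open>d\<close> doubles the radius.\<close>
            have "dist x y < 2 * e"
              using dist_triangle2[of x y d] lx y(3) by simp
            moreover have "y \<in> closure U"
              using y(2) by (simp add: frontier_def)
            ultimately have "norm (ev z x - ev z y) \<le> \<eta>"
              using osc True by blast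
            then show ?thesis
              using y(1,2) z False by (simp add: c_def state_space_def)
          qed
          then show ?thesis using nn[OF d True] by (simp add: mult_left_mono)
        qed simp
      qed
      also have "\<dots> = \<eta>"
        using one[OF True] by (simp add: sum_distrib_right[symmetric])
      finally show ?thesis .
    qed (use X_outside[OF QX] X_outside[OF z] that(2) in simp)
  qed
  ultimately show ?thesis
    using fin bX D(3) unfolding Q_def[symmetric]
    by (intro exI[of _ "D \<times> UNIV"] exI[of _ b] conjI ballI allI impI) (auto simp: Q_def[symmetric])
qed

text \<open>Radii \<open>1 / Suc k\<close> and uniform continuity on the compact closure give strong
  convergence to the identity. Measurability and integration of \<open>X\<close>-valued maps thereby
  reduce to finitely many scalar coefficients and fixed vectors \<open>b k p\<close>.\<close>

lemma finite_rank_approximation: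
  obtains A :: "nat \<Rightarrow> ((real ^ 'm) \<times> 'n) set" and b :: "nat \<Rightarrow> (real ^ 'm) \<times> 'n \<Rightarrow> ('m, real ^ 'n) bfun"
  where "\<And>k. finite (A k)" "\<And>k p. p \<in> A k \<Longrightarrow> fst p \<in> closure U" "\<And>k p. p \<in> A k \<Longrightarrow> b k p \<in> X"
    and "\<And>z k. z \<in> X \<Longrightarrow> norm (\<Sum>p\<in>A k. (ev z (fst p) $ snd p) *\<^sub>R b k p) \<le> norm z"
    and "\<And>z. z \<in> X \<Longrightarrow> (\<lambda>k. \<Sum>p\<in>A k. (ev z (fst p) $ snd p) *\<^sub>R b k p) \<longlonglongrightarrow> z"
proof -
  define P where "P e A b \<longleftrightarrow> finite A \<and> (\<forall>p\<in>A. fst p \<in> closure U \<and> b p \<in> X) \<and>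
    (\<forall>z\<in>X. norm (\<Sum>p\<in>A. (ev z (fst p) $ snd p) *\<^sub>R b p) \<le> norm z) \<and>
    (\<forall>z\<in>X. \<forall>\<eta>\<ge>0. (\<forall>x\<in>closure U. \<forall>y\<in>closure U. dist x y < 2 * e \<longrightarrow> norm (ev z x - ev z y) \<le> \<eta>) \<longrightarrow>
       norm ((\<Sum>p\<in>A. (ev z (fst p) $ snd p) *\<^sub>R b p) - z) \<le> \<eta>)"
    for e and A :: "((real ^ 'm) \<times> 'n) set" and b
  have "\<exists>A b. P (1 / real (Suc k)) A b" for k
    unfolding P_def by (rule finite_rank_step) simp
  then have "\<exists>q. P (1 / real (Suc k)) (fst q) (snd q)" for k
    by simp
  then obtain q where q: "\<And>k. P (1 / real (Suc k)) (fst (q k)) (snd (q k))"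
    by metis
  define A where "A k = fst (q k)" for k
  define b where "b k = snd (q k)" for k
  have Ab: "finite (A k)" "\<And>p. p \<in> A k \<Longrightarrow> fst p \<in> closure U" "\<And>p. p \<in> A k \<Longrightarrow> b k p \<in> X"
    "\<And>z. z \<in> X \<Longrightarrow> norm (\<Sum>p\<in>A k. (ev z (fst p) $ snd p) *\<^sub>R b k p) \<le> norm z"
    and cv: "\<And>z \<eta>. z \<in> X \<Longrightarrow> 0 \<le> \<eta> \<Longrightarrow>
        (\<forall>x\<in>closure U. \<forall>y\<in>closure U. dist x y < 2 * (1 / real (Suc k)) \<longrightarrow> norm (ev z x - ev z y) \<le> \<eta>) \<Longrightarrow>
        norm ((\<Sum>p\<in>A k. (ev z (fst p) $ snd p) *\<^sub>R b k p) - z) \<le> \<eta>" for k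
    using q[of k] unfolding P_def A_def b_def by blast+
  have lim: "(\<lambda>k. \<Sum>p\<in>A k. (ev z (fst p) $ snd p) *\<^sub>R b k p) \<longlonglongrightarrow> z" if z: "z \<in> X" for z
  proof (rule metric_LIMSEQ_I)
    fix r :: real assume "0 < r"
    have "uniformly_continuous_on (closure U) (ev z)"
      using z compact_uniformly_continuous[OF _ compact_clU] by (auto simp: state_space_def CU_def)
    then obtain d where d: "0 < d" "\<And>x y. x \<in> closure U \<Longrightarrow> y \<in> closure U \<Longrightarrow> dist x y < d \<Longrightarrow> dist (ev z x) (ev z y) < r / 2"
      unfolding uniformly_continuous_on_def using \<open>0 < r\<close> by (metis dist_commute half_gt_zero)
    obtain K where K: "1 / real (Suc K) < d / 2"
      using nat_approx_posE[of "d / 2"] d(1) by auto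
    show "\<exists>k0. \<forall>k\<ge>k0. dist (\<Sum>p\<in>A k. (ev z (fst p) $ snd p) *\<^sub>R b k p) z < r"
    proof (intro exI allI impI)
      fix k assume "K \<le> k"
      then have "1 / real (Suc k) \<le> 1 / real (Suc K)"
        by (simp add: frac_le)
      then have "2 * (1 / real (Suc k)) < d" using K by linarith
      then have "norm ((\<Sum>p\<in>A k. (ev z (fst p) $ snd p) *\<^sub>R b k p) - z) \<le> r / 2"
        using d(2) \<open>0 < r\<close> by (intro cv[OF z]) (auto simp: dist_norm less_imp_le)
      then show "dist (\<Sum>p\<in>A k. (ev z (fst p) $ snd p) *\<^sub>R b k p) z < r"
        using \<open>0 < r\<close> by (simp add: dist_norm)
    qed
  qed
  show thesis
    by (rule that[of A b]) (rule Ab lim, assumption?)+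
qed

end

section \<open>Bochner integrals of functions with values in the state space\<close>

text \<open>Evaluation at a point is linear and contractive, so it carries along the approximating
  simple functions and their integrals. Measurability of the evaluated map is a separate assumption
  because \<open>bochner_on\<close> only asks for measurable distances.\<close>

lemma has_bochner_integral_ev:
  fixes w :: "('m::finite, real ^ 'n) bfun"
  assumes w: "bochner_on J g w" and meas: "(\<lambda>t. ev (g t) x) \<in> borel_measurable (lebesgue_on J)"
  shows "has_bochner_integral (lebesgue_on J) (\<lambda>t. ev (g t) x) (ev w x)"
proof -
  obtain s where s: "\<And>k. Bochner_Integration.simple_bochner_integrable (lebesgue_on J) (s k)"
    and lim0: "(\<lambda>k. \<integral>\<^sup>+ t. ennreal (norm (g t - s k t)) \<partial>lebesgue_on J) \<longlonglongrightarrow> 0"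
    and limw: "(\<lambda>k. Bochner_Integration.simple_bochner_integral (lebesgue_on J) (s k)) \<longlonglongrightarrow> w"
    using w unfolding bochner_on_def by blast
  have lin: "linear (\<lambda>z::('m, real ^ 'n) bfun. ev z x)"
    using bounded_linear_ev by (rule bounded_linear.linear)
  show ?thesis
  proof (rule has_bochner_integral.intros[OF meas, where s="\<lambda>k t. ev (s k t) x"])
    show "Bochner_Integration.simple_bochner_integrable (lebesgue_on J) (\<lambda>t. ev (s k t) x)" for k
      using simple_bochner_integrable_compose2[where p="\<lambda>a b. ev a x", OF _ s[of k] s[of k]] by simp
    show "(\<lambda>k. \<integral>\<^sup>+ t. ennreal (norm (ev (g t) x - ev (s k t) x)) \<partial>lebesgue_on J) \<longlonglongrightarrow> 0"
    proof (rule tendsto_sandwich[OF _ _ tendsto_const lim0])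
      show "\<forall>\<^sub>F k in sequentially. (\<integral>\<^sup>+ t. ennreal (norm (ev (g t) x - ev (s k t) x)) \<partial>lebesgue_on J)
        \<le> (\<integral>\<^sup>+ t. ennreal (norm (g t - s k t)) \<partial>lebesgue_on J)"
        by (intro always_eventually allI nn_integral_mono ennreal_leI)
          (simp add: norm_ev_le flip: ev_simps)
    qed simp
    show "(\<lambda>k. Bochner_Integration.simple_bochner_integral (lebesgue_on J) (\<lambda>t. ev (s k t) x)) \<longlonglongrightarrow> ev w x"
      using ev_tendsto[OF limw, of x] simple_bochner_integral_linear[OF lin s] by simp
  qed
qed

lemma simple_bochner_integrable_sum:
  fixes f :: "'i \<Rightarrow> 'a \<Rightarrow> 'b::real_vector"
  assumes "finite A" "\<And>i. i \<in> A \<Longrightarrow> Bochner_Integration.simple_bochner_integrable M (f i)"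
  shows "Bochner_Integration.simple_bochner_integrable M (\<lambda>t. \<Sum>i\<in>A. f i t)"
  using assms
proof (induction A rule: finite_induct)
  case empty
  show ?case by (rule simple_bochner_integrable.intros) auto
next
  case (insert i A)
  then show ?case
    using simple_bochner_integrable_compose2[where p="(+)" and f="f i" and g="\<lambda>t. \<Sum>i\<in>A. f i t" and M=M]
    by simp
qed

lemma integrable_simple_approx:
  fixes c :: "'a \<Rightarrow> real"
  assumes "integrable M c" "0 < e"
  obtains s where "Bochner_Integration.simple_bochner_integrable M s" "(\<integral>\<^sup>+ t. ennreal \<bar>c t - s t\<bar> \<partial>M) < ennreal e"
proof -
  obtain y where "has_bochner_integral M c y"
    using assms(1) by (auto elim: integrable.cases)
  then show thesis
  proof cases
    case (1 s)
    have "0 < ennreal e" using assms(2) by simp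
    with 1(3) have "\<forall>\<^sub>F i in sequentially. (\<integral>\<^sup>+ t. ennreal (norm (c t - s i t)) \<partial>M) < ennreal e"
      by (rule order_tendstoD)
    then obtain i where "(\<integral>\<^sup>+ t. ennreal (norm (c t - s i t)) \<partial>M) < ennreal e"
      by (auto simp: eventually_sequentially)
    then show thesis
      using that[OF 1(2)] by simp
  qed
qed

context state_domain
begin

text \<open>
  Integrability of an \<open>X\<close>-valued map in terms of its point evaluations: since \<open>X\<close> is separable, this is
  enough for Bochner integrability.
\<close>

definition xint :: "real set \<Rightarrow> (real \<Rightarrow> ('m, real ^ 'n) bfun) \<Rightarrow> bool" where
  "xint J g \<longleftrightarrow> J \<in> sets lebesgue \<and> (AE t in lebesgue_on J. g t \<in> X) \<and>
     (\<forall>x\<in>closure U. (\<lambda>t. ev (g t) x) \<in> borel_measurable (lebesgue_on J)) \<and>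
     (\<exists>m. integrable (lebesgue_on J) m \<and> (AE t in lebesgue_on J. xnorm U (g t) \<le> m t))"

lemma countable_dense:
  obtains D where "countable D" "D \<subseteq> closure U" "closure D = closure U" "D \<noteq> {}"
proof -
  obtain D where D: "countable D" "D \<subseteq> closure U" "closure U \<subseteq> closure D"
    using separable[of "closure U"] by blast
  then have eq: "closure D = closure U"
    by (metis closed_closure closure_minimal subset_antisym)
  have "D \<noteq> {}" using eq nonempty_U by (metis closure_eq_empty)
  with D(1,2) eq show thesis by (rule that)
qed

lemma SUP_dense:
  fixes h :: "real ^ 'm \<Rightarrow> real"
  assumes "closure D = closure U" "D \<subseteq> closure U" "D \<noteq> {}" "continuous_on (closure U) h"
    and bdd: "bdd_above (h ` D)" and x: "x \<in> closure U"
  shows "h x \<le> (SUP x\<in>D. h x)"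
  by (rule continuous_le_on_closure[of D h]) (use assms in \<open>auto intro: cSUP_upper\<close>)

text \<open>For a function continuous on \<open>closure U\<close>, the suprema may be taken over a
  countable dense set, and a countable supremum of measurable functions is measurable. For the
  library norm, points outside \<open>closure U\<close> contribute only the value 0.\<close>

lemma measurable_norms:
  fixes g :: "real \<Rightarrow> ('m, real ^ 'n) bfun"
  assumes J: "J \<in> sets lebesgue" and gX: "AE t in lebesgue_on J. g t \<in> CU U"
    and meas: "\<And>x. x \<in> closure U \<Longrightarrow> (\<lambda>t. ev (g t) x) \<in> borel_measurable (lebesgue_on J)"
  shows measurable_xnorm: "(\<lambda>t. xnorm U (g t)) \<in> borel_measurable (lebesgue_on J)"
    and measurable_norm: "(\<lambda>t. norm (g t)) \<in> borel_measurable (lebesgue_on J)"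
proof -
  obtain D where D: "countable D" "D \<subseteq> closure U" "closure D = closure U" "D \<noteq> {}"
    by (rule countable_dense)
  have bdd: "bdd_above ((\<lambda>x. norm (ev z x)) ` D)" for z :: "('m, real ^ 'n) bfun"
    by (rule bdd_aboveI2) (rule norm_ev_le)
  have [measurable]: "(\<lambda>t. ev (g t) x) \<in> borel_measurable (lebesgue_on J)" if "x \<in> D" for x
    using that D meas by blast
  have "(\<lambda>t. SUP x\<in>D. norm1 (ev (g t) x)) \<in> borel_measurable (lebesgue_on J)"
    by (rule borel_measurable_cSUP) (use D bdd_xnorm in \<open>auto intro: measurable_compose[OF _ borel_measurable_norm1]\<close>)
  moreover have "AE t in lebesgue_on J. (SUP x\<in>D. norm1 (ev (g t) x)) = xnorm U (g t)"
    using gX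
  proof eventually_elim
    case (elim t)
    then have cont: "continuous_on (closure U) (\<lambda>x. norm1 (ev (g t) x))"
      by (intro continuous_intros) (simp add: CU_def)
    show ?case
    proof (rule antisym)
      show "(SUP x\<in>D. norm1 (ev (g t) x)) \<le> xnorm U (g t)"
        using D by (intro cSUP_least) (auto intro: norm1_ev_le)
      show "xnorm U (g t) \<le> (SUP x\<in>D. norm1 (ev (g t) x))"
        by (rule xnorm_leI) (rule SUP_dense[OF D(3,2,4) cont bdd_xnorm])
    qed
  qed
  ultimately show "(\<lambda>t. xnorm U (g t)) \<in> borel_measurable (lebesgue_on J)"
    by (rule borel_measurable_lebesgue_on_AE[OF _ J])
  have "(\<lambda>t. SUP x\<in>D. norm (ev (g t) x)) \<in> borel_measurable (lebesgue_on J)"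
    by (rule borel_measurable_cSUP) (use D bdd in auto)
  moreover have "AE t in lebesgue_on J. (SUP x\<in>D. norm (ev (g t) x)) = norm (g t)"
    using gX
  proof eventually_elim
    case (elim t)
    then have cont: "continuous_on (closure U) (\<lambda>x. norm (ev (g t) x))"
      by (intro continuous_intros) (simp add: CU_def)
    obtain d where d: "d \<in> D" using D(4) by blast
    show ?case
    proof (rule antisym)
      show "(SUP x\<in>D. norm (ev (g t) x)) \<le> norm (g t)"
        using D by (intro cSUP_least) (auto intro: norm_ev_le)
      show "norm (g t) \<le> (SUP x\<in>D. norm (ev (g t) x))"
      proof (rule norm_le_ev)
        fix x show "norm (ev (g t) x) \<le> (SUP x\<in>D. norm (ev (g t) x))"
        proof (cases "x \<in> closure U")
          case True
          then show ?thesis by (rule SUP_dense[OF D(3,2,4) cont bdd])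
        next
          case False
          then have "norm (ev (g t) x) \<le> norm (ev (g t) d)"
            using elim by (simp add: CU_def)
          also have "\<dots> \<le> (SUP x\<in>D. norm (ev (g t) x))"
            by (rule cSUP_upper[OF d bdd])
          finally show ?thesis .
        qed
      qed
    qed
  qed
  ultimately show "(\<lambda>t. norm (g t)) \<in> borel_measurable (lebesgue_on J)"
    by (rule borel_measurable_lebesgue_on_AE[OF _ J])
qed

lemma xint_meas: "xint J g \<Longrightarrow> x \<in> closure U \<Longrightarrow> (\<lambda>t. ev (g t) x) \<in> borel_measurable (lebesgue_on J)"
  by (simp add: xint_def)

lemma xint_X: "xint J g \<Longrightarrow> AE t in lebesgue_on J. g t \<in> X"
  by (simp add: xint_def)

lemma xint_sets: "xint J g \<Longrightarrow> J \<in> sets lebesgue"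
  by (simp add: xint_def)

lemma xint_meas_all: "xint J g \<Longrightarrow> (\<lambda>t. ev (g t) x) \<in> borel_measurable (lebesgue_on J)"
proof (cases "x \<in> closure U")
  case False
  assume xi: "xint J g"
  have "AE t in lebesgue_on J. 0 = ev (g t) x"
    using xint_X[OF xi] by eventually_elim (simp add: X_outside False)
  with xint_sets[OF xi] show ?thesis
    by (rule borel_measurable_lebesgue_on_AE[rotated]) simp
qed (rule xint_meas)

lemma xint_integrable_xnorm:
  assumes "xint J g"
  shows "integrable (lebesgue_on J) (\<lambda>t. xnorm U (g t))"
proof -
  obtain m where m: "integrable (lebesgue_on J) m" "AE t in lebesgue_on J. xnorm U (g t) \<le> m t"
    using assms by (auto simp: xint_def)
  have "(\<lambda>t. xnorm U (g t)) \<in> borel_measurable (lebesgue_on J)"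
    using assms by (intro measurable_xnorm) (auto simp: xint_def X_CU elim: eventually_mono)
  then show ?thesis
    using m(2) by (intro Bochner_Integration.integrable_bound[OF m(1)]) (auto elim: eventually_mono)
qed

lemma xint_integrable_ev:
  assumes "xint J g" "x \<in> closure U"
  shows "integrable (lebesgue_on J) (\<lambda>t. ev (g t) x)"
  by (rule Bochner_Integration.integrable_bound[OF xint_integrable_xnorm[OF assms(1)] xint_meas[OF assms]])
    (use assms(2) in \<open>auto intro!: AE_I2 order_trans[OF norm_le_norm1] norm1_ev_le\<close>)

text \<open>There are two approximations. \<open>Q k\<close> samples \<open>g\<close> and tends to
  it in mean by dominated convergence with majorant \<open>2 * xnorm U (g t)\<close>;
  \<open>S k\<close> replaces each scalar coefficient of \<open>Q k\<close> by a simple function.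
  The integrals of \<open>S k\<close> form a Cauchy sequence in the closed space
  \<open>X\<close>.\<close>

lemma bochner_on_exists:
  assumes xi: "xint J g"
  shows "\<exists>w\<in>X. bochner_on J g w"
proof -
  let ?M = "lebesgue_on J"
  obtain A b where A: "\<And>k. finite (A k)" "\<And>k p. p \<in> A k \<Longrightarrow> fst p \<in> closure U" "\<And>k p. p \<in> A k \<Longrightarrow> b k p \<in> X"
    and bnd: "\<And>z k. z \<in> X \<Longrightarrow> norm (\<Sum>p\<in>A k. (ev z (fst p) $ snd p) *\<^sub>R b k p) \<le> norm z"
    and cv: "\<And>z. z \<in> X \<Longrightarrow> (\<lambda>k. \<Sum>p\<in>A k. (ev z (fst p) $ snd p) *\<^sub>R b k p) \<longlonglongrightarrow> z"
    by (rule finite_rank_approximation) (rule that)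
  note J = xint_sets[OF xi]
  define c where "c p t = ev (g t) (fst p) $ snd p" for p t
  define Q where "Q k t = (\<Sum>p\<in>A k. c p t *\<^sub>R b k p)" for k t
  have c_int: "integrable ?M (c p)" if "p \<in> A k" for p k
    unfolding c_def by (rule integrable_bounded_linear[OF bounded_linear_vec_nth])
      (rule xint_integrable_ev[OF xi A(2)[OF that]])
  have QX: "Q k t \<in> X" for k t
    unfolding Q_def by (intro X_sum X_scaleR A(3))
  \<comment> \<open>An error of \<open>1 / (Suc k * \<beta> k)\<close> in each coefficient, weighted
    by the norms of the \<open>b k p\<close>, adds up to at most \<open>1 / Suc k\<close>. The
    summand 1 keeps \<open>\<beta> k\<close> positive even if the sum is zero.\<close>
  define \<beta> where "\<beta> k = 1 + (\<Sum>p\<in>A k. norm (b k p))" for k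
  have \<beta>: "0 < \<beta> k" for k
    unfolding \<beta>_def by (smt (verit) sum_nonneg norm_ge_zero)
  define P where "P k p s \<longleftrightarrow> Bochner_Integration.simple_bochner_integrable ?M s \<and>
      (\<integral>\<^sup>+ t. ennreal \<bar>c p t - s t\<bar> \<partial>?M) < ennreal (1 / (real (Suc k) * \<beta> k))" for k p s
  have exP: "\<exists>s. P k p s" if "p \<in> A k" for p k
  proof -
    have "0 < 1 / (real (Suc k) * \<beta> k)" using \<beta>[of k] by simp
    from integrable_simple_approx[OF c_int[OF that] this] show ?thesis
      unfolding P_def by blast
  qed
  define s where "s k p = (SOME s. P k p s)" for k p
  have "P k p (s k p)" if "p \<in> A k" for p k
    unfolding s_def using exP[OF that] by (rule someI_ex)
  then have s: "\<And>p k. p \<in> A k \<Longrightarrow> Bochner_Integration.simple_bochner_integrable ?M (s k p)"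
    "\<And>p k. p \<in> A k \<Longrightarrow> (\<integral>\<^sup>+ t. ennreal \<bar>c p t - s k p t\<bar> \<partial>?M) < ennreal (1 / (real (Suc k) * \<beta> k))"
    by (auto simp: P_def)
  define S where "S k t = (\<Sum>p\<in>A k. s k p t *\<^sub>R b k p)" for k t
  have SX: "S k t \<in> X" for k t
    unfolding S_def by (intro X_sum X_scaleR A(3))
  have S_simple: "Bochner_Integration.simple_bochner_integrable ?M (S k)" for k
    unfolding S_def
  proof (rule simple_bochner_integrable_sum[OF A(1)])
    fix p assume "p \<in> A k"
    from s(1)[OF this] show "Bochner_Integration.simple_bochner_integrable ?M (\<lambda>t. s k p t *\<^sub>R b k p)"
      using simple_bochner_integrable_compose2[where p="\<lambda>a _. a *\<^sub>R b k p", of ?M "s k p" "s k p"] by simp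
  qed
  have s_meas [measurable]: "s k p \<in> borel_measurable ?M" if "p \<in> A k" for k p
    using s(1)[OF that] by (auto elim: simple_bochner_integrable.cases intro: borel_measurable_simple_function)
  have c_meas [measurable]: "c p \<in> borel_measurable ?M" if "p \<in> A k" for k p
    using c_int[OF that] by simp
  have evS: "(\<lambda>t. ev (S k t) x) \<in> borel_measurable ?M" for k x
    unfolding S_def ev_sum ev_simps by measurable
  have evQ: "(\<lambda>t. ev (Q k t) x) \<in> borel_measurable ?M" for k x
    unfolding Q_def ev_sum ev_simps by measurable
  have gX: "AE t in ?M. g t \<in> X" by (rule xint_X[OF xi])
  have evg: "(\<lambda>t. ev (g t) x) \<in> borel_measurable ?M" if "x \<in> closure U" for x
    by (rule xint_meas[OF xi that])
  have meas_gS [measurable]: "(\<lambda>t. norm (g t - S k t)) \<in> borel_measurable ?M" for k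
  proof (rule measurable_norm[OF J])
    show "AE t in ?M. g t - S k t \<in> CU U"
      using gX by eventually_elim (intro X_CU X_diff SX)
  qed (use evS evg in \<open>auto intro!: borel_measurable_diff\<close>)
  have meas_gQ [measurable]: "(\<lambda>t. norm (g t - Q k t)) \<in> borel_measurable ?M" for k
  proof (rule measurable_norm[OF J])
    show "AE t in ?M. g t - Q k t \<in> CU U"
      using gX by eventually_elim (intro X_CU X_diff QX)
  qed (use evQ evg in \<open>auto intro!: borel_measurable_diff\<close>)
  have QS: "(\<integral>\<^sup>+ t. ennreal (norm (Q k t - S k t)) \<partial>?M) \<le> ennreal (1 / real (Suc k))" for k
  proof -
    have "(\<integral>\<^sup>+ t. ennreal (norm (Q k t - S k t)) \<partial>?M)
        \<le> (\<integral>\<^sup>+ t. (\<Sum>p\<in>A k. ennreal (norm (b k p)) * ennreal \<bar>c p t - s k p t\<bar>) \<partial>?M)"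
    proof (rule nn_integral_mono)
      fix t
      have "norm (Q k t - S k t) \<le> (\<Sum>p\<in>A k. norm ((c p t - s k p t) *\<^sub>R b k p))"
        unfolding Q_def S_def sum_subtractf[symmetric] scaleR_diff_left[symmetric] by (rule norm_sum)
      also have "\<dots> = (\<Sum>p\<in>A k. norm (b k p) * \<bar>c p t - s k p t\<bar>)"
        by (simp add: mult.commute)
      finally have "ennreal (norm (Q k t - S k t)) \<le> ennreal (\<Sum>p\<in>A k. norm (b k p) * \<bar>c p t - s k p t\<bar>)"
        by (rule ennreal_leI)
      also have "\<dots> = (\<Sum>p\<in>A k. ennreal (norm (b k p)) * ennreal \<bar>c p t - s k p t\<bar>)"
        by (subst sum_ennreal[symmetric]) (auto simp: ennreal_mult)
      finally show "ennreal (norm (Q k t - S k t)) \<le> (\<Sum>p\<in>A k. ennreal (norm (b k p)) * ennreal \<bar>c p t - s k p t\<bar>)" .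
    qed
    also have "\<dots> = (\<Sum>p\<in>A k. ennreal (norm (b k p)) * (\<integral>\<^sup>+ t. ennreal \<bar>c p t - s k p t\<bar> \<partial>?M))"
    proof (subst nn_integral_sum)
      show "(\<lambda>t. ennreal (norm (b k p)) * ennreal \<bar>c p t - s k p t\<bar>) \<in> borel_measurable ?M" if "p \<in> A k" for p
        using that by measurable
      show "(\<Sum>p\<in>A k. \<integral>\<^sup>+ t. ennreal (norm (b k p)) * ennreal \<bar>c p t - s k p t\<bar> \<partial>?M) =
          (\<Sum>p\<in>A k. ennreal (norm (b k p)) * (\<integral>\<^sup>+ t. ennreal \<bar>c p t - s k p t\<bar> \<partial>?M))"
        by (intro sum.cong refl nn_integral_cmult) measurable
    qed
    also have "\<dots> \<le> (\<Sum>p\<in>A k. ennreal (norm (b k p)) * ennreal (1 / (real (Suc k) * \<beta> k)))"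
      by (intro sum_mono mult_left_mono less_imp_le[OF s(2)]) simp_all
    also have "\<dots> = ennreal ((\<Sum>p\<in>A k. norm (b k p)) * (1 / (real (Suc k) * \<beta> k)))"
    proof -
      define q where "q = 1 / (real (Suc k) * \<beta> k)"
      have q: "0 \<le> q" using \<beta>[of k] by (simp add: q_def)
      then have "(\<Sum>p\<in>A k. ennreal (norm (b k p)) * ennreal q) = (\<Sum>p\<in>A k. ennreal (norm (b k p) * q))"
        by (intro sum.cong refl ennreal_mult[symmetric]) auto
      also have "\<dots> = ennreal (\<Sum>p\<in>A k. norm (b k p) * q)"
        using q by (intro sum_ennreal) auto
      finally show ?thesis unfolding q_def by (simp only: sum_distrib_right)
    qed
    also have "\<dots> \<le> ennreal (1 / real (Suc k))"
    proof (rule ennreal_leI)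
      have "(\<Sum>p\<in>A k. norm (b k p)) * (1 / (real (Suc k) * \<beta> k)) \<le> \<beta> k * (1 / (real (Suc k) * \<beta> k))"
        using \<beta>[of k] by (intro mult_right_mono) (auto simp: \<beta>_def)
      also have "\<dots> = 1 / real (Suc k)"
        using \<beta>[of k] by simp
      finally show "(\<Sum>p\<in>A k. norm (b k p)) * (1 / (real (Suc k) * \<beta> k)) \<le> 1 / real (Suc k)" .
    qed
    finally show ?thesis .
  qed
  have lim_gQ: "(\<lambda>k. \<integral>\<^sup>+ t. ennreal (norm (g t - Q k t)) \<partial>?M) \<longlonglongrightarrow> 0"
  proof -
    have "(\<lambda>k. \<integral>\<^sup>+ t. ennreal (norm (g t - Q k t)) \<partial>?M) \<longlonglongrightarrow> (\<integral>\<^sup>+ t. 0 \<partial>?M)"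
    proof (rule nn_integral_dominated_convergence[where w="\<lambda>t. ennreal (2 * xnorm U (g t))"])
      show "AE t in ?M. ennreal (norm (g t - Q k t)) \<le> ennreal (2 * xnorm U (g t))" for k
        using gX
      proof eventually_elim
        case (elim t)
        have "norm (g t - Q k t) \<le> norm (g t) + norm (Q k t)" by (rule norm_triangle_ineq4)
        also have "\<dots> \<le> 2 * xnorm U (g t)"
          using bnd[OF elim, of k] norm_le_xnorm[OF X_CU[OF elim]] by (simp add: Q_def c_def)
        finally show ?case by (rule ennreal_leI)
      qed
      show "(\<integral>\<^sup>+ t. ennreal (2 * xnorm U (g t)) \<partial>?M) < \<infinity>"
        using xint_integrable_xnorm[OF xi]
        by (subst nn_integral_eq_integral) auto
      show "AE t in ?M. (\<lambda>k. ennreal (norm (g t - Q k t))) \<longlonglongrightarrow> 0"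
        using gX
      proof eventually_elim
        case (elim t)
        have "(\<lambda>k. norm (g t - Q k t)) \<longlonglongrightarrow> norm (g t - g t)"
          using cv[OF elim] unfolding Q_def c_def by (intro tendsto_intros)
        then show ?case
          using tendsto_ennrealI[of "\<lambda>k. norm (g t - Q k t)" 0] by simp
      qed
    qed (use xint_integrable_xnorm[OF xi] in auto)
    then show ?thesis by simp
  qed
  have lim: "(\<lambda>k. \<integral>\<^sup>+ t. ennreal (norm (g t - S k t)) \<partial>?M) \<longlonglongrightarrow> 0"
  proof (rule tendsto_sandwich[OF _ _ tendsto_const])
    show "\<forall>\<^sub>F k in sequentially. (\<integral>\<^sup>+ t. ennreal (norm (g t - S k t)) \<partial>?M)
       \<le> (\<integral>\<^sup>+ t. ennreal (norm (g t - Q k t)) \<partial>?M) + ennreal (1 / real (Suc k))"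
    proof (intro always_eventually allI)
      fix k
      have [measurable]: "(\<lambda>t. norm (Q k t - S k t)) \<in> borel_measurable ?M"
        by (rule measurable_norm[OF J]) (auto intro!: AE_I2 X_CU X_diff SX QX borel_measurable_diff evQ evS)
      have "(\<integral>\<^sup>+ t. ennreal (norm (g t - S k t)) \<partial>?M)
          \<le> (\<integral>\<^sup>+ t. ennreal (norm (g t - Q k t)) + ennreal (norm (Q k t - S k t)) \<partial>?M)"
        using norm_triangle_ineq[of "g t - Q k t" "Q k t - S k t" for t]
        by (intro nn_integral_mono) (auto simp flip: ennreal_plus)
      also have "\<dots> = (\<integral>\<^sup>+ t. ennreal (norm (g t - Q k t)) \<partial>?M) + (\<integral>\<^sup>+ t. ennreal (norm (Q k t - S k t)) \<partial>?M)"
        by (rule nn_integral_add) auto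
      finally show "(\<integral>\<^sup>+ t. ennreal (norm (g t - S k t)) \<partial>?M)
       \<le> (\<integral>\<^sup>+ t. ennreal (norm (g t - Q k t)) \<partial>?M) + ennreal (1 / real (Suc k))"
        using QS[of k] by (meson add_left_mono order_trans)
    qed
    have "(\<lambda>k. ennreal (1 / real (Suc k))) \<longlonglongrightarrow> ennreal 0"
      by (intro tendsto_ennrealI) (use LIMSEQ_inverse_real_of_nat in \<open>simp add: inverse_eq_divide\<close>)
    from tendsto_add[OF lim_gQ this]
    show "(\<lambda>k. (\<integral>\<^sup>+ t. ennreal (norm (g t - Q k t)) \<partial>?M) + ennreal (1 / real (Suc k))) \<longlonglongrightarrow> 0"
      by simp
  qed simp
  define W where "W k = Bochner_Integration.simple_bochner_integral ?M (S k)" for k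
  have WX: "W k \<in> X" for k
    unfolding W_def simple_bochner_integral_def by (intro X_sum X_scaleR) (use SX in auto)
  have W_diff: "ennreal (norm (W k - W l)) \<le>
      (\<integral>\<^sup>+ t. ennreal (norm (g t - S k t)) \<partial>?M) + (\<integral>\<^sup>+ t. ennreal (norm (g t - S l t)) \<partial>?M)" for k l
  proof -
    have si: "Bochner_Integration.simple_bochner_integrable ?M (\<lambda>t. S k t - S l t)"
      by (rule simple_bochner_integrable_compose2[OF _ S_simple S_simple]) simp
    have sin: "Bochner_Integration.simple_bochner_integrable ?M (\<lambda>t. norm (S k t - S l t))"
      using simple_bochner_integrable_compose2[where p="\<lambda>a b. norm (a - b)", OF _ S_simple S_simple] by simp
    have "norm (W k - W l) \<le> Bochner_Integration.simple_bochner_integral ?M (\<lambda>t. norm (S k t - S l t))"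
      unfolding W_def simple_bochner_integral_diff[OF S_simple S_simple, symmetric]
      by (rule simple_bochner_integral_norm_bound[OF si])
    then have "ennreal (norm (W k - W l)) \<le> (\<integral>\<^sup>+ t. ennreal (norm (S k t - S l t)) \<partial>?M)"
      unfolding simple_bochner_integral_eq_nn_integral[OF sin norm_ge_zero, symmetric] by (rule ennreal_leI)
    also have "\<dots> \<le> (\<integral>\<^sup>+ t. ennreal (norm (g t - S k t)) + ennreal (norm (g t - S l t)) \<partial>?M)"
    proof (rule nn_integral_mono)
      fix t
      have "norm (S k t - S l t) \<le> norm (g t - S k t) + norm (g t - S l t)"
        using norm_triangle_ineq4[of "g t - S l t" "g t - S k t"] by (simp add: norm_minus_commute)
      then show "ennreal (norm (S k t - S l t)) \<le> ennreal (norm (g t - S k t)) + ennreal (norm (g t - S l t))"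
        by (simp flip: ennreal_plus)
    qed
    also have "\<dots> = (\<integral>\<^sup>+ t. ennreal (norm (g t - S k t)) \<partial>?M) + (\<integral>\<^sup>+ t. ennreal (norm (g t - S l t)) \<partial>?M)"
      by (rule nn_integral_add) auto
    finally show ?thesis .
  qed
  have "Cauchy W"
  proof (rule CauchyI)
    fix e :: real assume "0 < e"
    then have "0 < ennreal (e / 2)" by simp
    with lim have "\<forall>\<^sub>F k in sequentially. (\<integral>\<^sup>+ t. ennreal (norm (g t - S k t)) \<partial>?M) < ennreal (e / 2)"
      by (rule order_tendstoD)
    then obtain K where K: "\<And>k. K \<le> k \<Longrightarrow> (\<integral>\<^sup>+ t. ennreal (norm (g t - S k t)) \<partial>?M) < ennreal (e / 2)"
      by (auto simp: eventually_sequentially)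
    show "\<exists>K. \<forall>k\<ge>K. \<forall>l\<ge>K. norm (W k - W l) < e"
    proof (intro exI allI impI)
      fix k l assume "K \<le> k" "K \<le> l"
      then have "ennreal (norm (W k - W l)) < ennreal (e / 2) + ennreal (e / 2)"
        by (intro le_less_trans[OF W_diff] add_strict_mono K)
      then show "norm (W k - W l) < e"
        using \<open>0 < e\<close> by (simp add: ennreal_less_iff flip: ennreal_plus)
    qed
  qed
  then obtain w where w: "W \<longlonglongrightarrow> w"
    using Cauchy_convergent convergent_def by blast
  have "bochner_on J g w"
    unfolding bochner_on_def using S_simple meas_gS lim w[unfolded W_def] by blast
  with X_closed_seq[OF WX w] show ?thesis by blast
qed

lemma bochner_on_unique:
  assumes "xint J g" "bochner_on J g w" "bochner_on J g w'"
  shows "w = w'"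
  by (rule ev_eqI) (metis assms has_bochner_integral_ev has_bochner_integral_eq xint_meas_all)

lemma bochner_on_bochner_integral:
  assumes "xint J g"
  shows "bochner_on J g (bochner_integral J g)"
  unfolding bochner_integral_def
  using bochner_on_exists[OF assms] bochner_on_unique[OF assms] by (metis the_equality)

lemma bochner_on_iff:
  assumes "xint J g"
  shows "bochner_on J g w \<longleftrightarrow> w = bochner_integral J g"
  using bochner_on_bochner_integral[OF assms] bochner_on_unique[OF assms] by blast

lemma bochner_integral_X:
  assumes "xint J g"
  shows "bochner_integral J g \<in> X"
  using bochner_on_exists[OF assms] bochner_on_iff[OF assms] by metis

lemma ev_bochner_integral:
  assumes "xint J g"
  shows "ev (bochner_integral J g) x = (LINT t|lebesgue_on J. ev (g t) x)"
  using has_bochner_integral_ev[OF bochner_on_bochner_integral[OF assms] xint_meas_all[OF assms]]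
  by (rule has_bochner_integral_integral_eq[symmetric])

text \<open>Arguing at each point and in each coordinate avoids the factor \<open>CARD('n)\<close>
  that a detour through the equivalent library norm would cost.\<close>

lemma xnorm_bochner_integral_le:
  assumes xi: "xint J g" and m: "integrable (lebesgue_on J) m" "AE t in lebesgue_on J. xnorm U (g t) \<le> m t"
  shows "xnorm U (bochner_integral J g) \<le> (LINT t|lebesgue_on J. m t)"
proof (rule xnorm_leI)
  fix x assume x: "x \<in> closure U"
  have int: "integrable (lebesgue_on J) (\<lambda>t. ev (g t) x $ i)" for i
    by (rule integrable_bounded_linear[OF bounded_linear_vec_nth xint_integrable_ev[OF xi x]])
  have comp: "(LINT t|lebesgue_on J. ev (g t) x) $ i = (LINT t|lebesgue_on J. ev (g t) x $ i)" for i
    by (rule integral_bounded_linear[OF bounded_linear_vec_nth xint_integrable_ev[OF xi x], symmetric])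
  have "norm1 (ev (bochner_integral J g) x) = (\<Sum>i\<in>UNIV. \<bar>LINT t|lebesgue_on J. ev (g t) x $ i\<bar>)"
    by (simp add: ev_bochner_integral[OF xi] norm1_def comp)
  also have "\<dots> \<le> (\<Sum>i\<in>UNIV. LINT t|lebesgue_on J. \<bar>ev (g t) x $ i\<bar>)"
    by (intro sum_mono integral_abs_bound)
  also have "\<dots> = (LINT t|lebesgue_on J. (\<Sum>i\<in>UNIV. \<bar>ev (g t) x $ i\<bar>))"
    by (rule Bochner_Integration.integral_sum[symmetric]) (use int in auto)
  also have "\<dots> \<le> (LINT t|lebesgue_on J. m t)"
  proof (rule integral_mono_AE)
    show "AE t in lebesgue_on J. (\<Sum>i\<in>UNIV. \<bar>ev (g t) x $ i\<bar>) \<le> m t"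
      using m(2) by eventually_elim (use norm1_ev_le[OF x] order_trans in \<open>fastforce simp: norm1_def\<close>)
  qed (use int m in auto)
  finally show "norm1 (ev (bochner_integral J g) x) \<le> (LINT t|lebesgue_on J. m t)" .
qed

lemma xint_I:
  assumes "J \<in> sets lebesgue" "AE t in lebesgue_on J. g t \<in> X"
    and "\<And>x. x \<in> closure U \<Longrightarrow> (\<lambda>t. ev (g t) x) \<in> borel_measurable (lebesgue_on J)"
    and "integrable (lebesgue_on J) m" "AE t in lebesgue_on J. xnorm U (g t) \<le> m t"
  shows "xint J g"
  using assms by (auto simp: xint_def)

lemma xint_diff:
  assumes "xint J g" "xint J h"
  shows "xint J (\<lambda>t. g t - h t)"
proof (rule xint_I)
  show "AE t in lebesgue_on J. g t - h t \<in> X"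
    using xint_X[OF assms(1)] xint_X[OF assms(2)] by eventually_elim (rule X_diff)
  show "integrable (lebesgue_on J) (\<lambda>t. xnorm U (g t) + xnorm U (h t))"
    using assms xint_integrable_xnorm by auto
  show "AE t in lebesgue_on J. xnorm U (g t - h t) \<le> xnorm U (g t) + xnorm U (h t)"
    by (rule AE_I2) (rule xnorm_diff)
qed (use assms xint_meas in \<open>auto simp: xint_sets\<close>)

lemma bochner_integral_diff:
  assumes "xint J g" "xint J h"
  shows "bochner_integral J (\<lambda>t. g t - h t) = bochner_integral J g - bochner_integral J h"
proof (rule X_eqI)
  fix x assume "x \<in> closure U"
  then show "ev (bochner_integral J (\<lambda>t. g t - h t)) x = ev (bochner_integral J g - bochner_integral J h) x"
    by (simp add: ev_bochner_integral assms xint_diff xint_integrable_ev)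
qed (use assms in \<open>auto intro: bochner_integral_X X_diff xint_diff\<close>)

lemma xint_mono:
  assumes xi: "xint J g" and J': "J' \<in> sets lebesgue" "J' \<subseteq> J"
  shows "xint J' g"
proof (rule xint_I)
  note J = xint_sets[OF xi]
  show "AE t in lebesgue_on J'. g t \<in> X"
    by (rule AE_lebesgue_on_mono[OF xint_X[OF xi] J J'])
  show "integrable (lebesgue_on J') (\<lambda>t. xnorm U (g t))"
    by (rule integrable_lebesgue_on_mono[OF xint_integrable_xnorm[OF xi] J J'])
  show "(\<lambda>t. ev (g t) x) \<in> borel_measurable (lebesgue_on J')" if "x \<in> closure U" for x
    using integrable_lebesgue_on_mono[OF xint_integrable_ev[OF xi that] J J'] by simp
qed (use J' in auto)

lemma xint_cong_AE:
  assumes xi: "xint J g" and eq: "AE t in lebesgue_on J. g t = h t"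
  shows "xint J h"
proof (rule xint_I)
  show "AE t in lebesgue_on J. h t \<in> X"
    using xint_X[OF xi] eq by eventually_elim simp
  show "(\<lambda>t. ev (h t) x) \<in> borel_measurable (lebesgue_on J)" if "x \<in> closure U" for x
    by (rule borel_measurable_lebesgue_on_AE[OF xint_meas[OF xi that] xint_sets[OF xi]])
      (use eq in \<open>auto elim: eventually_mono\<close>)
  show "integrable (lebesgue_on J) (\<lambda>t. xnorm U (g t))"
    by (rule xint_integrable_xnorm[OF xi])
  show "AE t in lebesgue_on J. xnorm U (h t) \<le> xnorm U (g t)"
    using eq by eventually_elim simp
qed (rule xint_sets[OF xi])

lemma bochner_integral_cong_AE:
  assumes xi: "xint J g" and eq: "AE t in lebesgue_on J. g t = h t"
  shows "bochner_integral J g = bochner_integral J h"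
proof (rule X_eqI)
  note xh = xint_cong_AE[OF assms]
  show "bochner_integral J g \<in> X" "bochner_integral J h \<in> X"
    using xi xh bochner_integral_X by auto
  fix x assume x: "x \<in> closure U"
  show "ev (bochner_integral J g) x = ev (bochner_integral J h) x"
    unfolding ev_bochner_integral[OF xi] ev_bochner_integral[OF xh]
    by (rule integral_cong_AE) (use xint_meas[OF xi x] xint_meas[OF xh x] eq in \<open>auto elim: eventually_mono\<close>)
qed

lemma bochner_integral_combine:
  assumes "xint {a..c} g" "a \<le> b" "b \<le> c"
  shows "bochner_integral {a..c} g = bochner_integral {a..b} g + bochner_integral {b..c} g"
proof (rule X_eqI)
  have x1: "xint {a..b} g" and x2: "xint {b..c} g"
    using assms by (auto intro: xint_mono)
  show "bochner_integral {a..c} g \<in> X" "bochner_integral {a..b} g + bochner_integral {b..c} g \<in> X"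
    using assms x1 x2 by (auto intro: bochner_integral_X X_add)
  fix x assume x: "x \<in> closure U"
  have "has_bochner_integral (lebesgue_on {a..c}) (\<lambda>t. ev (g t) x)
      ((LINT t|lebesgue_on {a..b}. ev (g t) x) + (LINT t|lebesgue_on {b..c}. ev (g t) x))"
    by (rule has_bochner_integral_combine[OF assms(2,3) has_bochner_integral_integrable
        has_bochner_integral_integrable]) (rule xint_integrable_ev[OF x1 x] xint_integrable_ev[OF x2 x])+
  then show "ev (bochner_integral {a..c} g) x = ev (bochner_integral {a..b} g + bochner_integral {b..c} g) x"
    by (simp add: ev_bochner_integral assms x1 x2 has_bochner_integral_integral_eq)
qed

end

section \<open>The heat semigroup and its convolutions\<close>

lemma subspace_state_space:
  "subspace (state_space U bc :: ('m::finite, 'b::real_normed_vector) bfun set)"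
  by (auto simp: subspace_def state_space_def CU_def intro: continuous_intros)

lemma C0_semigroup_onD:
  assumes "C0_semigroup_on S T"
  shows "0 \<le> t \<Longrightarrow> x \<in> S \<Longrightarrow> T t x \<in> S"
    and "0 \<le> t \<Longrightarrow> x \<in> S \<Longrightarrow> y \<in> S \<Longrightarrow> T t (a *\<^sub>R x + b *\<^sub>R y) = a *\<^sub>R T t x + b *\<^sub>R T t y"
    and "x \<in> S \<Longrightarrow> T 0 x = x"
    and "0 \<le> s \<Longrightarrow> 0 \<le> t \<Longrightarrow> x \<in> S \<Longrightarrow> T (s + t) x = T s (T t x)"
    and "x \<in> S \<Longrightarrow> ((\<lambda>t. T t x) \<longlongrightarrow> x) (at_right 0)"
  using assms unfolding C0_semigroup_on_def by blast+

lemma C0_semigroup_on_diff: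
  assumes "C0_semigroup_on S T" "0 \<le> t" "x \<in> S" "y \<in> S"
  shows "T t (x - y) = T t x - T t y"
  using C0_semigroup_onD(2)[OF assms, of 1 "-1"] by simp

lemma C0_semigroup_on_near_0:
  assumes T: "C0_semigroup_on S T" and z: "z \<in> S" and e: "0 < e"
  obtains d where "0 < d" "\<And>r. 0 \<le> r \<Longrightarrow> r < d \<Longrightarrow> norm (T r z - z) < e"
proof -
  have "\<forall>\<^sub>F r in at_right 0. dist (T r z) z < e"
    using C0_semigroup_onD(5)[OF T z] e by (rule tendstoD)
  then obtain d where "0 < d" "\<And>r. 0 < r \<Longrightarrow> r < d \<Longrightarrow> dist (T r z) z < e"
    unfolding eventually_at_right_field by auto
  then show thesis
    using that[of d] C0_semigroup_onD(3)[OF T z] e by (metis dist_norm order_le_less right_minus_eq norm_zero)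
qed

text \<open>Contractivity bounds the increment between times \<open>s \<le> t\<close> by the
  increment between 0 and \<open>t - s\<close>, so right continuity at 0 becomes uniform
  continuity.\<close>

lemma contraction_semigroup_continuous:
  assumes T: "C0_semigroup_on S T" and S: "subspace S"
    and contr: "\<And>t z. 0 \<le> t \<Longrightarrow> z \<in> S \<Longrightarrow> norm (T t z) \<le> norm z" and z: "z \<in> S"
  shows "continuous_on {0..} (\<lambda>t. T t z)"
proof -
  have le: "norm (T t z - T s z) \<le> norm (T (t - s) z - z)" if "0 \<le> s" "s \<le> t" for s t
  proof -
    have "T t z = T s (T (t - s) z)"
      using C0_semigroup_onD(4)[OF T, of s "t - s" z] that z by simp
    then have "T t z - T s z = T s (T (t - s) z - z)"
      using C0_semigroup_on_diff[OF T, of s "T (t - s) z" z] C0_semigroup_onD(1)[OF T, of "t - s" z] that z by simp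
    then show ?thesis
      using contr[of s "T (t - s) z - z"] that z C0_semigroup_onD(1)[OF T, of "t - s" z] S
      by (simp add: subspace_diff)
  qed
  have "uniformly_continuous_on {0..} (\<lambda>t. T t z)"
    unfolding uniformly_continuous_on_def
  proof (intro allI impI)
    fix e :: real assume "0 < e"
    then obtain d where d: "0 < d" "\<And>r. 0 \<le> r \<Longrightarrow> r < d \<Longrightarrow> norm (T r z - z) < e"
      using C0_semigroup_on_near_0[OF T z] by blast
    have "dist (T t z) (T s z) < e" if "0 \<le> s" "0 \<le> t" "dist t s < d" for s t
    proof (cases "s \<le> t")
      case True
      then show ?thesis
        using le[of s t] d(2)[of "t - s"] that by (simp add: dist_norm)
    next
      case False
      then show ?thesis
        using le[of t s] d(2)[of "s - t"] that by (simp add: dist_norm norm_minus_commute)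
    qed
    then show "\<exists>d>0. \<forall>x\<in>{0..}. \<forall>x'\<in>{0..}. dist x' x < d \<longrightarrow> dist (T x' z) (T x z) < e"
      using d(1) by auto
  qed
  then show ?thesis by (rule uniformly_continuous_imp_continuous)
qed

text \<open>On the relatively compact image \<open>B\<close> of the unit ball under
  \<open>T \<eta>\<close>, strong continuity at 0 is uniform, by a finite net with radius
  \<open>e / 3\<close>. For \<open>t \<ge> \<eta>\<close> and \<open>z\<close> normalised to
  \<open>z'\<close>, the increment from \<open>t\<close> to \<open>t + r\<close> is
  \<open>T (t - \<eta>)\<close> applied to \<open>y - T r y\<close> with
  \<open>y = T \<eta> z'\<close> in \<open>B\<close>, and the outer operator is a
  contraction.\<close>

lemma compact_semigroup_norm_continuous:
  assumes T: "C0_semigroup_on S T" and S: "subspace S"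
    and contr: "\<And>t z. 0 \<le> t \<Longrightarrow> z \<in> S \<Longrightarrow> norm (T t z) \<le> norm z"
    and cpt: "compact (closure (T \<eta> ` (S \<inter> cball 0 1)))" and \<eta>: "0 < \<eta>" and e: "0 < e"
  obtains d where "0 < d"
    "\<And>t r z. \<eta> \<le> t \<Longrightarrow> 0 \<le> r \<Longrightarrow> r < d \<Longrightarrow> z \<in> S \<Longrightarrow> norm (T t z - T (t + r) z) \<le> e * norm z"
proof -
  note inS = C0_semigroup_onD(1)[OF T]
  define B where "B = T \<eta> ` (S \<inter> cball 0 1)"
  have BS: "B \<subseteq> S" using inS \<eta> by (auto simp: B_def)
  have "closure B \<subseteq> (\<Union>y\<in>B. ball y (e / 3))"
  proof
    fix x assume "x \<in> closure B"
    then obtain y where "y \<in> B" "dist y x < e / 3"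
      using e closure_approachable[of x B] by (metis divide_pos_pos zero_less_numeral)
    then show "x \<in> (\<Union>y\<in>B. ball y (e / 3))" by auto
  qed
  then obtain C where C: "C \<subseteq> B" "finite C" "closure B \<subseteq> (\<Union>y\<in>C. ball y (e / 3))"
    using compactE_image[OF cpt[folded B_def], of B "\<lambda>y. ball y (e / 3)"] by auto
  have "\<exists>d>0. \<forall>r. 0 \<le> r \<longrightarrow> r < d \<longrightarrow> norm (T r y - y) < e / 3" if "y \<in> C" for y
    using C0_semigroup_on_near_0[OF T, of y "e / 3"] that C(1) BS e by (metis subset_iff divide_pos_pos zero_less_numeral)
  then obtain \<delta> where \<delta>: "\<And>y. y \<in> C \<Longrightarrow> 0 < \<delta> y"
    "\<And>y r. y \<in> C \<Longrightarrow> 0 \<le> r \<Longrightarrow> r < \<delta> y \<Longrightarrow> norm (T r y - y) < e / 3"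
    by metis
  \<comment> \<open>The inserted 1 spares a proof that the net \<open>C\<close> is nonempty.\<close>
  define d where "d = Min (insert 1 (\<delta> ` C))"
  have d: "0 < d" "\<And>y. y \<in> C \<Longrightarrow> d \<le> \<delta> y"
    using C(2) \<delta>(1) by (auto simp: d_def)
  have small: "norm (y - T r y) \<le> e" if yB: "y \<in> B" and r: "0 \<le> r" "r < d" for y r
  proof -
    obtain c where c: "c \<in> C" "dist c y < e / 3"
      using C(3) yB closure_subset[of B] by fastforce
    have yS: "y \<in> S" and cS: "c \<in> S" using yB c(1) C(1) BS by auto
    have "norm (T r c - T r y) \<le> norm (c - y)"
      using C0_semigroup_on_diff[OF T r(1) cS yS] contr[OF r(1), of "c - y"] S yS cS
      by (simp add: subspace_diff)
    moreover have "norm (T r c - c) < e / 3"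
      using \<delta>(2)[OF c(1) r(1)] d(2)[OF c(1)] r(2) by simp
    moreover have "norm (y - T r y) \<le> norm (c - y) + norm (T r c - c) + norm (T r c - T r y)"
    proof -
      have "y - T r y = (T r c - T r y) - (T r c - c) - (c - y)" by simp
      then show ?thesis
        using norm_triangle_ineq4[of "(T r c - T r y) - (T r c - c)" "c - y"]
          norm_triangle_ineq4[of "T r c - T r y" "T r c - c"] by simp
    qed
    ultimately show ?thesis using c(2) by (simp add: dist_norm)
  qed
  have "norm (T t z - T (t + r) z) \<le> e * norm z" if "\<eta> \<le> t" "0 \<le> r" "r < d" and z: "z \<in> S" for t r z
  proof (cases "z = 0")
    case True
    have "T s 0 = 0" if "0 \<le> s" for s
      using contr[OF that subspace_0[OF S]] by simp
    then show ?thesis using True that \<eta> by simp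
  next
    case False
    define z' where "z' = (1 / norm z) *\<^sub>R z"
    have z'S: "z' \<in> S" and n: "norm z' = 1" and z: "z = norm z *\<^sub>R z'"
      using z S False by (auto simp: z'_def subspace_scale)
    define y where "y = T \<eta> z'"
    have y: "y \<in> B" "y \<in> S" "T r y \<in> S" "0 \<le> t - \<eta>"
      using z'S n BS that inS \<eta> by (auto simp: y_def B_def)
    have "T t z' = T (t - \<eta>) y" "T (t + r) z' = T (t - \<eta>) (T r y)"
    proof -
      show "T t z' = T (t - \<eta>) y"
        using C0_semigroup_onD(4)[OF T, of "t - \<eta>" \<eta> z'] y(4) \<eta> z'S by (simp add: y_def)
      have "T (t + r) z' = T ((t - \<eta>) + (r + \<eta>)) z'" by (simp add: algebra_simps)
      also have "\<dots> = T (t - \<eta>) (T (r + \<eta>) z')"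
        using y(4) \<eta> z'S that by (intro C0_semigroup_onD(4)[OF T]) auto
      also have "T (r + \<eta>) z' = T r y"
        using \<eta> z'S that unfolding y_def by (intro C0_semigroup_onD(4)[OF T]) auto
      finally show "T (t + r) z' = T (t - \<eta>) (T r y)" .
    qed
    then have "T t z' - T (t + r) z' = T (t - \<eta>) (y - T r y)"
      using C0_semigroup_on_diff[OF T y(4,2,3)] by simp
    then have "norm (T t z' - T (t + r) z') \<le> e"
      using contr[OF y(4) subspace_diff[OF S y(2,3)]] small[OF y(1) that(2,3)] by simp
    moreover have "T s z = norm z *\<^sub>R T s z'" if "0 \<le> s" for s
      using C0_semigroup_onD(2)[OF T that z'S z'S, of "norm z" 0] z by simp
    then have "T t z - T (t + r) z = norm z *\<^sub>R (T t z' - T (t + r) z')"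
      using that \<eta> by (simp add: scaleR_diff_right)
    ultimately show ?thesis
      using mult_left_mono[of "norm (T t z' - T (t + r) z')" e "norm z"] by (simp add: mult.commute)
  qed
  with d(1) show thesis by (rule that)
qed

section \<open>The product semigroup, component by component\<close>

lemma component_simps:
  "component i (a + b) = component i a + component i b"
  "component i (a - b) = component i a - component i b"
  "component i (c *\<^sub>R a) = c *\<^sub>R component i a"
  by (rule ev_eqI, simp add: ev_component)+

lemma component_eqI: "(\<And>i. component i a = component i b) \<Longrightarrow> a = b"
  by (rule ev_eqI) (metis ev_component vec_eq_iff)

lemma component_state_space: "z \<in> state_space U bc \<Longrightarrow> component i z \<in> state_space U bc"
  by (auto simp: state_space_def CU_def ev_component intro: continuous_intros)

lemma state_space_componentI:
  assumes "\<And>i. component i z \<in> state_space U bc"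
  shows "z \<in> state_space U bc"
proof -
  have "ev z = (\<lambda>x. \<chi> i. ev (component i z) x)"
    by (rule ext) (simp add: ev_component vec_eq_iff)
  moreover have "continuous_on (closure U) (\<lambda>x. \<chi> i. ev (component i z) x)"
    using assms by (intro continuous_on_vec_lambda) (simp add: state_space_def CU_def)
  ultimately have "continuous_on (closure U) (ev z)" by simp
  moreover have "ev z x = 0" if "\<And>i. ev (component i z) x = 0" for x
    using that by (simp add: ev_component vec_eq_iff)
  ultimately show ?thesis
    using assms by (simp add: state_space_def CU_def)
qed

lemma component_etA: "component i (etA T t z) = T i t (component i z)"
  by (rule ev_eqI) (simp add: ev_component etA_def ev_tuple)

locale heat = state_domain U bc
  for U :: "(real ^ 'm::finite) set" and bc :: "('n::finite, real ^ 'm) bc" +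
  fixes T :: "'n \<Rightarrow> real \<Rightarrow> ('m, real) bfun \<Rightarrow> ('m, real) bfun"
  assumes heat_semigroup: "\<And>i. heat_semigroup U bc i (T i)"
begin

abbreviation P :: "real \<Rightarrow> ('m, real ^ 'n) bfun \<Rightarrow> ('m, real ^ 'n) bfun" where
  "P \<equiv> etA T"

lemma card_ge_1: "1 \<le> real CARD('n)"
  using zero_less_card_finite[where 'a='n] by linarith

lemma T_C0: "C0_semigroup_on (state_space U bc) (T i)"
  using heat_semigroup[of i] by (simp add: heat_semigroup_def)

lemma T_contr: "0 \<le> t \<Longrightarrow> z \<in> state_space U bc \<Longrightarrow> norm (T i t z) \<le> norm z"
  using heat_semigroup[of i] by (simp add: heat_semigroup_def)

lemma norm_component_le: "z \<in> X \<Longrightarrow> norm (component i z) \<le> xnorm U z"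
proof (rule norm_le_ev)
  fix x assume z: "z \<in> X"
  show "norm (ev (component i z) x) \<le> xnorm U z"
    by (cases "x \<in> closure U")
      (use z norm1_ev_le[of x z] component_le_norm1[of "ev z x" i] X_outside[OF z, of x] in \<open>auto simp: ev_component\<close>)
qed

lemma xnorm_le_components: "xnorm U z \<le> (\<Sum>i\<in>UNIV. norm (component i z))"
  for z :: "('m, real ^ 'n) bfun"
proof (rule xnorm_leI)
  fix x
  have "\<bar>ev z x $ i\<bar> \<le> norm (component i z)" for i
    using norm_ev_le[of "component i z" x] by (simp add: ev_component)
  then show "norm1 (ev z x) \<le> (\<Sum>i\<in>UNIV. norm (component i z))"
    unfolding norm1_def by (intro sum_mono)
qed

lemma P_X: "0 \<le> t \<Longrightarrow> z \<in> X \<Longrightarrow> P t z \<in> X"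
  by (intro state_space_componentI) (auto simp: component_etA intro: C0_semigroup_onD(1)[OF T_C0] component_state_space)

lemma P_lin:
  assumes "0 \<le> t" "x \<in> X" "y \<in> X"
  shows "P t (a *\<^sub>R x + b *\<^sub>R y) = a *\<^sub>R P t x + b *\<^sub>R P t y"
  by (rule component_eqI)
    (simp add: component_etA component_simps C0_semigroup_onD(2)[OF T_C0] assms component_state_space)

lemma P_add: "0 \<le> t \<Longrightarrow> x \<in> X \<Longrightarrow> y \<in> X \<Longrightarrow> P t (x + y) = P t x + P t y"
  using P_lin[of t x y 1 1] by simp

lemma P_diff: "0 \<le> t \<Longrightarrow> x \<in> X \<Longrightarrow> y \<in> X \<Longrightarrow> P t (x - y) = P t x - P t y"
  using P_lin[of t x y 1 "-1"] by simp

lemma P_scaleR: "0 \<le> t \<Longrightarrow> x \<in> X \<Longrightarrow> P t (a *\<^sub>R x) = a *\<^sub>R P t x"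
  using P_lin[of t x x a 0] by simp

lemma P_zero: "0 \<le> t \<Longrightarrow> P t 0 = 0"
  using P_scaleR[of t 0 0] by simp

lemma P_sum: "0 \<le> t \<Longrightarrow> (\<And>p. p \<in> A \<Longrightarrow> f p \<in> X) \<Longrightarrow> P t (\<Sum>p\<in>A. f p) = (\<Sum>p\<in>A. P t (f p))"
  by (induction A rule: infinite_finite_induct) (auto simp: P_zero P_add X_sum)

lemma P_plus: "0 \<le> s \<Longrightarrow> 0 \<le> t \<Longrightarrow> z \<in> X \<Longrightarrow> P (s + t) z = P s (P t z)"
  by (rule component_eqI) (simp add: component_etA C0_semigroup_onD(4)[OF T_C0] component_state_space)

text \<open>Each component is contracted in its own supremum norm, which is at most
  \<open>xnorm U z\<close>. The suprema of different components may sit at different points, and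
  adding them costs the factor \<open>CARD('n)\<close>.\<close>

lemma xnorm_P_le: "0 \<le> t \<Longrightarrow> z \<in> X \<Longrightarrow> xnorm U (P t z) \<le> real CARD('n) * xnorm U z"
proof -
  assume "0 \<le> t" "z \<in> X"
  then have "norm (component i (P t z)) \<le> xnorm U z" for i
    using order_trans[OF T_contr norm_component_le] by (simp add: component_etA component_state_space)
  then have "(\<Sum>i\<in>UNIV. norm (component i (P t z))) \<le> (\<Sum>i\<in>(UNIV::'n set). xnorm U z)"
    by (intro sum_mono)
  then show ?thesis
    using xnorm_le_components[of "P t z"] by simp
qed

lemma norm_le_components: "z \<in> X \<Longrightarrow> norm z \<le> (\<Sum>i\<in>UNIV. norm (component i z))"
  using norm_le_xnorm[OF X_CU] xnorm_le_components order_trans by blast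

lemma continuous_on_P:
  assumes z: "z \<in> X"
  shows "continuous_on {0..} (\<lambda>t. P t z)"
  unfolding continuous_on_def
proof
  fix s :: real assume s: "s \<in> {0..}"
  let ?F = "at s within {0..}"
  have "((\<lambda>t. component i (P t z)) \<longlongrightarrow> component i (P s z)) ?F" for i
  proof -
    have "continuous_on {0..} (\<lambda>t. T i t (component i z))"
      by (rule contraction_semigroup_continuous[OF T_C0 subspace_state_space T_contr component_state_space[OF z]])
    then show ?thesis
      using s by (simp add: continuous_on_def component_etA)
  qed
  then have lim: "((\<lambda>t. \<Sum>i\<in>UNIV. norm (component i (P t z) - component i (P s z))) \<longlongrightarrow> (\<Sum>i\<in>(UNIV::'n set). 0)) ?F"
    by (intro tendsto_sum tendsto_norm_zero LIM_zero)
  have "((\<lambda>t. P t z - P s z) \<longlongrightarrow> 0) ?F"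
  proof (rule Lim_null_comparison)
    show "\<forall>\<^sub>F t in ?F. norm (P t z - P s z) \<le> (\<Sum>i\<in>UNIV. norm (component i (P t z) - component i (P s z)))"
      unfolding eventually_at_filter
    proof (intro always_eventually allI impI)
      fix t :: real assume "t \<in> {0..}"
      then show "norm (P t z - P s z) \<le> (\<Sum>i\<in>UNIV. norm (component i (P t z) - component i (P s z)))"
        using norm_le_components[OF X_diff[OF P_X P_X], of t z s z] s z by (simp add: component_simps)
    qed
  qed (use lim in simp)
  then show "((\<lambda>t. P t z) \<longlongrightarrow> P s z) ?F"
    by (rule LIM_zero_cancel)
qed

lemma P_norm_continuous:
  assumes \<eta>: "0 < \<eta>" and e: "0 < e"
  obtains d where "0 < d"
    "\<And>t r z. \<eta> \<le> t \<Longrightarrow> 0 \<le> r \<Longrightarrow> r < d \<Longrightarrow> z \<in> X \<Longrightarrow> xnorm U (P t z - P (t + r) z) \<le> e * xnorm U z"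
proof -
  have e': "0 < e / real CARD('n)" using e card_ge_1 by simp
  have "\<exists>d>0. \<forall>t r z. \<eta> \<le> t \<longrightarrow> 0 \<le> r \<longrightarrow> r < d \<longrightarrow> z \<in> state_space U bc \<longrightarrow>
      norm (T i t z - T i (t + r) z) \<le> e / real CARD('n) * norm z" for i
  proof -
    have "compact (closure (T i \<eta> ` (state_space U bc \<inter> cball 0 1)))"
      using heat_semigroup[of i] \<eta> by (simp add: heat_semigroup_def)
    then obtain d where "0 < d" "\<And>t r z. \<eta> \<le> t \<Longrightarrow> 0 \<le> r \<Longrightarrow> r < d \<Longrightarrow> z \<in> state_space U bc \<Longrightarrow>
        norm (T i t z - T i (t + r) z) \<le> e / real CARD('n) * norm z"
      using compact_semigroup_norm_continuous[OF T_C0 subspace_state_space T_contr _ \<eta> e', of i thesis] by blast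
    then show ?thesis by blast
  qed
  then obtain \<delta> where \<delta>: "\<And>i. 0 < \<delta> i"
    "\<And>i t r z. \<eta> \<le> t \<Longrightarrow> 0 \<le> r \<Longrightarrow> r < \<delta> i \<Longrightarrow> z \<in> state_space U bc \<Longrightarrow>
      norm (T i t z - T i (t + r) z) \<le> e / real CARD('n) * norm z"
    by metis
  define d where "d = Min (range \<delta>)"
  have d: "0 < d" "\<And>i. d \<le> \<delta> i"
    using \<delta>(1) by (auto simp: d_def)
  have "xnorm U (P t z - P (t + r) z) \<le> e * xnorm U z"
    if "\<eta> \<le> t" "0 \<le> r" "r < d" and z: "z \<in> X" for t r z
  proof -
    have "norm (component i (P t z - P (t + r) z)) \<le> e / real CARD('n) * xnorm U z" for i
    proof -
      have "norm (component i (P t z - P (t + r) z)) \<le> e / real CARD('n) * norm (component i z)"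
        using \<delta>(2)[of t r i "component i z"] d(2)[of i] that
        by (simp add: component_simps component_etA component_state_space)
      also have "\<dots> \<le> e / real CARD('n) * xnorm U z"
        using e' norm_component_le[OF z] by (intro mult_left_mono) auto
      finally show ?thesis .
    qed
    then have "(\<Sum>i\<in>UNIV. norm (component i (P t z - P (t + r) z))) \<le> (\<Sum>i\<in>(UNIV::'n set). e / real CARD('n) * xnorm U z)"
      by (intro sum_mono)
    also have "\<dots> = e * xnorm U z"
      using card_ge_1 by simp
    finally show ?thesis
      using xnorm_le_components[of "P t z - P (t + r) z"] by linarith
  qed
  with d(1) show thesis by (rule that)
qed

lemma P_tendsto:
  assumes "0 \<le> t" "\<And>k. w k \<in> X" "z \<in> X" "w \<longlonglongrightarrow> z"
  shows "(\<lambda>k. P t (w k)) \<longlonglongrightarrow> P t z"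
proof (rule LIM_zero_cancel, rule Lim_null_comparison)
  have "norm (P t (w k) - P t z) \<le> real CARD('n) * (real CARD('n) * norm (w k - z))" for k
  proof -
    have "norm (P t (w k) - P t z) \<le> xnorm U (P t (w k - z))"
      using assms by (subst P_diff) (auto intro!: norm_le_xnorm X_CU X_diff P_X)
    also have "\<dots> \<le> real CARD('n) * xnorm U (w k - z)"
      using assms by (intro xnorm_P_le X_diff)
    also have "\<dots> \<le> real CARD('n) * (real CARD('n) * norm (w k - z))"
      by (intro mult_left_mono xnorm_le_norm) simp
    finally show ?thesis .
  qed
  then show "\<forall>\<^sub>F k in sequentially. norm (P t (w k) - P t z) \<le> real CARD('n) * (real CARD('n) * norm (w k - z))"
    by simp
  have "(\<lambda>k. real CARD('n) * (real CARD('n) * norm (w k - z))) \<longlonglongrightarrow> real CARD('n) * (real CARD('n) * 0)"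
    using assms(4) by (intro tendsto_intros tendsto_norm_zero LIM_zero)
  then show "(\<lambda>k. real CARD('n) * (real CARD('n) * norm (w k - z))) \<longlonglongrightarrow> 0" by simp
qed

text \<open>Sampling turns the integrand into a finite sum of measurable scalars times continuous
  curves \<open>P (\<rho> s) (b k p)\<close>; the pointwise limit of these sums is the map in
  question.\<close>

lemma xint_P:
  assumes xi: "xint J g" and \<rho>: "continuous_on J \<rho>" "\<And>s. s \<in> J \<Longrightarrow> 0 \<le> \<rho> s"
  shows "xint J (\<lambda>s. P (\<rho> s) (g s))"
proof -
  let ?M = "lebesgue_on J"
  obtain A b where A: "\<And>k. finite (A k)" "\<And>k p. p \<in> A k \<Longrightarrow> fst p \<in> closure U" "\<And>k p. p \<in> A k \<Longrightarrow> b k p \<in> X"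
    and bnd: "\<And>z k. z \<in> X \<Longrightarrow> norm (\<Sum>p\<in>A k. (ev z (fst p) $ snd p) *\<^sub>R b k p) \<le> norm z"
    and cv: "\<And>z. z \<in> X \<Longrightarrow> (\<lambda>k. \<Sum>p\<in>A k. (ev z (fst p) $ snd p) *\<^sub>R b k p) \<longlonglongrightarrow> z"
    by (rule finite_rank_approximation) (rule that)
  note J = xint_sets[OF xi]
  \<comment> \<open>The measurable limit is taken at every time, so the null set on which
    \<open>g\<close> leaves \<open>X\<close> is patched with 0.\<close>
  define g' where "g' s = (if g s \<in> X then g s else 0)" for s
  have g'X: "g' s \<in> X" for s by (simp add: g'_def)
  have eq: "AE s in ?M. g s = g' s"
    using xint_X[OF xi] by eventually_elim (simp add: g'_def)
  have xi': "xint J g'" by (rule xint_cong_AE[OF xi eq])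
  have meas: "(\<lambda>s. ev (P (\<rho> s) (g' s)) x) \<in> borel_measurable ?M" if "x \<in> closure U" for x
  proof (rule borel_measurable_LIMSEQ_metric)
    fix k
    have "(\<lambda>s. (ev (g' s) (fst p) $ snd p) *\<^sub>R ev (P (\<rho> s) (b k p)) x) \<in> borel_measurable ?M" if p: "p \<in> A k" for p
    proof (rule borel_measurable_scaleR)
      show "(\<lambda>s. ev (g' s) (fst p) $ snd p) \<in> borel_measurable ?M"
        by (rule borel_measurable_integrable[OF integrable_bounded_linear[OF bounded_linear_vec_nth
              xint_integrable_ev[OF xi' A(2)[OF p]]]])
      have "continuous_on J (\<lambda>s. P (\<rho> s) (b k p))"
        by (rule continuous_on_compose2[OF continuous_on_P[OF A(3)[OF p]] \<rho>(1)]) (use \<rho>(2) in auto)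
      then have "continuous_on J (\<lambda>s. ev (P (\<rho> s) (b k p)) x)"
        by (rule bounded_linear.continuous_on[OF bounded_linear_ev])
      then show "(\<lambda>s. ev (P (\<rho> s) (b k p)) x) \<in> borel_measurable ?M"
        by (rule continuous_imp_measurable_on_sets_lebesgue) (rule J)
    qed
    then show "(\<lambda>s. \<Sum>p\<in>A k. (ev (g' s) (fst p) $ snd p) *\<^sub>R ev (P (\<rho> s) (b k p)) x) \<in> borel_measurable ?M"
      by (rule borel_measurable_sum)
  next
    fix s assume "s \<in> space ?M"
    then have s: "0 \<le> \<rho> s" using \<rho>(2) by simp
    have "(\<lambda>k. ev (P (\<rho> s) (\<Sum>p\<in>A k. (ev (g' s) (fst p) $ snd p) *\<^sub>R b k p)) x) \<longlonglongrightarrow> ev (P (\<rho> s) (g' s)) x"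
      by (intro ev_tendsto P_tendsto s X_sum X_scaleR A(3) g'X cv)
    then show "(\<lambda>k. \<Sum>p\<in>A k. (ev (g' s) (fst p) $ snd p) *\<^sub>R ev (P (\<rho> s) (b k p)) x) \<longlonglongrightarrow> ev (P (\<rho> s) (g' s)) x"
      by (simp add: P_sum[OF s] P_scaleR[OF s] A(3) X_scaleR ev_sum cong: sum.cong)
  qed
  show ?thesis
  proof (rule xint_I[OF J])
    show "AE s in ?M. P (\<rho> s) (g s) \<in> X"
      using xint_X[OF xi] AE_mem_lebesgue_on by eventually_elim (intro P_X \<rho>(2))
    show "integrable ?M (\<lambda>s. real CARD('n) * xnorm U (g s))"
      using xint_integrable_xnorm[OF xi] by simp
    show "AE s in ?M. xnorm U (P (\<rho> s) (g s)) \<le> real CARD('n) * xnorm U (g s)"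
      using xint_X[OF xi] AE_mem_lebesgue_on by eventually_elim (intro xnorm_P_le \<rho>(2))
    show "(\<lambda>s. ev (P (\<rho> s) (g s)) x) \<in> borel_measurable ?M" if "x \<in> closure U" for x
      by (rule borel_measurable_lebesgue_on_AE[OF meas[OF that] J])
        (use eq in \<open>eventually_elim, simp\<close>)
  qed
qed

text \<open>For the sampled integrand this is linearity over a finite sum. Strong convergence of the
  sampling operators and dominated convergence pass to the limit on both sides. The interchange is
  what allows a solution to be restarted and an operator to be frozen on a time interval.\<close>

lemma bochner_integral_P:
  assumes xi: "xint J g" and r: "0 \<le> r"
  shows "bochner_integral J (\<lambda>s. P r (g s)) = P r (bochner_integral J g)"
proof -
  let ?M = "lebesgue_on J"
  obtain A b where A: "\<And>k. finite (A k)" "\<And>k p. p \<in> A k \<Longrightarrow> fst p \<in> closure U" "\<And>k p. p \<in> A k \<Longrightarrow> b k p \<in> X"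
    and bnd: "\<And>z k. z \<in> X \<Longrightarrow> norm (\<Sum>p\<in>A k. (ev z (fst p) $ snd p) *\<^sub>R b k p) \<le> norm z"
    and cv: "\<And>z. z \<in> X \<Longrightarrow> (\<lambda>k. \<Sum>p\<in>A k. (ev z (fst p) $ snd p) *\<^sub>R b k p) \<longlonglongrightarrow> z"
    by (rule finite_rank_approximation) (rule that)
  note J = xint_sets[OF xi]
  define Q where "Q k z = (\<Sum>p\<in>A k. (ev z (fst p) $ snd p) *\<^sub>R b k p)" for k z
  have QX: "Q k z \<in> X" for k z
    unfolding Q_def by (intro X_sum X_scaleR A(3))
  have xP: "xint J (\<lambda>s. P r (g s))" by (rule xint_P[OF xi]) (auto intro: r)
  have Qbound: "xnorm U (Q k z) \<le> real CARD('n) * xnorm U z" if "z \<in> X" for k z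
    by (rule order_trans[OF xnorm_le_norm])
      (use bnd[OF that, of k] norm_le_xnorm[OF X_CU[OF that]] in \<open>auto simp: Q_def intro: mult_left_mono\<close>)
  have c_int: "integrable ?M (\<lambda>s. ev (g s) (fst p) $ snd p)" if "p \<in> A k" for p k
    by (rule integrable_bounded_linear[OF bounded_linear_vec_nth xint_integrable_ev[OF xi A(2)[OF that]]])
  define C where "C p = (LINT s|?M. ev (g s) (fst p) $ snd p)" for p
  define V where "V k = (\<Sum>p\<in>A k. C p *\<^sub>R b k p)" for k
  have VX: "V k \<in> X" for k
    unfolding V_def by (intro X_sum X_scaleR A(3))
  have evQ_int: "integrable ?M (\<lambda>s. ev (Q k (g s)) x)" for k x
    unfolding Q_def ev_sum ev_simps by (intro Bochner_Integration.integrable_sum integrable_scaleR_left c_int)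
  have xQ: "xint J (\<lambda>s. Q k (g s))" for k
  proof (rule xint_I[OF J])
    show "integrable ?M (\<lambda>s. real CARD('n) * xnorm U (g s))"
      using xint_integrable_xnorm[OF xi] by simp
    show "AE s in ?M. xnorm U (Q k (g s)) \<le> real CARD('n) * xnorm U (g s)"
      using xint_X[OF xi] by eventually_elim (rule Qbound)
  qed (use QX evQ_int in auto)
  have BQ: "bochner_integral J (\<lambda>s. Q k (g s)) = V k" for k
  proof (rule ev_eqI)
    fix x
    have "(LINT s|?M. ev (Q k (g s)) x) = (\<Sum>p\<in>A k. C p *\<^sub>R ev (b k p) x)"
      unfolding Q_def ev_sum ev_simps C_def
      by (subst Bochner_Integration.integral_sum) (auto intro!: integrable_scaleR_left c_int sum.cong integral_scaleR_left)
    then show "ev (bochner_integral J (\<lambda>s. Q k (g s))) x = ev (V k) x"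
      by (simp add: ev_bochner_integral[OF xQ] V_def ev_sum)
  qed
  have lim0: "(\<lambda>k. LINT s|?M. xnorm U (Q k (g s) - g s)) \<longlonglongrightarrow> (LINT s|?M. 0)"
  proof (rule integral_dominated_convergence[where w="\<lambda>s. (real CARD('n) + 1) * xnorm U (g s)"])
    show "(\<lambda>s. xnorm U (Q k (g s) - g s)) \<in> borel_measurable ?M" for k
      using xint_integrable_xnorm[OF xint_diff[OF xQ xi]] by simp
    show "integrable ?M (\<lambda>s. (real CARD('n) + 1) * xnorm U (g s))"
      using xint_integrable_xnorm[OF xi] by simp
    show "AE s in ?M. (\<lambda>k. xnorm U (Q k (g s) - g s)) \<longlonglongrightarrow> 0"
      using xint_X[OF xi]
    proof eventually_elim
      case (elim s)
      have "(\<lambda>k. real CARD('n) * norm (Q k (g s) - g s)) \<longlonglongrightarrow> real CARD('n) * 0"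
        using cv[OF elim] unfolding Q_def by (intro tendsto_intros tendsto_norm_zero LIM_zero)
      then have "(\<lambda>k. real CARD('n) * norm (Q k (g s) - g s)) \<longlonglongrightarrow> 0" by simp
      then show ?case
        by (rule Lim_null_comparison[rotated]) (use xnorm_le_norm in auto)
    qed
    show "AE s in ?M. norm (xnorm U (Q k (g s) - g s)) \<le> (real CARD('n) + 1) * xnorm U (g s)" for k
      using xint_X[OF xi]
    proof eventually_elim
      case (elim s)
      show ?case
        using xnorm_diff[of "Q k (g s)" "g s"] Qbound[OF elim, of k] by (simp add: algebra_simps)
    qed
  qed auto
  have lim: "V \<longlonglongrightarrow> bochner_integral J g"
  proof (rule LIM_zero_cancel, rule Lim_null_comparison)
    have "norm (V k - bochner_integral J g) \<le> (LINT s|?M. xnorm U (Q k (g s) - g s))" for k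
    proof -
      have "V k - bochner_integral J g = bochner_integral J (\<lambda>s. Q k (g s) - g s)"
        by (simp add: bochner_integral_diff[OF xQ xi] BQ)
      then have "norm (V k - bochner_integral J g) \<le> xnorm U (bochner_integral J (\<lambda>s. Q k (g s) - g s))"
        by (simp add: norm_le_xnorm X_CU bochner_integral_X xint_diff[OF xQ xi])
      also have "\<dots> \<le> (LINT s|?M. xnorm U (Q k (g s) - g s))"
        by (rule xnorm_bochner_integral_le[OF xint_diff[OF xQ xi] xint_integrable_xnorm[OF xint_diff[OF xQ xi]]]) simp
      finally show ?thesis .
    qed
    then show "\<forall>\<^sub>F k in sequentially. norm (V k - bochner_integral J g) \<le> (LINT s|?M. xnorm U (Q k (g s) - g s))"
      by simp
  qed (use lim0 in simp)
  show ?thesis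
  proof (rule X_eqI)
    show "bochner_integral J (\<lambda>s. P r (g s)) \<in> X" "P r (bochner_integral J g) \<in> X"
      using xP xi r by (auto intro: bochner_integral_X P_X)
    fix x assume x: "x \<in> closure U"
    have "(\<lambda>k. ev (P r (V k)) x) \<longlonglongrightarrow> ev (P r (bochner_integral J g)) x"
      by (intro ev_tendsto P_tendsto r VX bochner_integral_X xi lim)
    moreover have "ev (P r (V k)) x = (LINT s|?M. ev (P r (Q k (g s))) x)" for k
    proof -
      have "(LINT s|?M. ev (P r (Q k (g s))) x) = (LINT s|?M. (\<Sum>p\<in>A k. (ev (g s) (fst p) $ snd p) *\<^sub>R ev (P r (b k p)) x))"
        by (simp add: Q_def P_sum[OF r] P_scaleR[OF r] A(3) X_scaleR ev_sum cong: sum.cong)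
      also have "\<dots> = (\<Sum>p\<in>A k. C p *\<^sub>R ev (P r (b k p)) x)"
        unfolding C_def
        by (subst Bochner_Integration.integral_sum) (auto intro!: integrable_scaleR_left c_int sum.cong integral_scaleR_left)
      also have "\<dots> = ev (P r (V k)) x"
        by (simp add: V_def P_sum[OF r] P_scaleR[OF r] A(3) X_scaleR ev_sum cong: sum.cong)
      finally show ?thesis by simp
    qed
    moreover have "(\<lambda>k. LINT s|?M. ev (P r (Q k (g s))) x) \<longlonglongrightarrow> (LINT s|?M. ev (P r (g s)) x)"
    proof (rule integral_dominated_convergence[where w="\<lambda>s. real CARD('n) * (real CARD('n) * xnorm U (g s))"])
      show "(\<lambda>s. ev (P r (g s)) x) \<in> borel_measurable ?M"
        by (rule xint_meas[OF xP x])
      show "(\<lambda>s. ev (P r (Q k (g s))) x) \<in> borel_measurable ?M" for k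
        by (rule xint_meas[OF xint_P[OF xQ] x]) (auto intro: r)
      show "integrable ?M (\<lambda>s. real CARD('n) * (real CARD('n) * xnorm U (g s)))"
        using xint_integrable_xnorm[OF xi] by simp
      show "AE s in ?M. (\<lambda>k. ev (P r (Q k (g s))) x) \<longlonglongrightarrow> ev (P r (g s)) x"
        using xint_X[OF xi]
        by eventually_elim (intro ev_tendsto P_tendsto r QX, simp_all add: Q_def cv)
      show "AE s in ?M. norm (ev (P r (Q k (g s))) x) \<le> real CARD('n) * (real CARD('n) * xnorm U (g s))" for k
        using xint_X[OF xi]
      proof eventually_elim
        case (elim s)
        have "norm (ev (P r (Q k (g s))) x) \<le> xnorm U (P r (Q k (g s)))"
          using norm1_ev_le[OF x] norm_le_norm1 order_trans by blast
        also have "\<dots> \<le> real CARD('n) * xnorm U (Q k (g s))" by (intro xnorm_P_le r QX)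
        also have "\<dots> \<le> real CARD('n) * (real CARD('n) * xnorm U (g s))" by (intro mult_left_mono Qbound elim) simp
        finally show ?case .
      qed
    qed
    ultimately show "ev (bochner_integral J (\<lambda>s. P r (g s))) x = ev (P r (bochner_integral J g)) x"
      using LIMSEQ_unique by (fastforce simp: ev_bochner_integral[OF xP])
  qed
qed

section \<open>Duhamel integrals with variable starting time\<close>

definition conv :: "real \<Rightarrow> real \<Rightarrow> (real \<Rightarrow> ('m, real ^ 'n) bfun) \<Rightarrow> ('m, real ^ 'n) bfun" where
  "conv a t g = bochner_integral {a..t} (\<lambda>s. P (t - s) (g s))"

lemma xint_conv: "xint J g \<Longrightarrow> J \<subseteq> {..t} \<Longrightarrow> xint J (\<lambda>s. P (t - s) (g s))"
  by (rule xint_P) (auto intro!: continuous_intros)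

lemma conv_X: "xint {a..t} g \<Longrightarrow> conv a t g \<in> X"
  unfolding conv_def by (intro bochner_integral_X xint_conv) auto

lemma conv_bound:
  assumes xi: "xint {a..t} g" and m: "integrable (lebesgue_on {a..t}) m"
    and le: "AE s in lebesgue_on {a..t}. xnorm U (g s) \<le> m s"
  shows "xnorm U (conv a t g) \<le> real CARD('n) * (LINT s|lebesgue_on {a..t}. m s)"
proof -
  have "xnorm U (conv a t g) \<le> (LINT s|lebesgue_on {a..t}. real CARD('n) * m s)"
    unfolding conv_def
  proof (rule xnorm_bochner_integral_le)
    show "AE s in lebesgue_on {a..t}. xnorm U (P (t - s) (g s)) \<le> real CARD('n) * m s"
      using le xint_X[OF xi] AE_mem_lebesgue_on
    proof eventually_elim
      case (elim s)
      have "xnorm U (P (t - s) (g s)) \<le> real CARD('n) * xnorm U (g s)"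
        using elim by (intro xnorm_P_le) auto
      also have "\<dots> \<le> real CARD('n) * m s" using elim(1) by (rule mult_left_mono) simp
      finally show ?case .
    qed
  qed (use m xi in \<open>auto intro: xint_conv\<close>)
  then show ?thesis by simp
qed

lemma conv_diff:
  assumes "xint {a..t} g" "xint {a..t} h"
  shows "conv a t (\<lambda>s. g s - h s) = conv a t g - conv a t h"
proof -
  have "bochner_integral {a..t} (\<lambda>s. P (t - s) (g s - h s)) =
      bochner_integral {a..t} (\<lambda>s. P (t - s) (g s) - P (t - s) (h s))"
  proof (rule bochner_integral_cong_AE[OF xint_conv[OF xint_diff[OF assms]]])
    show "AE s in lebesgue_on {a..t}. P (t - s) (g s - h s) = P (t - s) (g s) - P (t - s) (h s)"
      using xint_X[OF assms(1)] xint_X[OF assms(2)] AE_mem_lebesgue_on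
      by eventually_elim (auto intro: P_diff)
  qed auto
  also have "\<dots> = bochner_integral {a..t} (\<lambda>s. P (t - s) (g s)) - bochner_integral {a..t} (\<lambda>s. P (t - s) (h s))"
    by (rule bochner_integral_diff) (auto intro: xint_conv assms)
  finally show ?thesis unfolding conv_def .
qed

text \<open>For \<open>s \<le> r\<close> the semigroup law splits \<open>P (t - s)\<close> into
  \<open>P (t - r)\<close> after \<open>P (r - s)\<close>, and the first factor no longer depends on
  \<open>s\<close>. This serves the conditions defining \<open>KI\<close>, which look at
  subintervals and hence at solutions restarted at their left end.\<close>

lemma conv_restart_tail:
  assumes xi: "xint {a..r} g" and "r \<le> t"
  shows "bochner_integral {a..r} (\<lambda>s. P (t - s) (g s)) = P (t - r) (conv a r g)"
proof -
  have xr: "xint {a..r} (\<lambda>s. P (r - s) (g s))" by (rule xint_conv[OF xi]) auto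
  have "bochner_integral {a..r} (\<lambda>s. P (t - r) (P (r - s) (g s))) = P (t - r) (conv a r g)"
    unfolding conv_def by (rule bochner_integral_P[OF xr]) (use assms in simp)
  moreover have "bochner_integral {a..r} (\<lambda>s. P (t - s) (g s)) = bochner_integral {a..r} (\<lambda>s. P (t - r) (P (r - s) (g s)))"
  proof (rule bochner_integral_cong_AE[OF xint_conv[OF xi]])
    show "AE s in lebesgue_on {a..r}. P (t - s) (g s) = P (t - r) (P (r - s) (g s))"
      using xint_X[OF xi] AE_mem_lebesgue_on
    proof eventually_elim
      case (elim s)
      then show ?case
        using P_plus[of "t - r" "r - s" "g s"] assms(2) by simp
    qed
  qed (use assms in auto)
  ultimately show ?thesis by simp
qed

lemma conv_restart:
  assumes xi: "xint {a..t} g" and "a \<le> r" "r \<le> t"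
  shows "conv a t g = P (t - r) (conv a r g) + conv r t g"
proof -
  have "conv a t g = bochner_integral {a..r} (\<lambda>s. P (t - s) (g s)) + conv r t g"
    unfolding conv_def by (rule bochner_integral_combine[OF xint_conv[OF xi]]) (use assms in auto)
  then show ?thesis
    using conv_restart_tail[of a r g t] xint_mono[OF xi, of "{a..r}"] assms by simp
qed

text \<open>Extending the integrand by zero to the fixed interval \<open>{a..b}\<close> puts the
  dependence on \<open>t\<close> into the kernel \<open>K t\<close> alone, and dominated convergence
  applies along sequences of times.\<close>

lemma continuous_on_conv:
  assumes xi: "xint {a..b} g"
  shows "continuous_on {a..b} (\<lambda>t. conv a t g)"
proof -
  let ?M = "lebesgue_on {a..b}"
  define K where "K t s = (if s \<in> {a..t} then P (t - s) (g s) else 0)" for t s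
  have xi_sub: "xint {a..t} g" if "t \<in> {a..b}" for t
    using that by (intro xint_mono[OF xi]) auto
  have KX: "AE s in ?M. K t s \<in> X" for t
    using xint_X[OF xi] by eventually_elim (auto simp: K_def intro: P_X)
  have Kb: "AE s in ?M. xnorm U (K t s) \<le> real CARD('n) * xnorm U (g s)" for t
    using xint_X[OF xi] by eventually_elim (auto simp: K_def intro: xnorm_P_le)
  have Km: "(\<lambda>s. ev (K t s) x) \<in> borel_measurable ?M" if "t \<in> {a..b}" "x \<in> closure U" for t x
  proof -
    have "(\<lambda>s. if s \<in> {a..t} then ev (P (t - s) (g s)) x else 0) \<in> borel_measurable ?M"
      using that xint_meas[OF xint_conv[OF xi_sub[OF that(1)]] that(2), of t]
      by (subst borel_measurable_if_lebesgue_on) auto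
    moreover have "(\<lambda>s. ev (K t s) x) = (\<lambda>s. if s \<in> {a..t} then ev (P (t - s) (g s)) x else 0)"
      by (auto simp: K_def)
    ultimately show ?thesis by simp
  qed
  have xK: "xint {a..b} (K t)" if "t \<in> {a..b}" for t
    by (rule xint_I[OF _ KX Km[OF that] _ Kb]) (use xint_integrable_xnorm[OF xi] in auto)
  have conv_K: "conv a t g = bochner_integral {a..b} (K t)" if t: "t \<in> {a..b}" for t
  proof (rule ev_eqI)
    fix x
    have "(LINT s|lebesgue_on {a..t}. ev (P (t - s) (g s)) x) =
        (LINT s|?M. (if s \<in> {a..t} then ev (P (t - s) (g s)) x else 0))"
      using t by (intro integral_restrict[symmetric]) auto
    also have "\<dots> = (LINT s|?M. ev (K t s) x)"
      by (rule Bochner_Integration.integral_cong) (auto simp: K_def)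
    finally show "ev (conv a t g) x = ev (bochner_integral {a..b} (K t)) x"
      using t by (simp add: conv_def ev_bochner_integral xK xint_conv xi_sub)
  qed
  show ?thesis
    unfolding continuous_on_sequentially
  proof (intro ballI allI impI, elim conjE)
    fix \<sigma> t assume t: "t \<in> {a..b}" and \<sigma>: "\<forall>k. \<sigma> k \<in> {a..b}" and lim: "\<sigma> \<longlonglongrightarrow> t"
    have xD: "xint {a..b} (\<lambda>s. K (\<sigma> k) s - K t s)" for k
      using t \<sigma> by (intro xint_diff xK) auto
    have "(\<lambda>k. LINT s|?M. xnorm U (K (\<sigma> k) s - K t s)) \<longlonglongrightarrow> (LINT s|?M. 0)"
    proof (rule integral_dominated_convergence[where w="\<lambda>s. 2 * (real CARD('n) * xnorm U (g s))"])
      show "(\<lambda>s. xnorm U (K (\<sigma> k) s - K t s)) \<in> borel_measurable ?M" for k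
        using xint_integrable_xnorm[OF xD] by simp
      show "integrable ?M (\<lambda>s. 2 * (real CARD('n) * xnorm U (g s)))"
        using xint_integrable_xnorm[OF xi] by simp
      show "AE s in ?M. norm (xnorm U (K (\<sigma> k) s - K t s)) \<le> 2 * (real CARD('n) * xnorm U (g s))" for k
        using Kb[of "\<sigma> k"] Kb[of t] by eventually_elim (use xnorm_diff in \<open>smt (verit) real_norm_def xnorm_nonneg\<close>)
      \<comment> \<open>At \<open>s = t\<close> the indicator in the kernel jumps, so convergence
        may fail at this one time.\<close>
      have "AE s in lebesgue. s \<noteq> t" by (rule AE_completion[OF AE_lborel_singleton])
      then have "AE s in ?M. s \<noteq> t" by (rule AE_lebesgue_on) simp
      then show "AE s in ?M. (\<lambda>k. xnorm U (K (\<sigma> k) s - K t s)) \<longlonglongrightarrow> 0"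
        using xint_X[OF xi] AE_mem_lebesgue_on
      proof eventually_elim
        case (elim s)
        show ?case
        proof (cases "s < t")
          case True
          have ev: "\<forall>\<^sub>F k in sequentially. s < \<sigma> k" using lim True by (rule order_tendstoD)
          \<comment> \<open>The maximum keeps every argument in the domain of continuity
            \<open>{0..}\<close>; it is inactive as soon as \<open>s < \<sigma> k\<close>.\<close>
          have "(\<lambda>k. P (max 0 (\<sigma> k - s)) (g s)) \<longlonglongrightarrow> P (max 0 (t - s)) (g s)"
            by (rule continuous_on_tendsto_compose[OF continuous_on_P[OF elim(2)]])
              (use lim in \<open>auto intro!: tendsto_intros\<close>)
          then have "(\<lambda>k. real CARD('n) * norm (P (max 0 (\<sigma> k - s)) (g s) - P (max 0 (t - s)) (g s))) \<longlonglongrightarrow> real CARD('n) * 0"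
            by (intro tendsto_intros tendsto_norm_zero LIM_zero)
          then have z: "(\<lambda>k. real CARD('n) * norm (P (max 0 (\<sigma> k - s)) (g s) - P (max 0 (t - s)) (g s))) \<longlonglongrightarrow> 0" by simp
          show ?thesis
          proof (rule Lim_null_comparison[OF _ z])
            show "\<forall>\<^sub>F k in sequentially. norm (xnorm U (K (\<sigma> k) s - K t s)) \<le>
                real CARD('n) * norm (P (max 0 (\<sigma> k - s)) (g s) - P (max 0 (t - s)) (g s))"
              using ev
            proof eventually_elim
              case (elim k)
              then have "K (\<sigma> k) s - K t s = P (max 0 (\<sigma> k - s)) (g s) - P (max 0 (t - s)) (g s)"
                using True \<open>s \<in> {a..b}\<close> by (simp add: K_def)
              then show ?case using xnorm_le_norm by simp
            qed
          qed
        next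
          case False
          then have "t < s" using elim(1) by simp
          then have "\<forall>\<^sub>F k in sequentially. \<sigma> k < s" using lim by (intro order_tendstoD)
          then have "\<forall>\<^sub>F k in sequentially. xnorm U (K (\<sigma> k) s - K t s) = 0"
            by eventually_elim (use \<open>t < s\<close> in \<open>simp add: K_def\<close>)
          then show ?thesis by (rule tendsto_eventually)
        qed
      qed
    qed auto
    then have lim0: "(\<lambda>k. LINT s|?M. xnorm U (K (\<sigma> k) s - K t s)) \<longlonglongrightarrow> 0" by simp
    show "((\<lambda>t. conv a t g) \<circ> \<sigma>) \<longlonglongrightarrow> conv a t g"
    proof (rule LIM_zero_cancel, rule Lim_null_comparison[OF _ lim0])
      have "norm (conv a (\<sigma> k) g - conv a t g) \<le> (LINT s|?M. xnorm U (K (\<sigma> k) s - K t s))" for k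
      proof -
        have "conv a (\<sigma> k) g - conv a t g = bochner_integral {a..b} (\<lambda>s. K (\<sigma> k) s - K t s)"
          using \<sigma> t by (simp add: conv_K bochner_integral_diff xK)
        then have "norm (conv a (\<sigma> k) g - conv a t g) \<le> xnorm U (bochner_integral {a..b} (\<lambda>s. K (\<sigma> k) s - K t s))"
          by (simp add: norm_le_xnorm X_CU bochner_integral_X xD)
        also have "\<dots> \<le> (LINT s|?M. xnorm U (K (\<sigma> k) s - K t s))"
          by (rule xnorm_bochner_integral_le[OF xD xint_integrable_xnorm[OF xD]]) simp
        finally show ?thesis .
      qed
      then show "\<forall>\<^sub>F k in sequentially. norm (((\<lambda>t. conv a t g) \<circ> \<sigma>) k - conv a t g)
          \<le> (LINT s|?M. xnorm U (K (\<sigma> k) s - K t s))"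
        by simp
    qed
  qed
qed

end

section \<open>Caratheodory maps and moduli of continuity\<close>

lemma zero_in_cball1 [simp]: "0 \<in> (cball1 (real j) :: (real ^ 'n) set)"
  by (simp add: cball1_def)

lemma SC_AE_continuous:
  "f \<in> SC U \<Longrightarrow> AE t in lebesgue. continuous_on (closure U \<times> UNIV) (\<lambda>(x, y). f t x y)"
  by (simp add: SC_def)

lemma LC_SC: "f \<in> LC U \<Longrightarrow> f \<in> SC U"
  by (simp add: LC_def)

lemma SC_m_bound: "f \<in> SC U \<Longrightarrow> \<exists>m. m_bound U (cball1 r) f m"
  using compact_cball1 by (auto simp: SC_def)

lemma LC_l_bound: "f \<in> LC U \<Longrightarrow> \<exists>l. l_bound U (cball1 r) f l"
  using compact_cball1 by (auto simp: LC_def)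

lemma L1loc_integrable: "m \<in> L1loc \<Longrightarrow> integrable (lebesgue_on {a..b}) m"
  by (simp add: L1loc_def integrable_lebesgue_on_iff)

lemma LINT_combine:
  fixes m :: "real \<Rightarrow> real"
  assumes "integrable (lebesgue_on {a..c}) m" "a \<le> b" "b \<le> c"
  shows "(LINT t|lebesgue_on {a..c}. m t) = (LINT t|lebesgue_on {a..b}. m t) + (LINT t|lebesgue_on {b..c}. m t)"
proof (rule has_bochner_integral_integral_eq)
  have "integrable (lebesgue_on {a..b}) m" "integrable (lebesgue_on {b..c}) m"
    using assms by (auto intro: integrable_lebesgue_on_mono[OF assms(1)])
  then show "has_bochner_integral (lebesgue_on {a..c}) m
      ((LINT t|lebesgue_on {a..b}. m t) + (LINT t|lebesgue_on {b..c}. m t))"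
    by (intro has_bochner_integral_combine[OF assms(2,3)] has_bochner_integral_integrable)
qed

lemma LINT_singleton: "(LINT t|lebesgue_on {a::real}. m t) = (0::real)"
  by (rule integral_eq_zero_null_sets) (intro null_sets_completionI finite_imp_null_set_lborel, simp)

lemma LINT_nonneg:
  fixes m :: "real \<Rightarrow> real"
  assumes "AE t in lebesgue. 0 \<le> m t" "J \<in> sets lebesgue"
  shows "0 \<le> (LINT t|lebesgue_on J. m t)"
  by (rule integral_nonneg_AE) (rule AE_lebesgue_on[OF assms])

lemma LINT_mono_set:
  fixes m :: "real \<Rightarrow> real"
  assumes int: "integrable (lebesgue_on {a..b}) m" and nn: "AE t in lebesgue. 0 \<le> m t"
    and sub: "{c..d} \<subseteq> {a..b}"
  shows "(LINT t|lebesgue_on {c..d}. m t) \<le> (LINT t|lebesgue_on {a..b}. m t)"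
  by (rule integral_mono_lebesgue_on_AE[OF int]) (use sub AE_lebesgue_on[OF nn] in auto)

lemma SC_measurable_section:
  fixes f :: "('m::finite, 'n::finite) cmap"
  assumes f: "f \<in> SC U" and x: "x \<in> closure U"
    and v: "v \<in> borel_measurable (lebesgue_on J)"
  shows "(\<lambda>s. f s x (v s)) \<in> borel_measurable (lebesgue_on J)"
proof -
  have id: "(\<lambda>s::real. s) \<in> borel_measurable (lebesgue_on J)"
    using id_borel_measurable_lebesgue_on by (simp add: id_def)
  have "(\<lambda>s. (s, x, v s)) \<in> measurable (lebesgue_on J) (restrict_space borel (UNIV \<times> closure U \<times> UNIV))"
    using x by (intro measurable_restrict_space2 borel_measurable_Pair id v) auto
  moreover have "(\<lambda>(t, x, y). f t x y) \<in> borel_measurable (restrict_space borel (UNIV \<times> closure U \<times> UNIV))"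
    using f by (simp add: SC_def)
  ultimately have "(\<lambda>s. (\<lambda>(t, x, y). f t x y) (s, x, v s)) \<in> borel_measurable (lebesgue_on J)"
    by (rule measurable_compose)
  then show ?thesis by simp
qed

section \<open>Superposition maps and optimal m-bounds\<close>

context state_domain
begin

text \<open>The quantifier over \<open>z\<close> stands inside \<open>AE\<close>: one null set of
  times serves all functions, so \<open>z\<close> may later be replaced by the value at time
  \<open>t\<close> of a curve.\<close>

lemma nem_bound:
  assumes f: "f \<in> SC U" and m: "m_bound U K f m"
  shows "AE t in lebesgue. \<forall>z\<in>CU U. (\<forall>x\<in>closure U. ev z x \<in> K) \<longrightarrow> xnorm U (nem U f t z :: ('m, real ^ 'n) bfun) \<le> m t"
proof -
  have "AE t in lebesgue. \<forall>x\<in>closure U. \<forall>y\<in>K. norm1 (f t x y) \<le> m t"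
    using m by (simp add: m_bound_def)
  then show ?thesis
    using SC_AE_continuous[OF f]
  proof eventually_elim
    case (elim t)
    then show ?case
      by (intro ballI impI xnorm_leI) (simp add: ev_nem[where f=f and t=t, OF bounded_U elim(2)])
  qed
qed

lemma nem_lipschitz:
  fixes f :: "('m, 'n) cmap"
  assumes f: "f \<in> SC U" and l: "l_bound U K f l"
  shows "AE t in lebesgue. \<forall>z\<in>CU U. \<forall>z'\<in>CU U. (\<forall>x\<in>closure U. ev z x \<in> K \<and> ev z' x \<in> K) \<longrightarrow>
    xnorm U (nem U f t z - nem U f t z') \<le> l t * xnorm U (z - z')"
proof -
  have "AE t in lebesgue. \<forall>x\<in>closure U. \<forall>y1\<in>K. \<forall>y2\<in>K. norm1 (f t x y1 - f t x y2) \<le> l t * norm1 (y1 - y2)"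
    using l by (simp add: l_bound_def)
  then show ?thesis
    using SC_AE_continuous[OF f]
  proof eventually_elim
    case (elim t)
    show ?case
    proof (intro ballI impI xnorm_leI)
      fix z z' :: "('m, real ^ 'n) bfun" and x
      assume z: "z \<in> CU U" "z' \<in> CU U" "\<forall>x\<in>closure U. ev z x \<in> K \<and> ev z' x \<in> K" and x: "x \<in> closure U"
      have "norm1 (ev (nem U f t z - nem U f t z') x) = norm1 (f t x (ev z x) - f t x (ev z' x))"
        using x by (simp add: ev_nem[where f=f and t=t, OF bounded_U elim(2)] z)
      also have "\<dots> \<le> l t * norm1 (ev (z - z') x)"
        using elim(1) x z(3) by simp
      also have "\<dots> \<le> l t * xnorm U (z - z')"
        using l norm1_ev_le[OF x, of "z - z'"] by (intro mult_left_mono) (auto simp: l_bound_def)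
      finally show "norm1 (ev (nem U f t z - nem U f t z') x) \<le> l t * xnorm U (z - z')" .
    qed
  qed
qed

lemma nem_diff:
  fixes f g :: "('m, 'n) cmap"
  assumes f: "f \<in> SC U" and g: "g \<in> SC U"
  shows "AE t in lebesgue. \<forall>z\<in>CU U. nem U (f - g) t z = nem U f t z - nem U g t z"
  using SC_AE_continuous[OF f] SC_AE_continuous[OF g]
proof eventually_elim
  case (elim t)
  have "continuous_on (closure U \<times> UNIV) (\<lambda>p. (\<lambda>(x, y). f t x y) p - (\<lambda>(x, y). g t x y) p)"
    using elim by (rule continuous_on_diff)
  moreover have "(\<lambda>p. (\<lambda>(x, y). f t x y) p - (\<lambda>(x, y). g t x y) p) = (\<lambda>(x, y). (f - g) t x y)"
    by auto
  ultimately have "continuous_on (closure U \<times> UNIV) (\<lambda>(x, y). (f - g) t x y)"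
    by simp
  then show ?case
    by (intro ballI ev_eqI) (simp add: ev_nem[OF bounded_U] elim)
qed

lemma nem_X:
  fixes f :: "('m, 'n) cmap"
  assumes f: "f \<in> SC U" and bcf: "bc_compatible U bc f"
  shows "AE t in lebesgue. \<forall>z\<in>X. nem U f t z \<in> X"
  using SC_AE_continuous[OF f]
proof eventually_elim
  case (elim t)
  show ?case
  proof
    fix z assume z: "z \<in> X"
    note e = ev_nem[where f=f and t=t, OF bounded_U elim X_CU[OF z]]
    have "continuous_on (closure U) (\<lambda>x. (\<lambda>(x, y). f t x y) (x, ev z x))"
      using z by (intro continuous_on_compose2[OF elim] continuous_intros) (auto simp: state_space_def CU_def)
    then have "continuous_on (closure U) (\<lambda>x. f t x (ev z x))"
      by simp
    then have "continuous_on (closure U) (ev (nem U f t z))"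
      by (rule continuous_on_cong[THEN iffD1, rotated -1]) (auto simp: e)
    moreover have "ev (nem U f t z) x = 0" if "bc = Dirichlet" "x \<in> frontier U" for x
      using that z bcf by (auto simp: e bc_compatible_def state_space_def)
    ultimately show "nem U f t z \<in> X"
      by (auto simp: state_space_def CU_def e)
  qed
qed

lemma continuous_bounded:
  fixes v :: "real \<Rightarrow> ('m, real ^ 'n) bfun"
  assumes "continuous_on {a..b} v"
  obtains R where "\<And>t. t \<in> {a..b} \<Longrightarrow> xnorm U (v t) \<le> R"
proof -
  have "compact ((\<lambda>t. xnorm U (v t)) ` {a..b})"
    by (intro compact_continuous_image continuous_intros assms) auto
  then have "bdd_above ((\<lambda>t. xnorm U (v t)) ` {a..b})"
    by (intro bounded_imp_bdd_above compact_imp_bounded)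
  then obtain R where "\<And>y. y \<in> (\<lambda>t. xnorm U (v t)) ` {a..b} \<Longrightarrow> y \<le> R"
    unfolding bdd_above_def by blast
  then show thesis
    by (intro that[of R]) simp
qed

text \<open>Point evaluations reduce measurability to \<open>f s x (ev (v s) x)\<close>, a Borel map
  composed with a continuous curve. The curve has bounded range, so a single m-bound
  dominates.\<close>

lemma xint_nem:
  fixes f :: "('m, 'n) cmap"
  assumes f: "f \<in> SC U" and bcf: "bc_compatible U bc f"
    and v: "continuous_on {a..b} v" and vX: "\<And>t. t \<in> {a..b} \<Longrightarrow> v t \<in> X"
  shows "xint {a..b} (\<lambda>s. nem U f s (v s))"
proof -
  obtain R where R: "\<And>t. t \<in> {a..b} \<Longrightarrow> xnorm U (v t) \<le> R"
    using continuous_bounded[OF v] by blast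
  obtain m where m: "m_bound U (cball1 R) f m"
    using SC_m_bound[OF f] by blast
  show ?thesis
  proof (rule xint_I)
    show "AE s in lebesgue_on {a..b}. nem U f s (v s) \<in> X"
      using AE_lebesgue_on[OF nem_X[OF f bcf], of "{a..b}"] AE_mem_lebesgue_on by (auto simp: vX)
    show "integrable (lebesgue_on {a..b}) m"
      using m by (auto simp: m_bound_def intro: L1loc_integrable)
    have "AE s in lebesgue_on {a..b}. \<forall>z\<in>CU U. (\<forall>x\<in>closure U. ev z x \<in> cball1 R) \<longrightarrow> xnorm U (nem U f s z) \<le> m s"
      by (rule AE_lebesgue_on[OF nem_bound[OF f m]]) simp
    then show "AE s in lebesgue_on {a..b}. xnorm U (nem U f s (v s)) \<le> m s"
      using AE_mem_lebesgue_on
    proof eventually_elim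
      case (elim s)
      have "\<forall>x\<in>closure U. ev (v s) x \<in> cball1 R"
        using R[OF elim(2)] norm1_ev_le[of _ "v s"] by (force simp: cball1_def)
      then show ?case using elim vX X_CU by blast
    qed
    fix x assume x: "x \<in> closure U"
    have "continuous_on {a..b} (\<lambda>s. ev (v s) x)"
      by (rule bounded_linear.continuous_on[OF bounded_linear_ev v])
    then have "(\<lambda>s. f s x (ev (v s) x)) \<in> borel_measurable (lebesgue_on {a..b})"
      by (intro SC_measurable_section[OF f x] continuous_imp_measurable_on_sets_lebesgue) auto
    then show "(\<lambda>s. ev (nem U f s (v s)) x) \<in> borel_measurable (lebesgue_on {a..b})"
    proof (rule borel_measurable_lebesgue_on_AE)
      show "AE s in lebesgue_on {a..b}. f s x (ev (v s) x) = ev (nem U f s (v s)) x"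
        using AE_lebesgue_on[OF SC_AE_continuous[OF f], of "{a..b}", simplified] AE_mem_lebesgue_on
        by eventually_elim (simp add: ev_nem bounded_U X_CU vX x)
    qed simp
  qed simp
qed

text \<open>A real supremum is an upper bound only if the set is bounded. Continuity on the compact
  product of \<open>closure U\<close> and the ball gives this for almost every time.\<close>

lemma opt_bound_upper:
  fixes f :: "('m, 'n) cmap"
  assumes f: "f \<in> SC U"
  shows "AE t in lebesgue. \<forall>x\<in>closure U. \<forall>y\<in>cball1 (real j). norm1 (f t x y) \<le> opt_bound U j f t"
  using SC_AE_continuous[OF f]
proof eventually_elim
  case (elim t)
  have "compact ((\<lambda>(x, y). norm1 (f t x y)) ` (closure U \<times> cball1 (real j)))"
  proof (rule compact_continuous_image)
    have "continuous_on (closure U \<times> cball1 (real j)) (\<lambda>p. norm1 ((\<lambda>(x, y). f t x y) p))"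
      by (rule continuous_on_norm1) (rule continuous_on_subset[OF elim], auto)
    then show "continuous_on (closure U \<times> cball1 (real j)) (\<lambda>(x, y). norm1 (f t x y))"
      by (simp add: case_prod_unfold)
  qed (intro compact_Times compact_clU compact_cball1)
  then have bdd: "bdd_above ((\<lambda>(x, y). norm1 (f t x y)) ` (closure U \<times> cball1 (real j)))"
    by (intro bounded_imp_bdd_above compact_imp_bounded)
  show ?case
    unfolding opt_bound_def
  proof (intro ballI)
    fix x y assume "x \<in> closure U" "y \<in> (cball1 (real j) :: (real ^ 'n) set)"
    then show "norm1 (f t x y) \<le> (SUP (x, y)\<in>closure U \<times> cball1 (real j). norm1 (f t x y))"
      using cSUP_upper[OF _ bdd, of "(x, y)"] by simp
  qed
qed

lemma opt_bound_le:
  fixes f :: "('m, 'n) cmap"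
  assumes "\<And>x y. x \<in> closure U \<Longrightarrow> y \<in> cball1 (real j) \<Longrightarrow> norm1 (f t x y) \<le> B"
  shows "opt_bound U j f t \<le> B"
  unfolding opt_bound_def
proof (rule cSUP_least)
  show "closure U \<times> (cball1 (real j) :: (real ^ 'n) set) \<noteq> {}"
    using closure_nonempty zero_in_cball1 by (metis SigmaI empty_iff ex_in_conv)
qed (use assms in auto)

lemma opt_bound_nonneg:
  fixes f :: "('m, 'n) cmap"
  assumes f: "f \<in> SC U"
  shows "AE t in lebesgue. 0 \<le> opt_bound U j f t"
  using opt_bound_upper[OF f, of j]
proof eventually_elim
  case (elim t)
  obtain x where "x \<in> closure U" using closure_nonempty by (metis ex_in_conv)
  then have "norm1 (f t x 0) \<le> opt_bound U j f t" using elim zero_in_cball1 by blast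
  then show ?case using norm1_nonneg order_trans by blast
qed

lemma opt_bound_mono:
  fixes f :: "('m, 'n) cmap"
  assumes f: "f \<in> SC U" and "j \<le> k"
  shows "AE t in lebesgue. opt_bound U j f t \<le> opt_bound U k f t"
  using opt_bound_upper[OF f, of k]
proof eventually_elim
  case (elim t)
  show ?case
    by (rule opt_bound_le) (use elim assms(2) in \<open>auto simp: cball1_def\<close>)
qed

lemma opt_bound_le_m_bound:
  fixes f :: "('m, 'n) cmap"
  assumes "m_bound U (cball1 (real j)) f m"
  shows "AE t in lebesgue. opt_bound U j f t \<le> m t"
proof -
  have "AE t in lebesgue. \<forall>x\<in>closure U. \<forall>y\<in>cball1 (real j). norm1 (f t x y) \<le> m t"
    using assms by (simp add: m_bound_def)
  then show ?thesis
    by eventually_elim (auto intro: opt_bound_le)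
qed

lemma opt_bound_measurable:
  fixes f :: "('m, 'n) cmap"
  assumes f: "f \<in> SC U"
  shows "opt_bound U j f \<in> borel_measurable (lebesgue_on {a..b})"
proof -
  let ?M = "lebesgue_on {a..b}"
  let ?S = "closure U \<times> (cball1 (real j) :: (real ^ 'n) set)"
  obtain m where m: "m_bound U (cball1 (real j)) f m"
    using SC_m_bound[OF f] by blast
  obtain D where D: "countable D" "D \<subseteq> ?S" "?S \<subseteq> closure D"
    using separable[of ?S] .
  have ne: "?S \<noteq> {}"
    using closure_nonempty zero_in_cball1 by (metis SigmaI empty_iff ex_in_conv)
  then have Dne: "D \<noteq> {}" using D(3) by auto
  have clD: "closure D = ?S"
    using D(2,3) closure_minimal[OF D(2) closed_Times[OF closed_closure compact_imp_closed[OF compact_cball1]]] by blast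
  \<comment> \<open>The minimum with \<open>m t\<close> keeps the family bounded above at every
    time, as the countable supremum requires; for almost every \<open>t\<close> it changes
    nothing.\<close>
  define h where "h p t = min (norm1 (f t (fst p) (snd p))) (m t)" for p t
  have m_int: "integrable ?M m"
    using m by (auto simp: m_bound_def intro: L1loc_integrable)
  have bdd: "bdd_above ((\<lambda>p. h p t) ` D)" for t
    by (rule bdd_aboveI2[where M="m t"]) (simp add: h_def)
  have "(\<lambda>t. h p t) \<in> borel_measurable ?M" if "p \<in> D" for p
    unfolding h_def
  proof (intro borel_measurable_min measurable_compose[OF _ borel_measurable_norm1])
    show "(\<lambda>t. f t (fst p) (snd p)) \<in> borel_measurable ?M"
      using that D(2) by (intro SC_measurable_section[OF f]) auto
  qed (use m_int in auto)
  then have "(\<lambda>t. SUP p\<in>D. h p t) \<in> borel_measurable ?M"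
    by (intro borel_measurable_cSUP D bdd)
  then show ?thesis
  proof (rule borel_measurable_lebesgue_on_AE)
    have "AE t in lebesgue. (SUP p\<in>D. h p t) = opt_bound U j f t"
    proof -
      have "AE t in lebesgue. \<forall>x\<in>closure U. \<forall>y\<in>cball1 (real j). norm1 (f t x y) \<le> m t"
        using m by (simp add: m_bound_def)
      then show ?thesis
        using SC_AE_continuous[OF f] opt_bound_upper[OF f, of j]
      proof eventually_elim
        case (elim t)
        have h_eq: "h p t = norm1 (f t (fst p) (snd p))" if "p \<in> D" for p
          using elim(1) that D(2) by (auto simp: h_def)
        show ?case
        proof (rule antisym)
          show "(SUP p\<in>D. h p t) \<le> opt_bound U j f t"
            using Dne D(2) elim(3) by (intro cSUP_least) (auto simp: h_eq)
          have cont: "continuous_on (closure D) (\<lambda>p. norm1 ((\<lambda>(x, y). f t x y) p))"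
            unfolding clD by (rule continuous_on_norm1) (rule continuous_on_subset[OF elim(2)], auto)
          show "opt_bound U j f t \<le> (SUP p\<in>D. h p t)"
          proof (rule opt_bound_le)
            fix x and y :: "real ^ 'n" assume "x \<in> closure U" "y \<in> cball1 (real j)"
            then have xy: "(x, y) \<in> closure D" by (simp add: clD)
            have "norm1 ((\<lambda>(x, y). f t x y) p) \<le> (SUP p\<in>D. h p t)" if "p \<in> D" for p
              using cSUP_upper[OF that bdd, of t] h_eq[OF that] by (simp add: case_prod_unfold)
            from continuous_le_on_closure[OF cont xy this]
            show "norm1 (f t x y) \<le> (SUP p\<in>D. h p t)" by simp
          qed
        qed
      qed
    qed
    then show "AE t in ?M. (SUP p\<in>D. h p t) = opt_bound U j f t"
      by (rule AE_lebesgue_on) simp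
  qed simp
qed

lemma opt_bound_integrable:
  fixes f :: "('m, 'n) cmap"
  assumes f: "f \<in> SC U"
  shows "integrable (lebesgue_on {a..b}) (opt_bound U j f)"
proof -
  obtain m where m: "m_bound U (cball1 (real j)) f m"
    using SC_m_bound[OF f] by blast
  show ?thesis
  proof (rule Bochner_Integration.integrable_bound)
    show "integrable (lebesgue_on {a..b}) m"
      using m by (auto simp: m_bound_def intro: L1loc_integrable)
    have "AE t in lebesgue. norm (opt_bound U j f t) \<le> norm (m t)"
      using opt_bound_le_m_bound[OF m] opt_bound_nonneg[OF f, of j] by eventually_elim simp
    then show "AE t in lebesgue_on {a..b}. norm (opt_bound U j f t) \<le> norm (m t)"
      by (rule AE_lebesgue_on) simp
  qed (rule opt_bound_measurable[OF f])
qed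

lemma nem_opt_bound:
  fixes f :: "('m, 'n) cmap"
  assumes f: "f \<in> SC U"
  shows "AE t in lebesgue. \<forall>z\<in>CU U. xnorm U z \<le> real j \<longrightarrow> xnorm U (nem U f t z) \<le> opt_bound U j f t"
  using SC_AE_continuous[OF f] opt_bound_upper[OF f, of j]
proof eventually_elim
  case (elim t)
  show ?case
  proof (intro ballI impI xnorm_leI)
    fix z :: "('m, real ^ 'n) bfun" and x
    assume z: "z \<in> CU U" "xnorm U z \<le> real j" and x: "x \<in> closure U"
    have "ev z x \<in> cball1 (real j)"
      using norm1_ev_le[OF x, of z] z(2) by (simp add: cball1_def)
    then show "norm1 (ev (nem U f t z) x) \<le> opt_bound U j f t"
      using elim(2) x by (simp add: ev_nem[where f=f and t=t, OF bounded_U elim(1) z(1)])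
  qed
qed

lemma CB_iff: "z \<in> CB U r \<longleftrightarrow> z \<in> CU U \<and> xnorm U z \<le> r" for z :: "('m, real ^ 'n) bfun"
  unfolding CB_def cball1_def using norm1_ev_le[of _ z] xnorm_leI[of z r] order_trans by blast

end

section \<open>Finiteness of the suprema behind the moduli and radii\<close>

context heat
begin

text \<open>The uniform bound \<open>2 * CARD('n)\<close> makes the suprema in \<open>opnorm\<close>
  and \<open>theta_sg\<close> finite, without which neither would dominate anything.\<close>

lemma opnorm_P_diff:
  assumes "0 \<le> t" "0 \<le> r"
  shows "opnorm U bc (\<lambda>z. P t z - P (t + r) z) \<le> 2 * real CARD('n)"
    and "z \<in> X \<Longrightarrow> xnorm U (P t z - P (t + r) z) \<le> opnorm U bc (\<lambda>z. P t z - P (t + r) z) * xnorm U z"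
    and "0 \<le> opnorm U bc (\<lambda>z. P t z - P (t + r) z)"
proof -
  let ?L = "\<lambda>z. P t z - P (t + r) z"
  have b: "xnorm U (?L z) \<le> 2 * real CARD('n) * xnorm U z" if "z \<in> X" for z
    using xnorm_diff[of "P t z" "P (t + r) z"] xnorm_P_le[of t z] xnorm_P_le[of "t + r" z] that assms by simp
  have b1: "xnorm U (?L z) \<le> 2 * real CARD('n)" if "z \<in> {z \<in> X. xnorm U z \<le> 1}" for z
    by (rule order_trans[OF b mult_left_le]) (use that in auto)
  have bdd: "bdd_above ((\<lambda>z. xnorm U (?L z)) ` {z \<in> X. xnorm U z \<le> 1})"
    by (rule bdd_aboveI2) (rule b1)
  have zero: "0 \<in> {z \<in> X. xnorm U z \<le> 1}" by simp
  show "opnorm U bc ?L \<le> 2 * real CARD('n)"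
    unfolding opnorm_def by (rule cSUP_least) (use zero b1 in blast)+
  show nn: "0 \<le> opnorm U bc ?L"
    unfolding opnorm_def by (rule order_trans[OF xnorm_nonneg cSUP_upper[OF zero bdd]])
  show "xnorm U (?L z) \<le> opnorm U bc ?L * xnorm U z" if z: "z \<in> X"
  proof (cases "xnorm U z = 0")
    case True
    then show ?thesis using b[OF z] by simp
  next
    case False
    then have pos: "0 < xnorm U z" using xnorm_nonneg[of z] by linarith
    define z' where "z' = (1 / xnorm U z) *\<^sub>R z"
    have z': "z' \<in> {z \<in> X. xnorm U z \<le> 1}"
      using z pos by (auto simp: z'_def xnorm_scaleR intro: X_scaleR)
    have zz: "z = xnorm U z *\<^sub>R z'" using pos by (simp add: z'_def)
    have "?L z = xnorm U z *\<^sub>R ?L z'"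
    proof -
      have "P s z = xnorm U z *\<^sub>R P s z'" if "0 \<le> s" for s
        by (subst zz) (rule P_scaleR[OF that], use z' in blast)
      then show ?thesis using assms by (simp add: scaleR_diff_right)
    qed
    then have "xnorm U (?L z) = xnorm U z * xnorm U (?L z')"
      by (simp only: xnorm_scaleR abs_of_nonneg[OF xnorm_nonneg])
    moreover have "xnorm U (?L z') \<le> opnorm U bc ?L"
      unfolding opnorm_def by (rule cSUP_upper[OF z' bdd])
    ultimately show ?thesis using pos by (simp add: mult.commute mult_left_mono)
  qed
qed

lemma theta_sg_ge:
  assumes t: "1 / real \<nu> \<le> t" "t \<le> q2 - q1" and r: "0 \<le> r" "r \<le> s"
  shows "0 \<le> theta_sg U bc T q1 q2 \<nu> s"
    and "z \<in> X \<Longrightarrow> xnorm U (P t z - P (t + r) z) \<le> theta_sg U bc T q1 q2 \<nu> s * xnorm U z"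
proof -
  have t0: "0 \<le> t" if "1 / real \<nu> \<le> t" for t
    using that by (meson divide_nonneg_nonneg of_nat_0_le_iff order_trans zero_le_one)
  have "(\<lambda>(t, r). opnorm U bc (\<lambda>z. P t z - P (t + r) z)) (t, r) \<le> theta_sg U bc T q1 q2 \<nu> s"
    unfolding theta_sg_def
  proof (rule cSUP_upper)
    show "bdd_above ((\<lambda>(t, r). opnorm U bc (\<lambda>z. P t z - P (t + r) z)) ` ({1 / real \<nu>..q2 - q1} \<times> {0..s}))"
    proof (rule bdd_aboveI2[where M="2 * real CARD('n)"])
      fix p assume "p \<in> {1 / real \<nu>..q2 - q1} \<times> {0..s}"
      then show "(\<lambda>(t, r). opnorm U bc (\<lambda>z. P t z - P (t + r) z)) p \<le> 2 * real CARD('n)"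
        using opnorm_P_diff(1)[OF t0[of "fst p"], of "snd p"] by (auto simp: case_prod_unfold)
    qed
  qed (use t r in auto)
  then have le: "opnorm U bc (\<lambda>z. P t z - P (t + r) z) \<le> theta_sg U bc T q1 q2 \<nu> s" by simp
  show "0 \<le> theta_sg U bc T q1 q2 \<nu> s"
    by (rule order_trans[OF opnorm_P_diff(3) le]) (use t0[OF t(1)] r in auto)
  show "xnorm U (P t z - P (t + r) z) \<le> theta_sg U bc T q1 q2 \<nu> s * xnorm U z" if "z \<in> X"
    by (rule order_trans[OF opnorm_P_diff(2)[OF t0[OF t(1)] r(1) that] mult_right_mono[OF le xnorm_nonneg]])
qed

end

locale equi = heat U bc T
  for U :: "(real ^ 'm::finite) set" and bc :: "('n::finite, real ^ 'm) bc" and T +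
  fixes E :: "('m, 'n) cmap set"
  assumes E_LC: "E \<subseteq> LC U" and E_bc: "\<And>g. g \<in> E \<Longrightarrow> bc_compatible U bc g"
    and E_equi: "equicontinuous_m_bounds U E"
begin

lemma E_SC: "g \<in> E \<Longrightarrow> g \<in> SC U"
  using E_LC LC_SC by blast

text \<open>The optimal m-bound lies almost everywhere below any other m-bound on the same ball, so
  it inherits the equicontinuity of the family \<open>S\<close>.\<close>

lemma equi_small:
  assumes j: "1 \<le> j" and r: "0 < r" and e: "0 < e"
  obtains d where "0 < d" "\<And>g t1 t2. g \<in> E \<Longrightarrow> - r \<le> t1 \<Longrightarrow> t1 \<le> t2 \<Longrightarrow> t2 \<le> r \<Longrightarrow> t2 - t1 < d \<Longrightarrow>
    (LINT t|lebesgue_on {t1..t2}. opt_bound U j g t) < e"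
proof -
  from E_equi[unfolded equicontinuous_m_bounds_def, THEN spec, THEN mp, OF j]
  obtain S where S: "\<forall>f\<in>E. \<exists>m\<in>S. m_bound U (cball1 (real j)) f m"
    "\<forall>r>0. \<forall>\<epsilon>>0. \<exists>\<delta>>0. \<forall>t1 t2. - r \<le> t1 \<and> t1 \<le> t2 \<and> t2 \<le> r \<and> t2 - t1 < \<delta> \<longrightarrow>
           (SUP m\<in>S. ereal (LINT t:{t1..t2}|lebesgue. m t)) < ereal \<epsilon>"
    by (elim exE conjE) (rule that, assumption+)
  from S(2)[THEN spec, THEN mp, OF r, THEN spec, THEN mp, OF e]
  obtain d where d: "0 < d" "\<forall>t1 t2. - r \<le> t1 \<and> t1 \<le> t2 \<and> t2 \<le> r \<and> t2 - t1 < d \<longrightarrow>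
           (SUP m\<in>S. ereal (LINT t:{t1..t2}|lebesgue. m t)) < ereal e"
    by (elim exE conjE) (rule that, assumption+)
  show thesis
  proof (rule that[OF d(1)])
    fix g t1 t2 assume g: "g \<in> E" and t: "- r \<le> t1" "t1 \<le> t2" "t2 \<le> r" "t2 - t1 < d"
    obtain m where m: "m \<in> S" "m_bound U (cball1 (real j)) g m" using S(1) g by blast
    have "ereal (LINT t:{t1..t2}|lebesgue. m t) < ereal e"
      using SUP_upper[OF m(1), of "\<lambda>m. ereal (LINT t:{t1..t2}|lebesgue. m t)"] d(2)[rule_format, of t1 t2] t
      by (meson le_less_trans)
    then have "(LINT t|lebesgue_on {t1..t2}. m t) < e"
      by (simp add: set_lebesgue_integral_eq)
    moreover have "(LINT t|lebesgue_on {t1..t2}. opt_bound U j g t) \<le> (LINT t|lebesgue_on {t1..t2}. m t)"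
    proof (rule integral_mono_AE)
      show "AE t in lebesgue_on {t1..t2}. opt_bound U j g t \<le> m t"
        by (rule AE_lebesgue_on[OF opt_bound_le_m_bound[OF m(2)]]) simp
    qed (use m E_SC[OF g] in \<open>auto simp: m_bound_def intro: L1loc_integrable opt_bound_integrable\<close>)
    ultimately show "(LINT t|lebesgue_on {t1..t2}. opt_bound U j g t) < e" by simp
  qed
qed

text \<open>Equicontinuity gives a length below which every integral is less than 1; cutting
  \<open>{a..b}\<close> into \<open>K\<close> shorter pieces bounds the whole integral by
  \<open>K\<close>, uniformly over \<open>E\<close>.\<close>

lemma equi_bounded:
  assumes j: "1 \<le> j"
  obtains C where "\<And>g. g \<in> E \<Longrightarrow> (LINT t|lebesgue_on {a..b}. opt_bound U j g t) \<le> C"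
proof (cases "a \<le> b")
  case True
  define r where "r = 1 + \<bar>a\<bar> + \<bar>b\<bar>"
  obtain d where d: "0 < d" "\<And>g t1 t2. g \<in> E \<Longrightarrow> - r \<le> t1 \<Longrightarrow> t1 \<le> t2 \<Longrightarrow> t2 \<le> r \<Longrightarrow> t2 - t1 < d \<Longrightarrow>
    (LINT t|lebesgue_on {t1..t2}. opt_bound U j g t) < 1"
    by (rule equi_small[OF j, of r 1]) (auto simp: r_def intro: that)
  obtain K :: nat where K: "(b - a) / d < real K" using reals_Archimedean2 by blast
  have K0: "0 < real K" using K d(1) True by (smt (verit) divide_nonneg_pos)
  define h where "h = (b - a) / real K"
  have h: "0 \<le> h" "h < d" "a + real K * h = b"
    using True K0 K d(1) by (auto simp: h_def field_simps)
  have "(LINT t|lebesgue_on {a..a + real i * h}. opt_bound U j g t) \<le> real i" if "i \<le> K" "g \<in> E" for g i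
    using that(1)
  proof (induction i)
    case 0
    have "(LINT t|lebesgue_on {a..a}. opt_bound U j g t) = 0"
      by (simp add: LINT_singleton)
    then show ?case by simp
  next
    case (Suc i)
    have 1: "a + real (Suc i) * h \<le> b"
      using Suc.prems h mult_right_mono[of "real (Suc i)" "real K" h] by simp
    have 2: "a + real (Suc i) * h = (a + real i * h) + h" by (simp add: algebra_simps)
    have 3: "a \<le> a + real i * h" using h(1) by simp
    have "(LINT t|lebesgue_on {a + real i * h..a + real (Suc i) * h}. opt_bound U j g t) < 1"
    proof (rule d(2)[OF that(2)])
      show "- r \<le> a + real i * h" using 3 by (simp add: r_def)
      show "a + real (Suc i) * h \<le> r" using 1 by (simp add: r_def)
    qed (use h(1,2) 2 in auto)
    moreover have "(LINT t|lebesgue_on {a..a + real (Suc i) * h}. opt_bound U j g t) =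
        (LINT t|lebesgue_on {a..a + real i * h}. opt_bound U j g t) +
        (LINT t|lebesgue_on {a + real i * h..a + real (Suc i) * h}. opt_bound U j g t)"
      using 2 3 h(1) by (intro LINT_combine opt_bound_integrable E_SC that(2)) auto
    ultimately show ?case using Suc by simp
  qed
  from this[of K] show thesis using h(3) by (intro that[of "real K"]) auto
next
  case False
  then show thesis by (intro that[of 0]) simp
qed

lemma E_nonneg: "g \<in> E \<Longrightarrow> AE t in lebesgue. 0 \<le> opt_bound U j g t"
  by (rule opt_bound_nonneg[OF E_SC])

lemma E_integrable: "g \<in> E \<Longrightarrow> integrable (lebesgue_on {a..b}) (opt_bound U j g)"
  by (rule opt_bound_integrable[OF E_SC])

lemma SUP_opt_bound_ge:
  assumes "1 \<le> j" "g \<in> E"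
  shows "(LINT t|lebesgue_on {a..b}. opt_bound U j g t) \<le> (SUP g\<in>E. LINT t:{a..b}|lebesgue. opt_bound U j g t)"
proof -
  obtain C where C: "\<And>g. g \<in> E \<Longrightarrow> (LINT t|lebesgue_on {a..b}. opt_bound U j g t) \<le> C"
    using equi_bounded[OF assms(1)] by blast
  have "(LINT t:{a..b}|lebesgue. opt_bound U j g t) \<le> (SUP g\<in>E. LINT t:{a..b}|lebesgue. opt_bound U j g t)"
    by (rule cSUP_upper[OF assms(2)], rule bdd_aboveI2) (use C in \<open>simp add: set_lebesgue_integral_eq\<close>)
  then show ?thesis by (simp add: set_lebesgue_integral_eq)
qed

lemma theta_ge:
  assumes j: "1 \<le> j" and g: "g \<in> E" and t: "t \<in> {q1..q2}" and s: "0 \<le> s"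
  shows "2 * real CARD('n) * (LINT \<tau>|lebesgue_on {t..t + s}. opt_bound U j g \<tau>) \<le> theta U E j q1 q2 s"
proof -
  \<comment> \<open>The interval \<open>{q1..q2 + s}\<close> contains every window over which the
    supremum in \<open>theta\<close> is taken, so one bound makes it finite.\<close>
  obtain C where C: "\<And>g. g \<in> E \<Longrightarrow> (LINT t|lebesgue_on {q1..q2 + s}. opt_bound U j g t) \<le> C"
    using equi_bounded[OF j] by blast
  have "(\<lambda>(t, g). LINT \<tau>:{t..t + s}|lebesgue. opt_bound U j g \<tau>) (t, g) \<le>
      (SUP (t, g)\<in>{q1..q2} \<times> E. LINT \<tau>:{t..t + s}|lebesgue. opt_bound U j g \<tau>)"
  proof (rule cSUP_upper)
    show "bdd_above ((\<lambda>(t, g). LINT \<tau>:{t..t + s}|lebesgue. opt_bound U j g \<tau>) ` ({q1..q2} \<times> E))"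
    proof (rule bdd_aboveI2[where M=C])
      fix p assume "p \<in> {q1..q2} \<times> E"
      then obtain t g where p: "p = (t, g)" "t \<in> {q1..q2}" "g \<in> E" by auto
      have "(LINT \<tau>|lebesgue_on {t..t + s}. opt_bound U j g \<tau>) \<le> (LINT t|lebesgue_on {q1..q2 + s}. opt_bound U j g t)"
        using p(2) by (intro LINT_mono_set E_integrable E_nonneg p(3)) auto
      also have "\<dots> \<le> C" by (rule C[OF p(3)])
      finally show "(\<lambda>(t, g). LINT \<tau>:{t..t + s}|lebesgue. opt_bound U j g \<tau>) p \<le> C"
        by (simp add: p(1) set_lebesgue_integral_eq)
    qed
  qed (use t g in auto)
  then show ?thesis
    unfolding theta_def by (intro mult_left_mono) (auto simp: set_lebesgue_integral_eq)
qed

end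

text \<open>Only the domination of the forcing \<open>g\<close> by the optimal m-bound of a member
  of \<open>E\<close> matters for membership in \<open>KI\<close>, not how \<open>g\<close> arises.
  The truncated solutions fit in with the cut-off nonlinearity as \<open>g\<close>.\<close>

locale forced = equi U bc T E
  for U :: "(real ^ 'm::finite) set" and bc :: "('n::finite, real ^ 'm) bc" and T and E +
  fixes j :: nat and h :: "('m, 'n) cmap" and b :: real
    and g v :: "real \<Rightarrow> ('m, real ^ 'n) bfun" and z0 :: "('m, real ^ 'n) bfun"
  assumes j: "1 \<le> j" and h: "h \<in> E" and z0: "z0 \<in> X"
    and xg: "xint {0..b} g"
    and g_le: "AE s in lebesgue_on {0..b}. xnorm U (g s) \<le> opt_bound U j h s"
    and v: "\<And>t. t \<in> {0..b} \<Longrightarrow> v t = P t z0 + conv 0 t g"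
    and v_le: "\<And>t. t \<in> {0..b} \<Longrightarrow> xnorm U (v t) \<le> real j"
begin

lemma xg_sub: "0 \<le> r \<Longrightarrow> t \<le> b \<Longrightarrow> xint {r..t} g"
  by (rule xint_mono[OF xg]) auto

lemma g_le_sub: "0 \<le> r \<Longrightarrow> t \<le> b \<Longrightarrow> AE s in lebesgue_on {r..t}. xnorm U (g s) \<le> opt_bound U j h s"
  by (rule AE_lebesgue_on_mono[OF g_le]) auto

lemma v_X: "t \<in> {0..b} \<Longrightarrow> v t \<in> X"
  using v z0 xg_sub[of 0 t] by (auto intro!: X_add P_X conv_X)

lemma v_restart:
  assumes "0 \<le> r" "r \<le> t" "t \<le> b"
  shows "v t = P (t - r) (v r) + conv r t g"
proof -
  have "conv 0 t g = P (t - r) (conv 0 r g) + conv r t g"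
    using assms by (intro conv_restart xg_sub) auto
  moreover have "P t z0 = P (t - r) (P r z0)"
    using P_plus[of "t - r" r z0] assms z0 by simp
  moreover have "P (t - r) (v r) = P (t - r) (P r z0) + P (t - r) (conv 0 r g)"
    using assms z0 by (simp add: v P_add P_X conv_X xg_sub)
  ultimately show ?thesis using assms v[of t] by simp
qed

lemma conv_g_le: "0 \<le> r \<Longrightarrow> t \<le> b \<Longrightarrow> xnorm U (conv r t g) \<le> real CARD('n) * (LINT s|lebesgue_on {r..t}. opt_bound U j h s)"
  by (rule conv_bound[OF xg_sub E_integrable[OF h] g_le_sub])

lemma moduli_le:
  assumes r: "0 \<le> r1" "r2 \<le> b" and \<nu>: "1 \<le> \<nu>" and t: "r1 + 1 / real \<nu> \<le> t1" "t1 \<le> t2" "t2 \<le> r2"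
  shows "xnorm U (v t1 - v t2) \<le> theta_nu U bc T E j r1 r2 \<nu> (t2 - t1) + theta U E j r1 r2 (1 / real \<nu>)"
proof -
  define d where "d = 1 / real \<nu>"
  define \<Theta> where "\<Theta> = theta_sg U bc T r1 r2 \<nu> (t2 - t1)"
  let ?o = "opt_bound U j h"
  have d: "0 < d" using \<nu> by (simp add: d_def)
  have t': "r1 + d \<le> t1" using t(1) by (simp add: d_def)
  \<comment> \<open>\<open>t1 - r1\<close> witnesses that the index set of the supremum is
    nonempty.\<close>
  have \<Theta>0: "0 \<le> \<Theta>"
    unfolding \<Theta>_def by (rule theta_sg_ge(1)[of _ "t1 - r1" _ _ "t2 - t1"]) (use t' t d_def in auto)
  have \<Theta>: "xnorm U (P s z - P (s + (t2 - t1)) z) \<le> \<Theta> * xnorm U z" if "d \<le> s" "s \<le> r2 - r1" "z \<in> X" for s z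
    unfolding \<Theta>_def by (rule theta_sg_ge(2)) (use that t d_def in auto)
  define D where "D s = P (t1 - s) (g s) - P (t2 - s) (g s)" for s
  have xD: "xint {r1..t1} D"
    unfolding D_def using r t' t d by (intro xint_diff xint_conv xg_sub) auto
  have xr1: "xint {r1..t1} g" and xr2: "xint {r1..t2} g"
    using r t' t d by (auto intro!: xg_sub)
  have "conv r1 t2 g = bochner_integral {r1..t1} (\<lambda>s. P (t2 - s) (g s)) + conv t1 t2 g"
    unfolding conv_def by (rule bochner_integral_combine[OF xint_conv[OF xr2]]) (use t' t d in auto)
  moreover have "conv r1 t1 g - bochner_integral {r1..t1} (\<lambda>s. P (t2 - s) (g s)) = bochner_integral {r1..t1} D"
    unfolding conv_def D_def
    by (rule bochner_integral_diff[symmetric]) (use t in \<open>auto intro!: xint_conv xr1\<close>)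
  moreover have "bochner_integral {r1..t1} D = bochner_integral {r1..t1 - d} D + bochner_integral {t1 - d..t1} D"
    by (rule bochner_integral_combine[OF xD]) (use t' d in auto)
  moreover have "v t1 = P (t1 - r1) (v r1) + conv r1 t1 g" "v t2 = P (t2 - r1) (v r1) + conv r1 t2 g"
    using r t' t d by (auto intro!: v_restart)
  ultimately have eq: "v t1 - v t2 = (P (t1 - r1) (v r1) - P (t2 - r1) (v r1)) + bochner_integral {r1..t1 - d} D
      + bochner_integral {t1 - d..t1} D - conv t1 t2 g"
    by (simp add: algebra_simps)
  have r1b: "r1 \<in> {0..b}" using r t' t d by auto
  have 1: "xnorm U (P (t1 - r1) (v r1) - P (t2 - r1) (v r1)) \<le> \<Theta> * real j"
  proof -
    have "xnorm U (P (t1 - r1) (v r1) - P (t1 - r1 + (t2 - t1)) (v r1)) \<le> \<Theta> * xnorm U (v r1)"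
      using t' t r1b by (intro \<Theta> v_X) auto
    also have "\<dots> \<le> \<Theta> * real j" by (intro mult_left_mono v_le r1b \<Theta>0)
    finally show ?thesis by simp
  qed
  have 2: "xnorm U (bochner_integral {r1..t1 - d} D) \<le> \<Theta> * (SUP g\<in>E. LINT \<tau>:{r1..r2}|lebesgue. opt_bound U j g \<tau>)"
  proof -
    have "xnorm U (bochner_integral {r1..t1 - d} D) \<le> (LINT s|lebesgue_on {r1..t1 - d}. \<Theta> * ?o s)"
    proof (rule xnorm_bochner_integral_le)
      show "xint {r1..t1 - d} D" using d by (intro xint_mono[OF xD]) auto
      have "AE s in lebesgue_on {r1..t1 - d}. xnorm U (g s) \<le> ?o s"
        using r t d by (intro g_le_sub) auto
      moreover have "AE s in lebesgue_on {r1..t1 - d}. g s \<in> X"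
        using r t d by (intro xint_X xg_sub) auto
      ultimately show "AE s in lebesgue_on {r1..t1 - d}. xnorm U (D s) \<le> \<Theta> * ?o s"
        using AE_mem_lebesgue_on
      proof eventually_elim
        case (elim s)
        have "xnorm U (P (t1 - s) (g s) - P (t1 - s + (t2 - t1)) (g s)) \<le> \<Theta> * xnorm U (g s)"
          using elim t by (intro \<Theta>) auto
        also have "\<dots> \<le> \<Theta> * ?o s" by (intro mult_left_mono elim \<Theta>0)
        finally show ?case by (simp add: D_def)
      qed
    qed (use E_integrable[OF h] in auto)
    also have "\<dots> = \<Theta> * (LINT s|lebesgue_on {r1..t1 - d}. ?o s)" by simp
    also have "\<dots> \<le> \<Theta> * (LINT s|lebesgue_on {r1..r2}. ?o s)"
      using t d by (intro mult_left_mono \<Theta>0 LINT_mono_set E_integrable E_nonneg h) auto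
    also have "\<dots> \<le> \<Theta> * (SUP g\<in>E. LINT \<tau>:{r1..r2}|lebesgue. opt_bound U j g \<tau>)"
      by (intro mult_left_mono \<Theta>0 SUP_opt_bound_ge j h)
    finally show ?thesis .
  qed
  have 3: "xnorm U (bochner_integral {t1 - d..t1} D) \<le> theta U E j r1 r2 d"
  proof -
    have "xnorm U (bochner_integral {t1 - d..t1} D) \<le> (LINT s|lebesgue_on {t1 - d..t1}. 2 * real CARD('n) * ?o s)"
    proof (rule xnorm_bochner_integral_le)
      show "xint {t1 - d..t1} D" using t' by (intro xint_mono[OF xD]) auto
      have "AE s in lebesgue_on {t1 - d..t1}. xnorm U (g s) \<le> ?o s"
        using r t t' d by (intro g_le_sub) auto
      moreover have "AE s in lebesgue_on {t1 - d..t1}. g s \<in> X"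
        using r t t' d by (intro xint_X xg_sub) auto
      ultimately show "AE s in lebesgue_on {t1 - d..t1}. xnorm U (D s) \<le> 2 * real CARD('n) * ?o s"
        using AE_mem_lebesgue_on
      proof eventually_elim
        case (elim s)
        have "xnorm U (D s) \<le> real CARD('n) * xnorm U (g s) + real CARD('n) * xnorm U (g s)"
          unfolding D_def using elim t
          by (intro order_trans[OF xnorm_diff] add_mono xnorm_P_le) auto
        also have "\<dots> \<le> 2 * real CARD('n) * ?o s"
          using mult_left_mono[OF elim(1), of "real CARD('n)"] by simp
        finally show ?case .
      qed
    qed (use E_integrable[OF h] in auto)
    also have "\<dots> = 2 * real CARD('n) * (LINT s|lebesgue_on {t1 - d..(t1 - d) + d}. ?o s)" by simp
    also have "\<dots> \<le> theta U E j r1 r2 d"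
      using t' t d by (intro theta_ge j h) auto
    finally show ?thesis .
  qed
  have 4: "xnorm U (conv t1 t2 g) \<le> theta U E j r1 r2 (t2 - t1)"
  proof -
    have "xnorm U (conv t1 t2 g) \<le> real CARD('n) * (LINT s|lebesgue_on {t1..t1 + (t2 - t1)}. ?o s)"
      using conv_g_le[of t1 t2] r t t' d by simp
    also have "\<dots> \<le> 2 * real CARD('n) * (LINT s|lebesgue_on {t1..t1 + (t2 - t1)}. ?o s)"
      by (intro mult_right_mono LINT_nonneg E_nonneg h) auto
    also have "\<dots> \<le> theta U E j r1 r2 (t2 - t1)"
      using t t' d by (intro theta_ge j h) auto
    finally show ?thesis .
  qed
  have "xnorm U (v t1 - v t2) \<le> \<Theta> * real j + \<Theta> * (SUP g\<in>E. LINT \<tau>:{r1..r2}|lebesgue. opt_bound U j g \<tau>)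
      + theta U E j r1 r2 d + theta U E j r1 r2 (t2 - t1)"
    unfolding eq by (intro order_trans[OF xnorm_diff] order_trans[OF xnorm_triangle] add_mono 1 2 3 4)
  then show ?thesis
    unfolding theta_nu_def \<Theta>_def d_def by (simp add: algebra_simps)
qed

lemma v_continuous: "continuous_on {0..b} v"
proof -
  have "continuous_on {0..b} (\<lambda>t. P t z0 + conv 0 t g)"
    by (intro continuous_on_add continuous_on_conv xg continuous_on_subset[OF continuous_on_P[OF z0]]) auto
  then show ?thesis
    by (rule continuous_on_cong[THEN iffD1, rotated -1]) (auto simp: v)
qed

text \<open>In the distance condition, \<open>v t\<close> is compared with the evolution over time
  \<open>1 / \<nu>\<close> of the earlier value \<open>v (t - 1 / \<nu>)\<close>; they differ only
  by the forcing on the last window.\<close>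

lemma v_KI:
  assumes q: "0 \<le> q1" "q2 \<le> b"
  shows "v \<in> KI U bc T E j q1 q2"
proof -
  have "v \<in> CI U j q1 q2"
    using q v_X X_CU v_le by (auto simp: CI_def CB_iff intro: continuous_on_subset[OF v_continuous])
  moreover have "moduli_cond U bc T E j r1 r2 \<nu> v"
    if "q1 \<le> r1" "r2 \<le> q2" "1 \<le> \<nu>" for r1 r2 \<nu>
    unfolding moduli_cond_def
  proof (intro ballI)
    fix t1 t2 assume t: "t1 \<in> {r1 + 1 / real \<nu>..r2}" "t2 \<in> {r1 + 1 / real \<nu>..r2}"
    show "xnorm U (v t1 - v t2) \<le> theta_nu U bc T E j r1 r2 \<nu> \<bar>t1 - t2\<bar> + theta U E j r1 r2 (1 / real \<nu>)"
    proof (cases "t1 \<le> t2")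
      case True
      then show ?thesis using moduli_le[of r1 r2 \<nu> t1 t2] t that q by simp
    next
      case False
      then show ?thesis using moduli_le[of r1 r2 \<nu> t2 t1] t that q by (simp add: xnorm_commute)
    qed
  qed
  moreover have "xdist U (v t) (P (1 / real \<nu>) ` (CB U (radius U E j r1 r2) \<inter> X)) \<le> theta U E j r1 r2 (1 / real \<nu>)"
    if r: "q1 \<le> r1" "r2 \<le> q2" and \<nu>: "1 \<le> \<nu>" and t: "t \<in> {r1 + 1 / real \<nu>..r2}" for r1 r2 \<nu> t
  proof -
    define d where "d = 1 / real \<nu>"
    let ?o = "opt_bound U j h"
    have d: "0 < d" using \<nu> by (simp add: d_def)
    have t': "r1 \<le> t - d" "t \<le> r2" using t by (auto simp: d_def)
    \<comment> \<open>Restarting at \<open>r1\<close> rather than at 0 gives the radius belonging to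
      the subinterval: \<open>CARD('n) * j\<close> from the state at \<open>r1\<close> and the rest
      from the forcing on \<open>{r1..r2}\<close>.\<close>
    have "v (t - d) = P (t - d - r1) (v r1) + conv r1 (t - d) g"
      using r q t' d by (intro v_restart) auto
    moreover have "xnorm U (P (t - d - r1) (v r1)) \<le> real CARD('n) * real j"
      using r q t' d v_X[of r1] v_le[of r1]
      by (intro order_trans[OF xnorm_P_le mult_left_mono]) auto
    moreover have "xnorm U (conv r1 (t - d) g) \<le> real CARD('n) * (SUP g\<in>E. LINT \<tau>:{r1..r2}|lebesgue. opt_bound U j g \<tau>)"
    proof -
      have "xnorm U (conv r1 (t - d) g) \<le> real CARD('n) * (LINT s|lebesgue_on {r1..t - d}. ?o s)"
        using r q t' d by (intro conv_g_le) auto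
      also have "\<dots> \<le> real CARD('n) * (LINT s|lebesgue_on {r1..r2}. ?o s)"
        using t' d by (intro mult_left_mono LINT_mono_set E_integrable E_nonneg h) auto
      also have "\<dots> \<le> real CARD('n) * (SUP g\<in>E. LINT \<tau>:{r1..r2}|lebesgue. opt_bound U j g \<tau>)"
        by (intro mult_left_mono SUP_opt_bound_ge j h) auto
      finally show ?thesis .
    qed
    ultimately have "xnorm U (v (t - d)) \<le> radius U E j r1 r2"
      unfolding radius_def using xnorm_triangle[of "P (t - d - r1) (v r1)" "conv r1 (t - d) g"] by simp
    moreover have vX: "v (t - d) \<in> X"
      using r q t' d by (intro v_X) auto
    ultimately have "v (t - d) \<in> CB U (radius U E j r1 r2) \<inter> X"
      by (simp add: CB_iff X_CU)
    then have "P d (v (t - d)) \<in> P d ` (CB U (radius U E j r1 r2) \<inter> X)" by (rule imageI)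
    then have "xdist U (v t) (P d ` (CB U (radius U E j r1 r2) \<inter> X)) \<le> xnorm U (v t - P d (v (t - d)))"
      unfolding xdist_def by (rule cINF_lower[rotated]) (auto intro: bdd_belowI2[where m=0])
    also have "v t = P d (v (t - d)) + conv (t - d) t g"
      using v_restart[of "t - d" t] r q t' d by simp
    then have "xnorm U (v t - P d (v (t - d))) \<le> real CARD('n) * (LINT s|lebesgue_on {t - d..(t - d) + d}. ?o s)"
      using conv_g_le[of "t - d" t] r q t' d by simp
    also have "\<dots> \<le> 2 * real CARD('n) * (LINT s|lebesgue_on {t - d..(t - d) + d}. ?o s)"
      by (intro mult_right_mono LINT_nonneg E_nonneg h) auto
    also have "\<dots> \<le> theta U E j r1 r2 d"
      using t' d by (intro theta_ge j h) auto
    finally show ?thesis by (simp add: d_def)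
  qed
  ultimately show ?thesis
    unfolding KI_def by blast
qed

end

section \<open>Convergence in the four topologies\<close>

text \<open>The set of \<open>g\<close> with \<open>p (g - f) < e\<close> is a subbasic
  neighbourhood of \<open>f\<close>. That it contains \<open>f\<close> is the assumption
  \<open>p0\<close>, as \<open>p\<close> is an arbitrary real function here.\<close>

lemma limitin_seminorm_topology:
  fixes f :: "'a::minus"
  assumes lim: "limitin (subtopology (seminorm_topology S Q) L) fn f sequentially"
    and f: "f \<in> S" and p: "p \<in> Q" and e: "0 < e" and p0: "p (f - f) \<le> 0"
  shows "\<forall>\<^sub>F n in sequentially. p (fn n - f) < e"
proof -
  let ?V = "{g \<in> S. p (g - f) < e}"
  have "openin (seminorm_topology S Q) ?V"
    unfolding seminorm_topology_def by (rule topology_generated_by_Basis) (use f p e in blast)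
  moreover have "f \<in> ?V" using f p0 e by simp
  moreover have "limitin (seminorm_topology S Q) fn f sequentially"
    using lim by (simp add: limitin_subtopology)
  ultimately have "\<forall>\<^sub>F n in sequentially. fn n \<in> ?V"
    by (simp only: limitin_def)
  then show ?thesis by eventually_elim simp
qed

text \<open>The indefinite integral is continuous on a compact interval, hence uniformly
  continuous.\<close>

lemma small_integral:
  fixes m :: "real \<Rightarrow> real"
  assumes int: "integrable (lebesgue_on {a..b}) m" and e: "0 < e"
  obtains \<eta> where "0 < \<eta>" "\<And>c d. a \<le> c \<Longrightarrow> c \<le> d \<Longrightarrow> d \<le> b \<Longrightarrow> d - c < \<eta> \<Longrightarrow> (LINT t|lebesgue_on {c..d}. m t) < e"
proof -
  have "m integrable_on {a..b}"
    by (rule integrable_on_lebesgue_on[OF int]) simp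
  then have "continuous_on {a..b} (\<lambda>x. integral {a..x} m)"
    by (rule indefinite_integral_continuous_1)
  then have "uniformly_continuous_on {a..b} (\<lambda>x. integral {a..x} m)"
    by (rule compact_uniformly_continuous) simp
  then obtain \<eta> where \<eta>: "0 < \<eta>"
    "\<And>x x'. x \<in> {a..b} \<Longrightarrow> x' \<in> {a..b} \<Longrightarrow> dist x' x < \<eta> \<Longrightarrow> dist (integral {a..x'} m) (integral {a..x} m) < e"
    unfolding uniformly_continuous_on_def using e by meson
  show thesis
  proof (rule that[OF \<eta>(1)])
    fix c d assume cd: "a \<le> c" "c \<le> d" "d \<le> b" "d - c < \<eta>"
    have sub: "integrable (lebesgue_on {a'..b'}) m" if "a \<le> a'" "b' \<le> b" for a' b'
      by (rule integrable_lebesgue_on_mono[OF int]) (use that in auto)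
    have "dist (integral {a..d} m) (integral {a..c} m) < e"
      using cd by (intro \<eta>(2)) (auto simp: dist_norm)
    moreover have "(LINT t|lebesgue_on {a..d}. m t) = (LINT t|lebesgue_on {a..c}. m t) + (LINT t|lebesgue_on {c..d}. m t)"
      using cd by (intro LINT_combine sub) auto
    ultimately show "(LINT t|lebesgue_on {c..d}. m t) < e"
      using cd by (simp add: lebesgue_integral_eq_integral[OF sub] dist_norm)
  qed
qed

text \<open>Lets the theory developed for \<open>X\<close> be applied to curves in all of
  \<open>CU U\<close>, whatever the actual boundary conditions are.\<close>

lemma state_space_Neumann: "state_space U Neumann = CU U"
  by (simp add: state_space_def)

context state_domain
begin

lemma nem_diff_le:
  fixes f g :: "('m, 'n) cmap"
  assumes f: "f \<in> SC U" and g: "g \<in> SC U" and v: "\<And>t. t \<in> {a..b} \<Longrightarrow> v t \<in> CB U (real j)"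
  shows "AE s in lebesgue_on {a..b}. xnorm U (nem U (f - g) s (v s)) \<le> opt_bound U j f s + opt_bound U j g s"
proof -
  have "AE s in lebesgue. \<forall>z\<in>CB U (real j). xnorm U (nem U (f - g) s z) \<le> opt_bound U j f s + opt_bound U j g s"
    using nem_diff[OF f g] nem_opt_bound[OF f, of j] nem_opt_bound[OF g, of j]
  proof eventually_elim
    case (elim s)
    show ?case
    proof
      fix z :: "('m, real ^ 'n) bfun" assume z: "z \<in> CB U (real j)"
      have "nem U (f - g) s z = nem U f s z - nem U g s z"
        using elim(1) z by (simp add: CB_iff)
      moreover have "xnorm U (nem U f s z) \<le> opt_bound U j f s" "xnorm U (nem U g s z) \<le> opt_bound U j g s"
        using elim(2,3) z by (auto simp: CB_iff)
      ultimately show "xnorm U (nem U (f - g) s z) \<le> opt_bound U j f s + opt_bound U j g s"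
        using xnorm_diff[of "nem U f s z" "nem U g s z"] by simp
    qed
  qed
  then have "AE s in lebesgue_on {a..b}. \<forall>z\<in>CB U (real j). xnorm U (nem U (f - g) s z) \<le> opt_bound U j f s + opt_bound U j g s"
    by (rule AE_lebesgue_on) simp
  then show ?thesis
    using AE_mem_lebesgue_on by eventually_elim (use v in blast)
qed

lemma nem_diff_AE:
  fixes f g :: "('m, 'n) cmap"
  assumes f: "f \<in> SC U" and g: "g \<in> SC U" and v: "\<And>t. t \<in> {a..b} \<Longrightarrow> v t \<in> CU U"
  shows "AE s in lebesgue_on {a..b}. nem U (f - g) s (v s) = nem U f s (v s) - nem U g s (v s)"
  using AE_lebesgue_on[OF nem_diff[OF f g], of "{a..b}", simplified] AE_mem_lebesgue_on
  by eventually_elim (use v in simp)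

lemma xint_nem_diff:
  fixes f g :: "('m, 'n) cmap"
  assumes f: "f \<in> SC U" "bc_compatible U bc f" and g: "g \<in> SC U" "bc_compatible U bc g"
    and v: "continuous_on {a..b} v" "\<And>t. t \<in> {a..b} \<Longrightarrow> v t \<in> X"
  shows "xint {a..b} (\<lambda>s. nem U (f - g) s (v s))"
proof (rule xint_cong_AE)
  show "xint {a..b} (\<lambda>s. nem U f s (v s) - nem U g s (v s))"
    by (intro xint_diff xint_nem f g v)
  show "AE s in lebesgue_on {a..b}. nem U f s (v s) - nem U g s (v s) = nem U (f - g) s (v s)"
    using nem_diff_AE[OF f(1) g(1), of a b v] v(2) X_CU by (auto elim: eventually_mono)
qed

lemma bochner_nem_diff_bounds:
  fixes f g :: "('m, 'n) cmap"
  assumes f: "f \<in> SC U" and g: "g \<in> SC U" and v: "v \<in> CI U j a b"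
  shows "xnorm U (bochner_integral {a..b} (\<lambda>s. nem U (f - g) s (v s))) \<le>
      (LINT s:{a..b}|lebesgue. xnorm U (nem U (f - g) s (v s)))"
    and "(LINT s:{a..b}|lebesgue. xnorm U (nem U (f - g) s (v s))) \<le>
      (LINT s|lebesgue_on {a..b}. opt_bound U j f s + opt_bound U j g s)"
proof -
  \<comment> \<open>Elements of \<open>C(I, \<B>\<^sub>j)\<close> need not vanish on the boundary, so they only take values in the Neumann state space.\<close>
  interpret NB: state_domain U "Neumann :: ('n, real ^ 'm) bc"
    by unfold_locales (rule bounded_U nonempty_U)+
  have v': "continuous_on {a..b} v" "\<And>t. t \<in> {a..b} \<Longrightarrow> v t \<in> CB U (real j)"
    using v by (auto simp: CI_def)
  have x: "NB.xint {a..b} (\<lambda>s. nem U (f - g) s (v s))"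
    using v' by (intro NB.xint_nem_diff f g) (auto simp: bc_compatible_def state_space_Neumann CB_def)
  show "xnorm U (bochner_integral {a..b} (\<lambda>s. nem U (f - g) s (v s))) \<le>
      (LINT s:{a..b}|lebesgue. xnorm U (nem U (f - g) s (v s)))"
    using NB.xnorm_bochner_integral_le[OF x NB.xint_integrable_xnorm[OF x]]
    by (simp add: set_lebesgue_integral_eq)
  have "(LINT s|lebesgue_on {a..b}. xnorm U (nem U (f - g) s (v s))) \<le>
      (LINT s|lebesgue_on {a..b}. opt_bound U j f s + opt_bound U j g s)"
    by (intro integral_mono_AE NB.xint_integrable_xnorm[OF x] Bochner_Integration.integrable_add
        opt_bound_integrable f g nem_diff_le v'(2))
  then show "(LINT s:{a..b}|lebesgue. xnorm U (nem U (f - g) s (v s))) \<le>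
      (LINT s|lebesgue_on {a..b}. opt_bound U j f s + opt_bound U j g s)"
    by (simp add: set_lebesgue_integral_eq)
qed

lemma LINT_nem_self_diff:
  fixes f :: "('m, 'n) cmap"
  assumes f: "f \<in> SC U" and v: "v \<in> CI U j a b"
  shows "(LINT s:{a..b}|lebesgue. xnorm U (nem U (f - f) s (v s))) = 0"
proof -
  have "AE s in lebesgue_on {a..b}. nem U (f - f) s (v s) = nem U f s (v s) - nem U f s (v s)"
    by (rule nem_diff_AE[OF f f]) (use v in \<open>auto simp: CI_def CB_def\<close>)
  then have "AE s in lebesgue_on {a..b}. xnorm U (nem U (f - f) s (v s)) = 0"
    by eventually_elim simp
  then show ?thesis
    by (simp add: set_lebesgue_integral_eq integral_eq_zero_AE)
qed

text \<open>\<open>S\<close> is the functional under the supremum of a seminorm, squeezed between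
  the norm of an integral and the integral of a norm, so both kinds of topology are treated at once.
  \<open>upper\<close> makes the supremum finite, and \<open>lower\<close> extracts the conclusion.
  The test curve may vary with \<open>n\<close> because the supremum is over all of
  \<open>V\<close>.\<close>

lemma seminorm_limit:
  fixes f :: "('m, 'n) cmap" and fn :: "nat \<Rightarrow> ('m, 'n) cmap"
  assumes lim: "limitin (subtopology (seminorm_topology (SC U)
      {\<lambda>f. SUP v\<in>V j q1 q2. S q1 q2 f v | j q1 q2. 1 \<le> j \<and> q1 \<in> \<rat> \<and> q2 \<in> \<rat> \<and> q1 < q2}) (LC U)) fn f sequentially"
    and f: "f \<in> SC U" and fn: "\<And>n. fn n \<in> SC U"
    and j: "1 \<le> j" and q: "q1 \<in> \<rat>" "q2 \<in> \<rat>" "q1 < q2"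
    and V: "V j q1 q2 \<subseteq> CI U j q1 q2" and v: "\<And>n. v n \<in> V j q1 q2"
    and lower: "\<And>g v. g \<in> SC U \<Longrightarrow> v \<in> CI U j q1 q2 \<Longrightarrow>
      xnorm U (bochner_integral {q1..q2} (\<lambda>s. nem U (g - f) s (v s))) \<le> S q1 q2 (g - f) v"
    and upper: "\<And>g v. g \<in> SC U \<Longrightarrow> v \<in> CI U j q1 q2 \<Longrightarrow>
      S q1 q2 (g - f) v \<le> (LINT s:{q1..q2}|lebesgue. xnorm U (nem U (g - f) s (v s)))"
  shows "(\<lambda>n. xnorm U (bochner_integral {q1..q2} (\<lambda>s. nem U (fn n - f) s (v n s)))) \<longlonglongrightarrow> 0"
proof (rule order_tendstoI)
  fix e :: real assume e: "0 < e"
  define p where "p g = (SUP v\<in>V j q1 q2. S q1 q2 g v)" for g :: "('m, 'n) cmap"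
  have "p (f - f) \<le> 0"
    unfolding p_def
  proof (rule cSUP_least)
    fix v assume "v \<in> V j q1 q2"
    then show "S q1 q2 (f - f) v \<le> 0"
      using V upper[OF f, of v] LINT_nem_self_diff[OF f, of v j] by auto
  qed (use v in auto)
  from limitin_seminorm_topology[where p=p, OF lim f _ e this]
  have "\<forall>\<^sub>F n in sequentially. p (fn n - f) < e"
    using j q unfolding p_def[abs_def] by blast
  then show "\<forall>\<^sub>F n in sequentially. xnorm U (bochner_integral {q1..q2} (\<lambda>s. nem U (fn n - f) s (v n s))) < e"
  proof eventually_elim
    case (elim n)
    have "xnorm U (bochner_integral {q1..q2} (\<lambda>s. nem U (fn n - f) s (v n s))) \<le> S q1 q2 (fn n - f) (v n)"
      using v V by (intro lower fn) auto
    also have "\<dots> \<le> p (fn n - f)"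
      unfolding p_def
    proof (rule cSUP_upper[OF v])
      show "bdd_above ((\<lambda>v. S q1 q2 (fn n - f) v) ` V j q1 q2)"
        by (rule bdd_aboveI2, rule order_trans[OF upper[OF fn] bochner_nem_diff_bounds(2)[OF fn f]]) (use V in auto)
    qed
    finally show ?case using elim by simp
  qed
qed (auto intro!: always_eventually less_le_trans[OF _ xnorm_nonneg])

lemmas T_of_limit = seminorm_limit[where S="\<lambda>q1 q2 f v. LINT s:{q1..q2}|lebesgue. xnorm U (nem U f s (v s))",
    folded T_of_def, OF _ _ _ _ _ _ _ _ _ bochner_nem_diff_bounds(1) order_refl]

lemmas sigma_of_limit = seminorm_limit[where S="\<lambda>q1 q2 f v. xnorm U (bochner_integral {q1..q2} (\<lambda>s. nem U f s (v s)))",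
    folded sigma_of_def, OF _ _ _ _ _ _ _ _ _ order_refl bochner_nem_diff_bounds(1)]

text \<open>Curves in \<open>KI\<close> are test curves for all four topologies, since
  \<open>KI\<close> lies in \<open>HI\<close> and \<open>HI\<close> in \<open>CI\<close>.\<close>

lemma topologies_limit:
  fixes f :: "('m, 'n) cmap" and fn :: "nat \<Rightarrow> ('m, 'n) cmap"
  assumes top: "\<T> \<in> {topology_sigma_Theta U bc T E, topology_Theta_R U bc T E, topology_Theta U bc T E, topology_B U}"
    and lim: "limitin \<T> fn f sequentially" and f: "f \<in> SC U" and fn: "\<And>n. fn n \<in> SC U"
    and j: "1 \<le> j" and q: "q1 \<in> \<rat>" "q2 \<in> \<rat>" "q1 < q2"
    and v: "\<And>n. v n \<in> KI U bc T E j q1 q2"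
  shows "(\<lambda>n. xnorm U (bochner_integral {q1..q2} (\<lambda>s. nem U (fn n - f) s (v n s)))) \<longlonglongrightarrow> 0"
proof -
  \<comment> \<open>The conditions in \<open>KI\<close> range over rational subintervals; since
    \<open>q1\<close> and \<open>q2\<close> are rational, the full interval is one of them.\<close>
  have KH: "KI U bc T E j q1 q2 \<subseteq> HI U bc T E j q1 q2"
    using q unfolding KI_def HI_def by auto
  have HC: "HI U bc T E j q1 q2 \<subseteq> CI U j q1 q2"
    unfolding HI_def by auto
  have vH: "v n \<in> HI U bc T E j q1 q2" and vC: "v n \<in> CI U j q1 q2" for n
    using v KH HC by blast+
  from top consider "\<T> = sigma_of U (HI U bc T E)" | "\<T> = T_of U (KI U bc T E)"
    | "\<T> = T_of U (HI U bc T E)" | "\<T> = T_of U (CI U)"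
    by (auto simp: topology_sigma_Theta_def topology_Theta_R_def topology_Theta_def topology_B_def)
  then show ?thesis
  proof cases
    case 1
    show ?thesis by (rule sigma_of_limit[OF lim[unfolded 1] f fn j q HC vH]) (assumption | rule f)+
  next
    case 2
    show ?thesis by (rule T_of_limit[OF lim[unfolded 2] f fn j q order_trans[OF KH HC] v]) (assumption | rule f)+
  next
    case 3
    show ?thesis by (rule T_of_limit[OF lim[unfolded 3] f fn j q HC vH]) (assumption | rule f)+
  next
    case 4
    show ?thesis by (rule T_of_limit[OF lim[unfolded 4] f fn j q order_refl vC]) (assumption | rule f)+
  qed
qed

lemma bochner_integral_singleton:
  assumes "xint {a..a} g"
  shows "bochner_integral {a..a} g = 0"
  using bochner_integral_combine[OF assms order_refl order_refl] by simp

end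

section \<open>Smallness of Duhamel integrals from smallness of integrals over rational
  intervals\<close>

context heat
begin

text \<open>The estimate separates two sources of smallness: the cell integrals of \<open>G\<close>,
  which convergence controls, and the factor \<open>e\<close> from norm continuity in front of the
  total mass \<open>\<mu>\<close>, which is merely bounded.\<close>

lemma conv_grid_bound:
  fixes p :: "nat \<Rightarrow> real"
  assumes xG: "xint {0..b} G" and \<mu>: "integrable (lebesgue_on {0..b}) \<mu>"
    and G_le: "AE s in lebesgue_on {0..b}. xnorm U (G s) \<le> \<mu> s"
    and d: "\<And>t r z. \<eta> \<le> t \<Longrightarrow> 0 \<le> r \<Longrightarrow> r < d \<Longrightarrow> z \<in> X \<Longrightarrow> xnorm U (P t z - P (t + r) z) \<le> e * xnorm U z"
    and e: "0 \<le> e" and \<eta>: "0 \<le> \<eta>"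
    and p: "p 0 = 0" "mono p" "\<And>k. p (Suc k) - p k < d" and t: "t \<le> b"
  shows "p k \<le> t - \<eta> \<Longrightarrow> xnorm U (bochner_integral {0..p k} (\<lambda>s. P (t - s) (G s))) \<le>
      real CARD('n) * (\<Sum>i<k. xnorm U (bochner_integral {p i..p (Suc i)} G)) + e * (LINT s|lebesgue_on {0..p k}. \<mu> s)"
proof (induction k)
  case 0
  have "xint {0..0} (\<lambda>s. P (t - s) (G s))"
    using 0 p t \<eta> by (intro xint_conv xint_mono[OF xG]) auto
  then show ?case
    using bochner_integral_singleton by (simp add: p(1) LINT_singleton)
next
  case (Suc k)
  \<comment> \<open>Freezing at the right end \<open>c\<close> keeps \<open>t - c\<close> at least
    \<open>\<eta>\<close>, so norm continuity with step \<open>d\<close> covers the whole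
    cell.\<close>
  define c where "c = p (Suc k)"
  have c: "0 \<le> p k" "p k \<le> c" "c \<le> t - \<eta>" "c \<le> b" "c - p k < d"
    using Suc.prems p t \<eta> monoD[OF p(2), of 0 k] monoD[OF p(2), of k "Suc k"] by (auto simp: c_def)
  have xs: "xint {a..a'} G" if "0 \<le> a" "a' \<le> c" for a a'
    by (rule xint_mono[OF xG]) (use that c in auto)
  have ims: "integrable (lebesgue_on {a..a'}) \<mu>" if "0 \<le> a" "a' \<le> c" for a a'
    by (rule integrable_lebesgue_on_mono[OF \<mu>]) (use that c in auto)
  let ?D = "\<lambda>s. P (t - s) (G s) - P (t - c) (G s)"
  have x1: "xint {p k..c} (\<lambda>s. P (t - s) (G s))" and x2: "xint {p k..c} (\<lambda>s. P (t - c) (G s))"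
    using c \<eta> by (auto intro!: xint_conv xint_P xs)
  have "bochner_integral {0..c} (\<lambda>s. P (t - s) (G s)) =
      bochner_integral {0..p k} (\<lambda>s. P (t - s) (G s)) + bochner_integral {p k..c} (\<lambda>s. P (t - s) (G s))"
    using c \<eta> by (intro bochner_integral_combine xint_conv xs) auto
  moreover have "bochner_integral {p k..c} (\<lambda>s. P (t - s) (G s)) =
      P (t - c) (bochner_integral {p k..c} G) + bochner_integral {p k..c} ?D"
  proof -
    have "bochner_integral {p k..c} (\<lambda>s. P (t - c) (G s)) = P (t - c) (bochner_integral {p k..c} G)"
      using c \<eta> by (intro bochner_integral_P xs) auto
    then show ?thesis by (simp add: bochner_integral_diff[OF x1 x2])
  qed
  moreover have "xnorm U (P (t - c) (bochner_integral {p k..c} G)) \<le> real CARD('n) * xnorm U (bochner_integral {p k..c} G)"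
    using c \<eta> by (intro xnorm_P_le bochner_integral_X xs) auto
  moreover have "xnorm U (bochner_integral {p k..c} ?D) \<le> (LINT s|lebesgue_on {p k..c}. e * \<mu> s)"
  proof (rule xnorm_bochner_integral_le[OF xint_diff[OF x1 x2]])
    have "AE s in lebesgue_on {p k..c}. xnorm U (G s) \<le> \<mu> s"
      by (rule AE_lebesgue_on_mono[OF G_le]) (use c in auto)
    moreover have "AE s in lebesgue_on {p k..c}. G s \<in> X"
      by (rule xint_X[OF xs]) (use c in auto)
    ultimately show "AE s in lebesgue_on {p k..c}. xnorm U (?D s) \<le> e * \<mu> s"
      using AE_mem_lebesgue_on
    proof eventually_elim
      case (elim s)
      have "xnorm U (P (t - c) (G s) - P (t - c + (c - s)) (G s)) \<le> e * xnorm U (G s)"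
        using elim c by (intro d) auto
      also have "\<dots> \<le> e * \<mu> s" by (intro mult_left_mono elim e)
      finally show ?case by (simp add: xnorm_commute)
    qed
  qed (use ims[of "p k" c] c in auto)
  moreover have "xnorm U (bochner_integral {0..p k} (\<lambda>s. P (t - s) (G s))) \<le>
      real CARD('n) * (\<Sum>i<k. xnorm U (bochner_integral {p i..p (Suc i)} G)) + e * (LINT s|lebesgue_on {0..p k}. \<mu> s)"
    using c by (intro Suc.IH) auto
  moreover have "(LINT s|lebesgue_on {0..c}. \<mu> s) = (LINT s|lebesgue_on {0..p k}. \<mu> s) + (LINT s|lebesgue_on {p k..c}. \<mu> s)"
    using c by (intro LINT_combine ims) auto
  ultimately show ?case
    using xnorm_triangle[of "bochner_integral {0..p k} (\<lambda>s. P (t - s) (G s))" "P (t - c) (bochner_integral {p k..c} G) + bochner_integral {p k..c} ?D"]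
      xnorm_triangle[of "P (t - c) (bochner_integral {p k..c} G)" "bochner_integral {p k..c} ?D"]
    by (simp add: c_def[symmetric] algebra_simps)
qed

text \<open>The window \<open>\<eta>\<close>, the step \<open>d\<close> and the grid depend on
  \<open>e\<close> alone, not on \<open>t\<close> or \<open>n\<close>. Hence finitely many limits,
  one for each grid cell, yield a bound uniform in \<open>t\<close>.\<close>

lemma conv_uniform_limit:
  fixes G :: "nat \<Rightarrow> real \<Rightarrow> ('m, real ^ 'n) bfun"
  assumes b: "0 < b" "b \<in> \<rat>"
    and xG: "\<And>n. xint {0..b} (G n)" and \<mu>: "\<And>n. integrable (lebesgue_on {0..b}) (\<mu> n)"
    and G_le: "\<And>n. AE s in lebesgue_on {0..b}. xnorm U (G n s) \<le> \<mu> n s"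
    and \<mu>0: "\<And>n. AE s in lebesgue. 0 \<le> \<mu> n s"
    and small: "\<And>e. 0 < e \<Longrightarrow> \<exists>\<eta>>0. \<forall>n a c. 0 \<le> a \<longrightarrow> a \<le> c \<longrightarrow> c \<le> b \<longrightarrow> c - a < \<eta> \<longrightarrow> (LINT s|lebesgue_on {a..c}. \<mu> n s) < e"
    and C: "\<And>n. (LINT s|lebesgue_on {0..b}. \<mu> n s) \<le> C"
    and lim: "\<And>a c. a \<in> \<rat> \<Longrightarrow> c \<in> \<rat> \<Longrightarrow> 0 \<le> a \<Longrightarrow> a < c \<Longrightarrow> c \<le> b \<Longrightarrow>
      (\<lambda>n. xnorm U (bochner_integral {a..c} (G n))) \<longlonglongrightarrow> 0"
    and e: "0 < e"
  shows "\<forall>\<^sub>F n in sequentially. \<forall>t\<in>{0..b}. xnorm U (conv 0 t (G n)) \<le> e"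
proof -
  let ?N = "real CARD('n)"
  \<comment> \<open>The budget in units of \<open>e0\<close>: \<open>CARD('n)\<close> for the cell
    integrals, \<open>CARD('n)\<close> for the piece next to \<open>t\<close>, and
    \<open>\<bar>C\<bar>\<close> for freezing the operators.\<close>
  define e0 where "e0 = e / (2 * ?N + \<bar>C\<bar>)"
  have N: "1 \<le> ?N" by (rule card_ge_1)
  have e0: "0 < e0" and e0_e: "(2 * ?N + \<bar>C\<bar>) * e0 = e"
  proof -
    have "0 < 2 * ?N + \<bar>C\<bar>" using N by linarith
    then show "0 < e0" "(2 * ?N + \<bar>C\<bar>) * e0 = e" using e by (auto simp: e0_def)
  qed
  obtain \<eta>0 where \<eta>0: "0 < \<eta>0"
    "\<And>n a c. 0 \<le> a \<Longrightarrow> a \<le> c \<Longrightarrow> c \<le> b \<Longrightarrow> c - a < \<eta>0 \<Longrightarrow> (LINT s|lebesgue_on {a..c}. \<mu> n s) < e0"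
    using small[OF e0] by blast
  \<comment> \<open>The piece beyond the last grid point not exceeding \<open>t - \<eta>\<close> is
    shorter than \<open>\<eta> + h\<close>, hence shorter than
    \<open>2 * \<eta> = \<eta>0\<close>.\<close>
  define \<eta> where "\<eta> = \<eta>0 / 2"
  have \<eta>: "0 < \<eta>" using \<eta>0 by (simp add: \<eta>_def)
  obtain d where d: "0 < d"
    "\<And>t r z. \<eta> \<le> t \<Longrightarrow> 0 \<le> r \<Longrightarrow> r < d \<Longrightarrow> z \<in> X \<Longrightarrow> xnorm U (P t z - P (t + r) z) \<le> e0 * xnorm U z"
    by (rule P_norm_continuous[OF \<eta> e0]) (rule that)
  obtain K :: nat where K: "b / min \<eta> d < real K" using reals_Archimedean2 by blast
  have K0: "0 < real K" using K b \<eta> d(1) by (smt (verit) divide_nonneg_pos)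
  define h where "h = b / real K"
  have h: "0 < h" "h < \<eta>" "h < d" "real K * h = b"
  proof -
    have m: "0 < min \<eta> d" using \<eta> d(1) by simp
    have "b < min \<eta> d * real K" using K by (simp only: pos_divide_less_eq[OF m] mult.commute)
    then have "h < min \<eta> d" by (simp only: h_def pos_divide_less_eq[OF K0])
    then show "h < \<eta>" "h < d" by auto
  qed (use K0 b in \<open>auto simp: h_def\<close>)
  define p where "p k = real k * h" for k :: nat
  have p: "p 0 = 0" "mono p" "\<And>k. p (Suc k) - p k = h"
    using h by (auto simp: p_def mono_def algebra_simps)
  \<comment> \<open>The seminorms know only intervals with rational endpoints; a rational
    \<open>b\<close> divided into \<open>K\<close> equal parts provides them.\<close>
  have pQ: "p k \<in> \<rat>" for k
    unfolding p_def h_def using b by (intro Rats_mult Rats_divide) auto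
  have "(\<lambda>n. \<Sum>i<K. xnorm U (bochner_integral {p i..p (Suc i)} (G n))) \<longlonglongrightarrow> (\<Sum>i<K. 0)"
  proof (rule tendsto_sum)
    fix i assume i: "i \<in> {..<K}"
    have "p (Suc i) \<le> b"
      using mult_right_mono[of "real (Suc i)" "real K" h] i h by (simp add: p_def)
    then show "(\<lambda>n. xnorm U (bochner_integral {p i..p (Suc i)} (G n))) \<longlonglongrightarrow> 0"
      using p(3)[of i] h(1) by (intro lim pQ) (auto simp: p_def)
  qed
  then have "(\<lambda>n. \<Sum>i<K. xnorm U (bochner_integral {p i..p (Suc i)} (G n))) \<longlonglongrightarrow> 0" by simp
  from order_tendstoD(2)[OF this e0]
  show ?thesis
  proof eventually_elim
    case (elim n)
    show ?case
    proof
      fix t assume t: "t \<in> {0..b}"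
      have sub: "xint {a..c} (G n)" "integrable (lebesgue_on {a..c}) (\<mu> n)"
        "AE s in lebesgue_on {a..c}. xnorm U (G n s) \<le> \<mu> n s" if "0 \<le> a" "c \<le> b" for a c
      proof -
        have s: "{a..c} \<subseteq> {0..b}" using that by auto
        show "xint {a..c} (G n)" by (rule xint_mono[OF xG _ s]) simp
        show "integrable (lebesgue_on {a..c}) (\<mu> n)" by (rule integrable_lebesgue_on_mono[OF \<mu> _ _ s]) auto
        show "AE s in lebesgue_on {a..c}. xnorm U (G n s) \<le> \<mu> n s"
          by (rule AE_lebesgue_on_mono[OF G_le _ _ s]) auto
      qed
      have short: "xnorm U (conv a t (G n)) \<le> ?N * e0" if "0 \<le> a" "a \<le> t" "t - a < \<eta>0" for a
      proof -
        have "xnorm U (conv a t (G n)) \<le> ?N * (LINT s|lebesgue_on {a..t}. \<mu> n s)"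
          using that t by (intro conv_bound sub) auto
        also have "\<dots> \<le> ?N * e0"
          using \<eta>0(2)[of a t n] that t by (intro mult_left_mono less_imp_le) auto
        finally show ?thesis .
      qed
      show "xnorm U (conv 0 t (G n)) \<le> e"
      proof (cases "t < \<eta>")
        case True
        have "xnorm U (conv 0 t (G n)) \<le> ?N * e0"
          using True t \<eta> by (intro short) (auto simp: \<eta>_def)
        also have "\<dots> \<le> (2 * ?N + \<bar>C\<bar>) * e0"
          using e0 N by (intro mult_right_mono) auto
        finally show ?thesis by (simp add: e0_e)
      next
        case False
        define k where "k = nat \<lfloor>(t - \<eta>) / h\<rfloor>"
        have k: "p k \<le> t - \<eta>" "t - \<eta> < p k + h"
        proof -
          have "0 \<le> (t - \<eta>) / h" using False h by simp
          then have "real k = of_int \<lfloor>(t - \<eta>) / h\<rfloor>" by (simp add: k_def)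
          then have "real k \<le> (t - \<eta>) / h" "(t - \<eta>) / h < real k + 1" by linarith+
          then show "p k \<le> t - \<eta>" "t - \<eta> < p k + h"
            using h by (auto simp: p_def field_simps)
        qed
        have pk: "0 \<le> p k" "p k \<le> t" using h k \<eta> by (auto simp: p_def)
        have kK: "k \<le> K"
        proof (rule ccontr)
          assume "\<not> k \<le> K"
          then have "b \<le> p k" using mult_right_mono[of "real K" "real k" h] h by (simp add: p_def)
          then show False using k t \<eta> by simp
        qed
        have "conv 0 t (G n) = bochner_integral {0..p k} (\<lambda>s. P (t - s) (G n s)) + conv (p k) t (G n)"
          unfolding conv_def using t pk by (intro bochner_integral_combine xint_conv sub) auto
        then have "xnorm U (conv 0 t (G n)) \<le>
            xnorm U (bochner_integral {0..p k} (\<lambda>s. P (t - s) (G n s))) + xnorm U (conv (p k) t (G n))"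
          by (simp add: xnorm_triangle)
        moreover have "xnorm U (conv (p k) t (G n)) \<le> ?N * e0"
          using pk k h \<eta> by (intro short) (auto simp: \<eta>_def)
        moreover have "xnorm U (bochner_integral {0..p k} (\<lambda>s. P (t - s) (G n s))) \<le>
            ?N * (\<Sum>i<k. xnorm U (bochner_integral {p i..p (Suc i)} (G n))) + e0 * (LINT s|lebesgue_on {0..p k}. \<mu> n s)"
          by (rule conv_grid_bound[where d=d and \<eta>=\<eta>, OF xG \<mu> G_le]) (use d(2) e0 \<eta> p h t k in auto)
        moreover have "(\<Sum>i<k. xnorm U (bochner_integral {p i..p (Suc i)} (G n))) \<le> e0"
          using elim kK sum_mono2[of "{..<K}" "{..<k}" "\<lambda>i. xnorm U (bochner_integral {p i..p (Suc i)} (G n))"] by simp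
        then have "?N * (\<Sum>i<k. xnorm U (bochner_integral {p i..p (Suc i)} (G n))) \<le> ?N * e0"
          by (rule mult_left_mono) simp
        moreover have "(LINT s|lebesgue_on {0..p k}. \<mu> n s) \<le> \<bar>C\<bar>"
        proof -
          have "(LINT s|lebesgue_on {0..p k}. \<mu> n s) \<le> (LINT s|lebesgue_on {0..b}. \<mu> n s)"
            using pk t by (intro LINT_mono_set \<mu> \<mu>0) auto
          then show ?thesis using C[of n] by linarith
        qed
        then have "e0 * (LINT s|lebesgue_on {0..p k}. \<mu> n s) \<le> e0 * \<bar>C\<bar>"
          using e0 by (intro mult_left_mono) auto
        moreover have "(2 * ?N + \<bar>C\<bar>) * e0 = ?N * e0 + ?N * e0 + e0 * \<bar>C\<bar>"
          by (simp add: algebra_simps)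
        ultimately have "xnorm U (conv 0 t (G n)) \<le> (2 * ?N + \<bar>C\<bar>) * e0"
          by linarith
        then show ?thesis by (simp add: e0_e)
      qed
    qed
  qed
qed

end

section \<open>Gronwall estimates and truncated equations\<close>

text \<open>Continuation in finitely many equal steps, each carrying less than \<open>e\<close> of
  the integral of \<open>l\<close>. It replaces a weighted norm or an exponential factor in both
  Gronwall's inequality and the existence proof, where \<open>l\<close> is merely
  integrable.\<close>

lemma integral_step_induct:
  fixes l :: "real \<Rightarrow> real" and Q :: "real \<Rightarrow> bool"
  assumes int: "integrable (lebesgue_on {0..b}) l" and b: "0 \<le> b" and e: "0 < e" and Q0: "Q 0"
    and step: "\<And>a c. 0 \<le> a \<Longrightarrow> a \<le> c \<Longrightarrow> c \<le> b \<Longrightarrow> (LINT s|lebesgue_on {a..c}. l s) < e \<Longrightarrow> Q a \<Longrightarrow> Q c"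
  shows "Q b"
proof -
  obtain \<eta> where \<eta>: "0 < \<eta>" "\<And>c d. 0 \<le> c \<Longrightarrow> c \<le> d \<Longrightarrow> d \<le> b \<Longrightarrow> d - c < \<eta> \<Longrightarrow> (LINT t|lebesgue_on {c..d}. l t) < e"
    by (rule small_integral[OF int e]) (rule that)
  obtain K :: nat where K: "b / \<eta> < real K" using reals_Archimedean2 by blast
  have K0: "0 < real K" using K b \<eta> by (smt (verit) divide_nonneg_pos)
  define h where "h = b / real K"
  have h: "0 \<le> h" "h < \<eta>" "real K * h = b"
  proof -
    have "b < \<eta> * real K" using K by (simp only: pos_divide_less_eq[OF \<eta>(1)] mult.commute)
    then show "h < \<eta>" by (simp only: h_def pos_divide_less_eq[OF K0])
  qed (use K0 b in \<open>auto simp: h_def\<close>)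
  have "Q (real k * h)" if "k \<le> K" for k
    using that
  proof (induction k)
    case (Suc k)
    have 1: "real (Suc k) * h \<le> b"
      using Suc.prems h mult_right_mono[of "real (Suc k)" "real K" h] by simp
    show ?case
    proof (rule step[OF _ _ 1 \<eta>(2)[OF _ _ 1]])
      show "Q (real k * h)" using Suc by simp
    qed (use h in \<open>auto simp: algebra_simps\<close>)
  qed (simp add: Q0)
  from this[of K] show ?thesis by (simp add: h(3))
qed

lemma integrable_mult_continuous:
  fixes l \<phi> :: "real \<Rightarrow> real"
  assumes l: "integrable (lebesgue_on {a..b}) l" and \<phi>: "continuous_on {a..b} \<phi>"
  shows "integrable (lebesgue_on {a..b}) (\<lambda>s. l s * \<phi> s)"
proof -
  have "bounded (\<phi> ` {a..b})"
    by (intro compact_imp_bounded compact_continuous_image \<phi>) simp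
  then obtain B where B: "\<forall>s\<in>{a..b}. \<bar>\<phi> s\<bar> \<le> B"
    unfolding bounded_iff by auto
  show ?thesis
  proof (rule Bochner_Integration.integrable_bound)
    show "integrable (lebesgue_on {a..b}) (\<lambda>s. B * l s)" using l by simp
    show "(\<lambda>s. l s * \<phi> s) \<in> borel_measurable (lebesgue_on {a..b})"
      by (intro borel_measurable_times borel_measurable_integrable[OF l]
          continuous_imp_measurable_on_sets_lebesgue[OF \<phi>]) simp
    show "AE s in lebesgue_on {a..b}. norm (l s * \<phi> s) \<le> norm (B * l s)"
      using AE_mem_lebesgue_on
    proof eventually_elim
      case (elim s)
      then have "\<bar>\<phi> s\<bar> \<le> \<bar>B\<bar>" using B by fastforce
      then show ?case by (simp add: abs_mult mult.commute mult_right_mono)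
    qed
  qed
qed

text \<open>The constant stands before \<open>\<phi>\<close>, \<open>a\<close> and
  \<open>t0\<close>, so that it can serve a whole sequence of solutions on intervals that vary with
  the index. On a step with little mass of \<open>l\<close>, the maximum of \<open>\<phi>\<close> is
  absorbed into the left side.\<close>

lemma gronwall:
  fixes l :: "real \<Rightarrow> real"
  assumes l: "integrable (lebesgue_on {0..b}) l" "AE s in lebesgue. 0 \<le> l s" and b: "0 \<le> b" and M: "0 \<le> M"
  shows "\<exists>C\<ge>0. \<forall>\<phi> a t0. 0 \<le> a \<and> 0 \<le> t0 \<and> t0 \<le> b \<and> continuous_on {0..t0} \<phi> \<and>
      (\<forall>t\<in>{0..t0}. 0 \<le> \<phi> t \<and> \<phi> t \<le> a + M * (LINT s|lebesgue_on {0..t}. l s * \<phi> s)) \<longrightarrow>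
      (\<forall>t\<in>{0..t0}. \<phi> t \<le> C * a)"
proof -
  define adm where "adm \<phi> a t0 \<longleftrightarrow> 0 \<le> a \<and> 0 \<le> t0 \<and> t0 \<le> b \<and> continuous_on {0..t0} \<phi> \<and>
      (\<forall>t\<in>{0..t0}. 0 \<le> \<phi> t \<and> \<phi> t \<le> a + M * (LINT s|lebesgue_on {0..t}. l s * \<phi> s))" for \<phi> :: "real \<Rightarrow> real" and a t0
  define Q where "Q c \<longleftrightarrow> (\<exists>C\<ge>0. \<forall>\<phi> a t0. adm \<phi> a t0 \<longrightarrow> (\<forall>t\<in>{0..min c t0}. \<phi> t \<le> C * a))" for c
  define L where "L = (LINT s|lebesgue_on {0..b}. l s)"
  have L: "0 \<le> L" unfolding L_def by (rule LINT_nonneg[OF l(2)]) simp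
  \<comment> \<open>With less than \<open>1 / (2 * (M + 1))\<close> of the integral of
    \<open>l\<close> on a step, its contribution multiplied by \<open>M\<close> is at most half the
    maximum. The summand 1 covers \<open>M = 0\<close>.\<close>
  have "Q b"
  proof (rule integral_step_induct[OF l(1) b, where e="1 / (2 * (M + 1))"])
    show "Q 0"
      unfolding Q_def
    proof (intro exI[of _ 1] conjI allI impI ballI)
      fix \<phi> a t0 t assume A: "adm \<phi> a t0" and "t \<in> {0..min 0 t0}"
      then have "t = 0" "0 \<in> {0..t0}" by (auto simp: adm_def)
      moreover from this A have "\<phi> 0 \<le> a + M * (LINT s|lebesgue_on {0..0}. l s * \<phi> s)"
        unfolding adm_def by blast
      ultimately show "\<phi> t \<le> 1 * a" by (simp add: LINT_singleton)
    qed simp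
    fix a0 c assume ac: "0 \<le> a0" "a0 \<le> c" "c \<le> b" and small: "(LINT s|lebesgue_on {a0..c}. l s) < 1 / (2 * (M + 1))"
      and "Q a0"
    then obtain C where C: "0 \<le> C" "\<And>\<phi> a t0 t. adm \<phi> a t0 \<Longrightarrow> t \<in> {0..min a0 t0} \<Longrightarrow> \<phi> t \<le> C * a"
      unfolding Q_def by blast
    \<comment> \<open>At the maximum point \<open>x\<close> the inequality reads
      \<open>\<phi> x \<le> a + M * L * C * a + \<phi> x / 2\<close>, which gives the first summand
      after doubling. The second keeps the old bound valid when \<open>x\<close> lies before
      \<open>a0\<close>.\<close>
    define C' where "C' = 2 * (1 + M * (L * C)) + C"
    have C': "0 \<le> C'" "C \<le> C'" "2 * (1 + M * (L * C)) \<le> C'"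
      using C(1) M L by (auto simp: C'_def)
    have "\<phi> t \<le> C' * a" if A: "adm \<phi> a t0" and t: "t \<in> {0..min c t0}" for \<phi> a t0 t
    proof -
      have a: "0 \<le> a" and t0: "0 \<le> t0" "t0 \<le> b" and cont: "continuous_on {0..t0} \<phi>"
        and nn: "\<And>t. t \<in> {0..t0} \<Longrightarrow> 0 \<le> \<phi> t"
        and ineq: "\<And>t. t \<in> {0..t0} \<Longrightarrow> \<phi> t \<le> a + M * (LINT s|lebesgue_on {0..t}. l s * \<phi> s)"
        using A by (auto simp: adm_def)
      have "\<exists>x\<in>{0..min c t0}. \<forall>y\<in>{0..min c t0}. \<phi> y \<le> \<phi> x"
        by (rule continuous_attains_sup) (use t in \<open>auto intro: continuous_on_subset[OF cont]\<close>)
      then obtain x where x: "x \<in> {0..min c t0}" "\<And>y. y \<in> {0..min c t0} \<Longrightarrow> \<phi> y \<le> \<phi> x" by blast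
      have int: "integrable (lebesgue_on {p..q}) (\<lambda>s. l s * \<phi> s)" "integrable (lebesgue_on {p..q}) l"
        if "0 \<le> p" "q \<le> t0" for p q
      proof -
        show i: "integrable (lebesgue_on {p..q}) l"
          by (rule integrable_lebesgue_on_mono[OF l(1)]) (use that t0 in auto)
        show "integrable (lebesgue_on {p..q}) (\<lambda>s. l s * \<phi> s)"
          by (rule integrable_mult_continuous[OF i continuous_on_subset[OF cont]]) (use that in auto)
      qed
      have le_int: "(LINT s|lebesgue_on {p..q}. l s * \<phi> s) \<le> (LINT s|lebesgue_on {p..q}. l s) * B"
        if pq: "0 \<le> p" "q \<le> t0" and B: "\<And>s. s \<in> {p..q} \<Longrightarrow> \<phi> s \<le> B" for p q B
      proof -
        have "(LINT s|lebesgue_on {p..q}. l s * \<phi> s) \<le> (LINT s|lebesgue_on {p..q}. l s * B)"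
        proof (rule integral_mono_AE[OF int(1)[OF pq]])
          show "integrable (lebesgue_on {p..q}) (\<lambda>s. l s * B)" using int(2)[OF pq] by simp
          have "AE s in lebesgue_on {p..q}. 0 \<le> l s" by (rule AE_lebesgue_on[OF l(2)]) simp
          then show "AE s in lebesgue_on {p..q}. l s * \<phi> s \<le> l s * B"
            using AE_mem_lebesgue_on by eventually_elim (use B in \<open>auto intro: mult_left_mono\<close>)
        qed
        then show ?thesis by simp
      qed
      have "\<phi> x \<le> C' * a"
      proof (cases "x \<le> a0")
        case True
        then have "\<phi> x \<le> C * a" using C(2)[OF A, of x] x(1) by auto
        also have "\<dots> \<le> C' * a" using C' a by (intro mult_right_mono)
        finally show ?thesis .
      next
        case False
        then have xa: "a0 \<le> x" "x \<le> t0" "x \<le> c" using x(1) by auto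
        have sp: "(LINT s|lebesgue_on {0..x}. l s * \<phi> s) =
            (LINT s|lebesgue_on {0..a0}. l s * \<phi> s) + (LINT s|lebesgue_on {a0..x}. l s * \<phi> s)"
          using xa ac by (intro LINT_combine int) auto
        have 1: "(LINT s|lebesgue_on {0..a0}. l s * \<phi> s) \<le> L * (C * a)"
        proof -
          have "(LINT s|lebesgue_on {0..a0}. l s * \<phi> s) \<le> (LINT s|lebesgue_on {0..a0}. l s) * (C * a)"
            using xa by (intro le_int C(2)[OF A]) auto
          also have "\<dots> \<le> L * (C * a)"
            unfolding L_def using ac C(1) a by (intro mult_right_mono LINT_mono_set l) auto
          finally show ?thesis .
        qed
        have 2: "(LINT s|lebesgue_on {a0..x}. l s * \<phi> s) \<le> 1 / (2 * (M + 1)) * \<phi> x"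
        proof -
          have "(LINT s|lebesgue_on {a0..x}. l s * \<phi> s) \<le> (LINT s|lebesgue_on {a0..x}. l s) * \<phi> x"
            using xa ac by (intro le_int x(2)) auto
          also have "(LINT s|lebesgue_on {a0..x}. l s) \<le> (LINT s|lebesgue_on {a0..c}. l s)"
            using xa ac by (intro LINT_mono_set l integrable_lebesgue_on_mono[OF l(1)]) auto
          then have "(LINT s|lebesgue_on {a0..x}. l s) * \<phi> x \<le> 1 / (2 * (M + 1)) * \<phi> x"
            using small nn[of x] xa ac by (intro mult_right_mono) auto
          finally show ?thesis .
        qed
        have 3: "M * (1 / (2 * (M + 1)) * \<phi> x) \<le> \<phi> x / 2"
        proof -
          have "M / (M + 1) \<le> 1" using M by simp
          then have "M / (M + 1) * (\<phi> x / 2) \<le> 1 * (\<phi> x / 2)"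
            using nn[of x] xa ac by (intro mult_right_mono) auto
          then show ?thesis using M by (simp add: field_simps)
        qed
        have "\<phi> x \<le> a + M * (LINT s|lebesgue_on {0..x}. l s * \<phi> s)"
          using xa ac by (intro ineq) auto
        also have "\<dots> \<le> a + M * (L * (C * a) + 1 / (2 * (M + 1)) * \<phi> x)"
          unfolding sp using 1 2 M by (intro add_left_mono mult_left_mono add_mono)
        also have "\<dots> = a + M * (L * (C * a)) + M * (1 / (2 * (M + 1)) * \<phi> x)"
          by (simp add: distrib_left)
        finally have "\<phi> x \<le> a + M * (L * (C * a)) + M * (1 / (2 * (M + 1)) * \<phi> x)" .
        then have "\<phi> x \<le> 2 * (a + M * (L * (C * a)))" using 3 by argo
        also have "\<dots> = 2 * (1 + M * (L * C)) * a" by (simp add: algebra_simps)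
        also have "\<dots> \<le> C' * a" by (rule mult_right_mono[OF C'(3) a])
        finally show ?thesis .
      qed
      then show ?thesis using x(2)[OF t] by linarith
    qed
    then show "Q c" unfolding Q_def using C'(1) by blast
  qed (use M in auto)
  then obtain C where C: "0 \<le> C" "\<And>\<phi> a t0 t. adm \<phi> a t0 \<Longrightarrow> t \<in> {0..min b t0} \<Longrightarrow> \<phi> t \<le> C * a"
    unfolding Q_def by blast
  have "\<phi> t \<le> C * a" if "adm \<phi> a t0" "t \<in> {0..t0}" for \<phi> a t0 t
    using C(2)[OF that(1), of t] that by (auto simp: adm_def)
  with C(1) show ?thesis unfolding adm_def by blast
qed

text \<open>Clipping each coordinate, rather than retracting radially, is 1-Lipschitz in the 1-norm
  and in the Euclidean norm alike. The price is a range of 1-norm up to \<open>CARD('n) * R\<close>;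
  on the 1-ball of radius \<open>R\<close> it is still the identity.\<close>

definition clip :: "real \<Rightarrow> real ^ 'n \<Rightarrow> real ^ 'n" where
  "clip R y = (\<chi> i. max (- R) (min R (y $ i)))"

lemma clip_diff_component: "\<bar>(clip R y - clip R y') $ i\<bar> \<le> \<bar>(y - y') $ i\<bar>"
  by (simp add: clip_def)

lemma norm1_clip_diff: "norm1 (clip R y - clip R y') \<le> norm1 (y - y')"
  unfolding norm1_def by (intro sum_mono clip_diff_component)

lemma norm_clip_diff: "norm (clip R y - clip R y') \<le> norm (y - y')"
  by (rule norm_le_componentwise_cart) (use clip_diff_component in auto)

lemma norm1_clip: "0 \<le> R \<Longrightarrow> norm1 (clip R y) \<le> real CARD('n) * R" for y :: "real ^ 'n"
proof -
  assume "0 \<le> R"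
  then have "norm1 (clip R y) \<le> (\<Sum>i\<in>(UNIV :: 'n set). R)"
    unfolding norm1_def by (intro sum_mono) (auto simp: clip_def)
  then show ?thesis by simp
qed

lemma clip_zero: "0 \<le> R \<Longrightarrow> clip R 0 = 0"
  by (simp add: clip_def vec_eq_iff)

lemma clip_id: "norm1 y \<le> R \<Longrightarrow> clip R y = y"
  unfolding vec_eq_iff
proof
  fix i assume "norm1 y \<le> R"
  then have "\<bar>y $ i\<bar> \<le> R" using component_le_norm1[of y i] by linarith
  then show "clip R y $ i = y $ i" by (simp add: clip_def)
qed

definition trunc :: "real \<Rightarrow> ('m::finite, real ^ 'n) bfun \<Rightarrow> ('m, real ^ 'n) bfun" where
  "trunc R z = Bcontfun (\<lambda>d. clip R (apply_bcontfun z d))"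

lemma ev_trunc:
  fixes z :: "('m::finite, real ^ 'n) bfun"
  assumes "0 \<le> R"
  shows "ev (trunc R z) x = clip R (ev z x)"
proof -
  have "norm (clip R (apply_bcontfun z d)) \<le> norm z" for d
    using norm_clip_diff[of R "apply_bcontfun z d" 0] norm_bounded[of z d] clip_zero[OF assms, where 'a='n]
    by simp
  then have "bounded (range (\<lambda>d. clip R (apply_bcontfun z d)))"
    by (auto simp: bounded_iff)
  moreover have "continuous_on UNIV (\<lambda>d. clip R (apply_bcontfun z d))"
    by (simp add: continuous_on_open_vimage open_discrete)
  ultimately have "(\<lambda>d. clip R (apply_bcontfun z d)) \<in> bcontfun"
    by (simp add: bcontfun_def)
  then show ?thesis by (simp add: trunc_def ev_def Bcontfun_inverse)
qed

lemma continuous_on_trunc: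
  assumes "0 \<le> R" "continuous_on S u"
  shows "continuous_on S (\<lambda>s. trunc R (u s) :: ('m::finite, real ^ 'n) bfun)"
proof -
  have "1-lipschitz_on UNIV (trunc R :: ('m, real ^ 'n) bfun \<Rightarrow> _)"
  proof (rule lipschitz_onI)
    fix z z' :: "('m, real ^ 'n) bfun"
    show "dist (trunc R z) (trunc R z') \<le> 1 * dist z z'"
      unfolding dist_norm mult_1
    proof (rule norm_le_ev)
      fix x
      have "norm (ev (trunc R z - trunc R z') x) \<le> norm (ev (z - z') x)"
        by (simp add: ev_trunc[OF assms(1)] norm_clip_diff)
      also have "\<dots> \<le> norm (z - z')" by (rule norm_ev_le)
      finally show "norm (ev (trunc R z - trunc R z') x) \<le> norm (z - z')" .
    qed
  qed simp
  then have "continuous_on UNIV (trunc R :: ('m, real ^ 'n) bfun \<Rightarrow> _)"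
    by (rule lipschitz_on_continuous_on)
  then show ?thesis
    using continuous_on_compose2[OF _ assms(2)] by blast
qed

context state_domain
begin

lemma xnorm_le_0: "z \<in> X \<Longrightarrow> xnorm U z \<le> 0 \<Longrightarrow> z = 0"
  using norm_le_xnorm[OF X_CU, of z] by (metis norm_le_zero_iff order_trans)

lemma trunc_X:
  assumes R: "0 \<le> R" and z: "z \<in> X"
  shows "trunc R z \<in> X"
proof -
  have "continuous_on (closure U) (\<lambda>x. clip R (ev z x))"
    unfolding clip_def using z by (intro continuous_intros) (auto simp: state_space_def CU_def)
  moreover have "ev (trunc R z) = (\<lambda>x. clip R (ev z x))"
    by (rule ext) (rule ev_trunc[OF R])
  ultimately show ?thesis
    using z by (simp add: state_space_def CU_def clip_zero[OF R])
qed

lemma xnorm_trunc_diff: "0 \<le> R \<Longrightarrow> xnorm U (trunc R z - trunc R z') \<le> xnorm U (z - z')"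
  for z :: "('m, real ^ 'n) bfun"
  by (rule xnorm_leI)
    (auto simp: ev_trunc intro: order_trans[OF norm1_clip_diff] norm1_ev_le[of _ "z - z'", simplified])

lemma xnorm_trunc: "0 \<le> R \<Longrightarrow> xnorm U (trunc R z) \<le> real CARD('n) * R" for z :: "('m, real ^ 'n) bfun"
  by (rule xnorm_leI) (simp add: ev_trunc norm1_clip)

lemma trunc_id: "0 \<le> R \<Longrightarrow> z \<in> X \<Longrightarrow> xnorm U z \<le> R \<Longrightarrow> trunc R z = z"
  by (rule X_eqI) (auto simp: trunc_X ev_trunc intro!: clip_id order_trans[OF norm1_ev_le])

end

section \<open>Existence, comparison and uniqueness of mild solutions\<close>

context heat
begin

text \<open>Picard iteration contracts only on pieces with little mass of \<open>l\<close>. A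
  solution on \<open>{0..a}\<close> is kept fixed, and Banach's theorem extends it to
  \<open>{0..c}\<close>.\<close>

lemma global_existence:
  fixes F :: "real \<Rightarrow> ('m, real ^ 'n) bfun \<Rightarrow> ('m, real ^ 'n) bfun"
  assumes b: "0 \<le> b" and z0: "z0 \<in> X"
    and xF: "\<And>u. continuous_on {0..b} u \<Longrightarrow> (\<And>t. t \<in> {0..b} \<Longrightarrow> u t \<in> X) \<Longrightarrow> xint {0..b} (\<lambda>s. F s (u s))"
    and l: "integrable (lebesgue_on {0..b}) l" "AE s in lebesgue. 0 \<le> l s"
    and lip: "AE s in lebesgue. \<forall>z\<in>X. \<forall>z'\<in>X. xnorm U (F s z - F s z') \<le> l s * xnorm U (z - z')"
  obtains u where "continuous_on {0..b} u" "\<And>t. t \<in> {0..b} \<Longrightarrow> u t \<in> X"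
    "\<And>t. t \<in> {0..b} \<Longrightarrow> u t = P t z0 + conv 0 t (\<lambda>s. F s (u s))"
proof -
  let ?N = "real CARD('n)"
  have N: "1 \<le> ?N" by (rule card_ge_1)
  define \<Phi> where "\<Phi> u t = P t z0 + conv 0 t (\<lambda>s. F s (u s))" for u t
  define ok where "ok u \<longleftrightarrow> continuous_on {0..b} u \<and> (\<forall>t\<in>{0..b}. u t \<in> X)" for u
  \<comment> \<open>Only the fixed point equation is restricted to \<open>{0..c}\<close>. The curve
    itself lives on all of \<open>{0..b}\<close>, so that \<open>\<Phi>\<close> is meaningful
    throughout the induction.\<close>
  define Q where "Q c \<longleftrightarrow> (\<exists>u. ok u \<and> (\<forall>t\<in>{0..c}. u t = \<Phi> u t))" for c
  have xok: "xint {p..q} (\<lambda>s. F s (u s))" if "ok u" "0 \<le> p" "q \<le> b" for u p q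
    by (rule xint_mono[OF xF]) (use that in \<open>auto simp: ok_def\<close>)
  have \<Phi>_cont: "continuous_on {0..b} (\<Phi> u)" if "ok u" for u
    unfolding \<Phi>_def
    by (intro continuous_on_add continuous_on_conv xok[OF that] continuous_on_subset[OF continuous_on_P[OF z0]]) auto
  have \<Phi>_X: "\<Phi> u t \<in> X" if "ok u" "t \<in> {0..b}" for u t
    unfolding \<Phi>_def using that z0 by (intro X_add P_X conv_X xok) auto
  \<comment> \<open>One factor \<open>CARD('n)\<close> comes from the bound on \<open>P\<close> and
    one from passing from \<open>xnorm\<close> to the library norm, in which the contraction with
    constant \<open>1 / 2\<close> takes place.\<close>
  have "Q b"
  proof (rule integral_step_induct[OF l(1) b, where e="1 / (2 * ?N * ?N)"])
    show "0 < 1 / (2 * ?N * ?N)" using N by simp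
    show "Q 0"
      unfolding Q_def
    proof (intro exI[of _ "\<lambda>t. P t z0"] conjI ballI)
      show k: "ok (\<lambda>t. P t z0)"
        unfolding ok_def using z0 by (auto intro: continuous_on_subset[OF continuous_on_P[OF z0]] P_X)
      fix t :: real assume "t \<in> {0..0}"
      then have t: "t = 0" by simp
      have "xint {0..0} (\<lambda>s. F s (P s z0))" by (rule xok[OF k]) (use b in auto)
      then have "conv 0 0 (\<lambda>s. F s (P s z0)) = 0"
        unfolding conv_def by (intro bochner_integral_singleton xint_conv) auto
      then show "P t z0 = \<Phi> (\<lambda>t. P t z0) t" by (simp add: \<Phi>_def t)
    qed
    fix a c assume ac: "0 \<le> a" "a \<le> c" "c \<le> b" and small: "(LINT s|lebesgue_on {a..c}. l s) < 1 / (2 * ?N * ?N)"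
      and "Q a"
    then obtain ua where ua: "ok ua" "\<And>t. t \<in> {0..a} \<Longrightarrow> ua t = \<Phi> ua t"
      unfolding Q_def by blast
    \<comment> \<open>A product of closed sets is closed in the space of bounded continuous curves.
      Its members follow \<open>ua\<close> up to time \<open>a\<close> and are otherwise arbitrary
      in \<open>X\<close>.\<close>
    define S where "S = PiC UNIV (\<lambda>t::real. if t \<in> {0..a} then {ua t} else X)"
    have inS: "w \<in> S \<longleftrightarrow> (\<forall>t. apply_bcontfun w t \<in> (if t \<in> {0..a} then {ua t} else X))" for w
      by (simp only: S_def mem_PiC_iff Pi_iff) simp
    have uaX: "ua t \<in> X" if "t \<in> {0..b}" for t using ua(1) that by (simp add: ok_def)
    have S_ok: "ok (apply_bcontfun w)" "\<And>t. t \<in> {0..a} \<Longrightarrow> apply_bcontfun w t = ua t" if "w \<in> S" for w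
    proof -
      show e: "apply_bcontfun w t = ua t" if "t \<in> {0..a}" for t
        using \<open>w \<in> S\<close> that unfolding inS by (metis singletonD)
      have "apply_bcontfun w t \<in> X" if t: "t \<in> {0..b}" for t
      proof (cases "t \<in> {0..a}")
        case True
        then show ?thesis using e[OF True] uaX[OF t] by simp
      next
        case False
        then show ?thesis using \<open>w \<in> S\<close> unfolding inS by presburger
      qed
      then show "ok (apply_bcontfun w)" by (simp add: ok_def)
    qed
    \<comment> \<open>Holding a curve constant before 0 and after \<open>c\<close> makes it bounded
      and continuous on the whole line, as the Banach space of curves demands.\<close>
    define proj where "proj t = max 0 (min t c)" for t :: real
    have proj: "proj t \<in> {0..c}" "proj t \<in> {0..b}" for t using ac by (auto simp: proj_def)
    have proj_id: "t \<in> {0..c} \<Longrightarrow> proj t = t" for t by (auto simp: proj_def)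
    have bc: "(\<lambda>t. v (proj t)) \<in> bcontfun" if v: "continuous_on {0..b} v" for v :: "real \<Rightarrow> ('m, real ^ 'n) bfun"
    proof -
      have "continuous_on UNIV (\<lambda>t. v (proj t))"
        by (rule continuous_on_compose2[OF v]) (use proj in \<open>auto simp: proj_def[abs_def] intro!: continuous_intros\<close>)
      moreover have "bounded (v ` {0..b})"
        by (intro compact_imp_bounded compact_continuous_image v) simp
      then have "bounded (range (\<lambda>t. v (proj t)))"
        by (rule bounded_subset) (use proj in auto)
      ultimately show ?thesis by (simp add: bcontfun_def)
    qed
    define \<Psi> where "\<Psi> w = Bcontfun (\<lambda>t. \<Phi> (apply_bcontfun w) (proj t))" for w
    have \<Psi>: "apply_bcontfun (\<Psi> w) t = \<Phi> (apply_bcontfun w) (proj t)" if "w \<in> S" for w t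
      unfolding \<Psi>_def by (subst Bcontfun_inverse) (auto intro: bc[OF \<Phi>_cont[OF S_ok(1)[OF that]]])
    \<comment> \<open>Both curves agree on \<open>{0..a}\<close>, so the difference of the forcings
      vanishes there and only the short piece \<open>{a..t}\<close> contributes.\<close>
    have \<Phi>_diff: "norm (\<Phi> w t - \<Phi> w' t) \<le> 1 / 2 * D"
      if w: "ok w" "ok w'" "\<And>s. s \<in> {0..a} \<Longrightarrow> w s = w' s" and D: "\<And>s. s \<in> {0..b} \<Longrightarrow> norm (w s - w' s) \<le> D"
        and t: "t \<in> {0..c}" for w w' t D
    proof -
      define g where "g s = F s (w s) - F s (w' s)" for s
      have xg: "xint {p..q} g" if "0 \<le> p" "q \<le> b" for p q
        unfolding g_def using that by (intro xint_diff xok w)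
      have "D \<ge> 0" using D[of 0] b norm_ge_zero[of "w 0 - w' 0"] by (meson atLeastAtMost_iff order_refl order_trans)
      have \<Phi>g: "\<Phi> w t - \<Phi> w' t = conv 0 t g"
        unfolding \<Phi>_def g_def using t ac by (simp add: conv_diff xok w)
      have zero: "conv 0 p g = 0" if p: "0 \<le> p" "p \<le> a" for p
      proof -
        have "xnorm U (conv 0 p g) \<le> ?N * (LINT s|lebesgue_on {0..p}. 0)"
        proof (rule conv_bound)
          show "AE s in lebesgue_on {0..p}. xnorm U (g s) \<le> 0"
            using AE_mem_lebesgue_on by eventually_elim (use p w(3) in \<open>simp add: g_def\<close>)
        qed (use p ac in \<open>auto intro: xg\<close>)
        moreover have "conv 0 p g \<in> X" using p ac by (intro conv_X xg) auto
        ultimately show ?thesis using xnorm_le_0 by simp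
      qed
      show ?thesis
      proof (cases "t \<le> a")
        case True
        then show ?thesis using zero[of t] t \<Phi>g \<open>0 \<le> D\<close> by simp
      next
        case False
        then have ta: "a \<le> t" "t \<le> b" using t ac by auto
        have "conv 0 t g = P (t - a) (conv 0 a g) + conv a t g"
          using ta ac by (intro conv_restart xg) auto
        then have eq: "conv 0 t g = conv a t g"
          using zero[of a] ac ta by (simp add: P_zero)
        have "norm (conv a t g) \<le> xnorm U (conv a t g)"
          using ta ac by (intro norm_le_xnorm X_CU conv_X xg) auto
        also have "\<dots> \<le> ?N * (LINT s|lebesgue_on {a..t}. l s * (?N * D))"
        proof (rule conv_bound)
          have "integrable (lebesgue_on {a..t}) l"
            by (rule integrable_lebesgue_on_mono[OF l(1)]) (use ta ac in auto)
          then show "integrable (lebesgue_on {a..t}) (\<lambda>s. l s * (?N * D))" by simp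
          have "AE s in lebesgue. 0 \<le> l s \<and> (\<forall>z\<in>X. \<forall>z'\<in>X. xnorm U (F s z - F s z') \<le> l s * xnorm U (z - z'))"
            using l(2) lip by eventually_elim blast
          then have "AE s in lebesgue_on {a..t}. 0 \<le> l s \<and> (\<forall>z\<in>X. \<forall>z'\<in>X. xnorm U (F s z - F s z') \<le> l s * xnorm U (z - z'))"
            by (rule AE_lebesgue_on) simp
          then show "AE s in lebesgue_on {a..t}. xnorm U (g s) \<le> l s * (?N * D)"
            using AE_mem_lebesgue_on
          proof eventually_elim
            case (elim s)
            have s: "s \<in> {0..b}" using elim ta ac by auto
            have wX: "w s \<in> X" "w' s \<in> X" using w(1,2) s by (auto simp: ok_def)
            have "xnorm U (g s) \<le> l s * xnorm U (w s - w' s)"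
              unfolding g_def using elim(1) wX by blast
            also have "\<dots> \<le> l s * (?N * norm (w s - w' s))"
              using elim(1) by (intro mult_left_mono xnorm_le_norm) auto
            also have "\<dots> \<le> l s * (?N * D)"
              using elim(1) D[OF s] by (intro mult_left_mono) auto
            finally show ?case .
          qed
        qed (use ta ac in \<open>auto intro: xg\<close>)
        also have "\<dots> = ?N * ?N * D * (LINT s|lebesgue_on {a..t}. l s)" by simp
        also have "\<dots> \<le> ?N * ?N * D * (1 / (2 * ?N * ?N))"
        proof (rule mult_left_mono)
          have "(LINT s|lebesgue_on {a..t}. l s) \<le> (LINT s|lebesgue_on {a..c}. l s)"
            using t ac by (intro LINT_mono_set l integrable_lebesgue_on_mono[OF l(1)]) auto
          then show "(LINT s|lebesgue_on {a..t}. l s) \<le> 1 / (2 * ?N * ?N)" using small by linarith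
        qed (use \<open>0 \<le> D\<close> in auto)
        also have "\<dots> = 1 / 2 * D" using N by simp
        finally show ?thesis using \<Phi>g eq by simp
      qed
    qed
    have "\<exists>!w. w \<in> S \<and> \<Psi> w = w"
    proof (rule Banach_fix[where c="1 / 2"])
      have "closed S"
        unfolding S_def by (rule closed_PiC) (simp add: closed_X)
      then show "complete S" by (simp add: complete_eq_closed)
      define w0 where "w0 = Bcontfun (\<lambda>t. ua (proj t))"
      have w0: "apply_bcontfun w0 t = ua (proj t)" for t
        unfolding w0_def by (subst Bcontfun_inverse) (use ua(1) in \<open>auto intro!: bc simp: ok_def\<close>)
      have "w0 \<in> S"
        unfolding inS using proj(2) uaX ac by (auto simp: w0 proj_id)
      then show "S \<noteq> {}" by blast
      show "\<Psi> ` S \<subseteq> S"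
      proof safe
        fix w assume w: "w \<in> S"
        show "\<Psi> w \<in> S"
          unfolding inS
        proof
          fix t
          show "apply_bcontfun (\<Psi> w) t \<in> (if t \<in> {0..a} then {ua t} else X)"
          proof (cases "t \<in> {0..a}")
            case True
            then have t: "proj t = t" using ac by (auto intro: proj_id)
            have "conv 0 t (\<lambda>s. F s (apply_bcontfun w s)) = conv 0 t (\<lambda>s. F s (ua s))"
              unfolding conv_def
            proof (rule bochner_integral_cong_AE)
              show "xint {0..t} (\<lambda>s. P (t - s) (F s (apply_bcontfun w s)))"
                using True ac by (intro xint_conv xok S_ok(1)[OF w]) auto
              show "AE s in lebesgue_on {0..t}. P (t - s) (F s (apply_bcontfun w s)) = P (t - s) (F s (ua s))"
                using AE_mem_lebesgue_on by eventually_elim (use S_ok(2)[OF w] True in simp)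
            qed
            then have "\<Phi> (apply_bcontfun w) t = \<Phi> ua t" by (simp add: \<Phi>_def)
            then show ?thesis using \<Psi>[OF w, of t] t ua(2)[OF True] True by simp
          next
            case False
            have "apply_bcontfun (\<Psi> w) t \<in> X"
              unfolding \<Psi>[OF w] by (rule \<Phi>_X[OF S_ok(1)[OF w] proj(2)])
            then show ?thesis using False by presburger
          qed
        qed
      qed
      fix w w' assume w: "w \<in> S" "w' \<in> S"
      show "dist (\<Psi> w) (\<Psi> w') \<le> 1 / 2 * dist w w'"
      proof (rule dist_bound)
        fix t
        have "norm (\<Phi> (apply_bcontfun w) (proj t) - \<Phi> (apply_bcontfun w') (proj t)) \<le> 1 / 2 * dist w w'"
        proof (rule \<Phi>_diff[OF S_ok(1)[OF w(1)] S_ok(1)[OF w(2)] _ _ proj(1)])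
          show "apply_bcontfun w s = apply_bcontfun w' s" if "s \<in> {0..a}" for s
            using S_ok(2)[OF w(1) that] S_ok(2)[OF w(2) that] by simp
          show "norm (apply_bcontfun w s - apply_bcontfun w' s) \<le> dist w w'" for s
            using dist_bounded[of w s w'] by (simp add: dist_norm)
        qed
        then show "dist (apply_bcontfun (\<Psi> w) t) (apply_bcontfun (\<Psi> w') t) \<le> 1 / 2 * dist w w'"
          by (simp add: \<Psi> w dist_norm)
      qed
    qed auto
    then obtain w where w: "w \<in> S" "\<Psi> w = w" by blast
    show "Q c"
      unfolding Q_def
    proof (intro exI conjI ballI)
      show "ok (apply_bcontfun w)" by (rule S_ok(1)[OF w(1)])
      fix t assume "t \<in> {0..c}"
      then show "apply_bcontfun w t = \<Phi> (apply_bcontfun w) t"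
        using \<Psi>[OF w(1), of t] w(2) by (simp add: proj_id)
    qed
  qed
  then obtain u where "ok u" "\<And>t. t \<in> {0..b} \<Longrightarrow> u t = \<Phi> u t"
    unfolding Q_def by blast
  then show thesis
    using that unfolding ok_def \<Phi>_def by blast
qed

lemma mild_solution_iff:
  fixes f :: "('m, 'n) cmap"
  assumes f: "f \<in> SC U" "bc_compatible U bc f"
  shows "mild_solution U bc T f z b u \<longleftrightarrow> continuous_on {0..b} u \<and> (\<forall>t\<in>{0..b}. u t \<in> X) \<and>
    (\<forall>t\<in>{0..b}. u t = P t z + conv 0 t (\<lambda>s. nem U f s (u s)))"
proof -
  have "(\<exists>w. bochner_on {0..t} (\<lambda>s. P (t - s) (nem U f s (u s))) w \<and> u t = P t z + w) \<longleftrightarrow>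
      u t = P t z + conv 0 t (\<lambda>s. nem U f s (u s))"
    if u: "continuous_on {0..b} u" "\<forall>t\<in>{0..b}. u t \<in> X" and t: "t \<in> {0..b}" for t
  proof -
    have "xint {0..t} (\<lambda>s. nem U f s (u s))"
      by (rule xint_nem[OF f continuous_on_subset[OF u(1)]]) (use u(2) t in auto)
    then have "xint {0..t} (\<lambda>s. P (t - s) (nem U f s (u s)))"
      by (rule xint_conv) auto
    then show ?thesis by (simp add: bochner_on_iff conv_def)
  qed
  then show ?thesis unfolding mild_solution_def by blast
qed

text \<open>\<open>C\<close> depends only on \<open>f\<close>, \<open>R\<close> and
  \<open>b\<close>: a Lipschitz bound of \<open>f\<close> on the ball of radius \<open>R\<close> is
  fixed first and fed into \<open>gronwall\<close>. With \<open>a = 0\<close> this gives uniqueness;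
  with small \<open>a\<close> it measures the distance of perturbed solutions.\<close>

lemma comparison:
  fixes f :: "('m, 'n) cmap"
  assumes f: "f \<in> LC U" "bc_compatible U bc f" and b: "0 \<le> b"
  shows "\<exists>C\<ge>0. \<forall>u w a t0. 0 \<le> a \<and> 0 \<le> t0 \<and> t0 \<le> b \<and> continuous_on {0..t0} u \<and> continuous_on {0..t0} w \<and>
      (\<forall>t\<in>{0..t0}. u t \<in> X \<and> xnorm U (u t) \<le> R \<and> w t \<in> X \<and> xnorm U (w t) \<le> R) \<and>
      (\<forall>t\<in>{0..t0}. xnorm U (u t - w t) \<le> a + xnorm U (conv 0 t (\<lambda>s. nem U f s (u s) - nem U f s (w s)))) \<longrightarrow>
      (\<forall>t\<in>{0..t0}. xnorm U (u t - w t) \<le> C * a)"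
proof -
  let ?N = "real CARD('n)"
  obtain l where lb: "l_bound U (cball1 R) f l" using LC_l_bound[OF f(1)] by blast
  have l: "integrable (lebesgue_on {c..d}) l" "AE s in lebesgue. 0 \<le> l s" for c d
    using lb by (auto simp: l_bound_def intro: L1loc_integrable)
  obtain C where C: "0 \<le> C"
    "\<forall>\<phi> a t0. 0 \<le> a \<and> 0 \<le> t0 \<and> t0 \<le> b \<and> continuous_on {0..t0} \<phi> \<and>
      (\<forall>t\<in>{0..t0}. 0 \<le> \<phi> t \<and> \<phi> t \<le> a + ?N * (LINT s|lebesgue_on {0..t}. l s * \<phi> s)) \<longrightarrow>
      (\<forall>t\<in>{0..t0}. \<phi> t \<le> C * a)"
    using gronwall[OF l b, of ?N] by auto
  show ?thesis
  proof (intro exI[of _ C] conjI C(1) allI impI, elim conjE)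
    fix u w :: "real \<Rightarrow> ('m, real ^ 'n) bfun" and a t0
    assume a: "0 \<le> a" and t0: "0 \<le> t0" "t0 \<le> b" and cont: "continuous_on {0..t0} u" "continuous_on {0..t0} w"
      and uw: "\<forall>t\<in>{0..t0}. u t \<in> X \<and> xnorm U (u t) \<le> R \<and> w t \<in> X \<and> xnorm U (w t) \<le> R"
      and ineq: "\<forall>t\<in>{0..t0}. xnorm U (u t - w t) \<le> a + xnorm U (conv 0 t (\<lambda>s. nem U f s (u s) - nem U f s (w s)))"
    have cd: "continuous_on {0..t0} (\<lambda>t. xnorm U (u t - w t))"
      by (intro continuous_intros cont)
    have "xnorm U (u t - w t) \<le> a + ?N * (LINT s|lebesgue_on {0..t}. l s * xnorm U (u s - w s))"
      if t: "t \<in> {0..t0}" for t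
    proof -
      have "xnorm U (conv 0 t (\<lambda>s. nem U f s (u s) - nem U f s (w s))) \<le>
          ?N * (LINT s|lebesgue_on {0..t}. l s * xnorm U (u s - w s))"
      proof (rule conv_bound)
        show "xint {0..t} (\<lambda>s. nem U f s (u s) - nem U f s (w s))"
          using t uw by (intro xint_diff xint_nem LC_SC f continuous_on_subset[OF cont(1)] continuous_on_subset[OF cont(2)]) auto
        show "integrable (lebesgue_on {0..t}) (\<lambda>s. l s * xnorm U (u s - w s))"
          using t by (intro integrable_mult_continuous l continuous_on_subset[OF cd]) auto
        have "AE s in lebesgue_on {0..t}. \<forall>z\<in>CU U. \<forall>z'\<in>CU U. (\<forall>x\<in>closure U. ev z x \<in> cball1 R \<and> ev z' x \<in> cball1 R) \<longrightarrow>
            xnorm U (nem U f s z - nem U f s z') \<le> l s * xnorm U (z - z')"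
          by (rule AE_lebesgue_on[OF nem_lipschitz[OF LC_SC[OF f(1)] lb]]) simp
        then show "AE s in lebesgue_on {0..t}. xnorm U (nem U f s (u s) - nem U f s (w s)) \<le> l s * xnorm U (u s - w s)"
          using AE_mem_lebesgue_on
        proof eventually_elim
          case (elim s)
          have s: "s \<in> {0..t0}" using elim(2) t by auto
          have "u s \<in> CB U R" "w s \<in> CB U R" using uw s by (auto simp: CB_iff X_CU)
          then show ?case using elim(1) by (auto simp: CB_def)
        qed
      qed
      then show ?thesis
        using ineq t by fastforce
    qed
    then show "\<forall>t\<in>{0..t0}. xnorm U (u t - w t) \<le> C * a"
      using a t0 cd by (intro C(2)[rule_format, of a t0 "\<lambda>t. xnorm U (u t - w t)"] ballI conjI) auto
  qed
qed

lemma mild_solution_unique: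
  fixes f :: "('m, 'n) cmap"
  assumes f: "f \<in> LC U" "bc_compatible U bc f"
    and u: "mild_solution U bc T f z b u" and w: "mild_solution U bc T f z c w"
    and t: "t \<in> {0..b}" "t \<in> {0..c}"
  shows "u t = w t"
proof -
  note mild = mild_solution_iff[OF LC_SC[OF f(1)] f(2)]
  have u': "continuous_on {0..t} u" "\<And>s. s \<in> {0..t} \<Longrightarrow> u s \<in> X" 
    "\<And>s. s \<in> {0..t} \<Longrightarrow> u s = P s z + conv 0 s (\<lambda>s. nem U f s (u s))"
    using u t unfolding mild by (auto intro: continuous_on_subset)
  have w': "continuous_on {0..t} w" "\<And>s. s \<in> {0..t} \<Longrightarrow> w s \<in> X" 
    "\<And>s. s \<in> {0..t} \<Longrightarrow> w s = P s z + conv 0 s (\<lambda>s. nem U f s (w s))"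
    using w t unfolding mild by (auto intro: continuous_on_subset)
  obtain R1 where R1: "\<And>s. s \<in> {0..t} \<Longrightarrow> xnorm U (u s) \<le> R1"
    by (rule continuous_bounded[OF u'(1)]) (rule that)
  obtain R2 where R2: "\<And>s. s \<in> {0..t} \<Longrightarrow> xnorm U (w s) \<le> R2"
    by (rule continuous_bounded[OF w'(1)]) (rule that)
  have t0: "0 \<le> t" using t by simp
  let ?P = "\<lambda>s. u s \<in> X \<and> xnorm U (u s) \<le> max R1 R2 \<and> w s \<in> X \<and> xnorm U (w s) \<le> max R1 R2"
  let ?Q = "\<lambda>s. xnorm U (u s - w s) \<le> 0 + xnorm U (conv 0 s (\<lambda>s. nem U f s (u s) - nem U f s (w s)))"
  have PQ: "?P s \<and> ?Q s" if s: "s \<in> {0..t}" for s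
  proof -
    have "u s \<in> X \<and> xnorm U (u s) \<le> max R1 R2 \<and> w s \<in> X \<and> xnorm U (w s) \<le> max R1 R2"
      using u'(2) w'(2) R1[OF s] R2[OF s] s by auto
    moreover have "conv 0 s (\<lambda>s. nem U f s (u s) - nem U f s (w s)) = conv 0 s (\<lambda>s. nem U f s (u s)) - conv 0 s (\<lambda>s. nem U f s (w s))"
      by (rule conv_diff)
        (use s u' w' f in \<open>auto intro!: xint_nem LC_SC intro: continuous_on_subset\<close>)
    then have "xnorm U (u s - w s) \<le> 0 + xnorm U (conv 0 s (\<lambda>s. nem U f s (u s) - nem U f s (w s)))"
      using u'(3)[OF s] w'(3)[OF s] by simp
    ultimately show ?thesis by blast
  qed
  obtain C where "\<forall>s\<in>{0..t}. xnorm U (u s - w s) \<le> C * 0"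
    using comparison[OF f t0, of "max R1 R2"] u'(1) w'(1) PQ t0 by (meson order_refl)
  then have "xnorm U (u t - w t) \<le> C * 0" using t0 by simp
  then show ?thesis
    using xnorm_le_0[OF X_diff[OF u'(2) w'(2)], of t t] t0 by simp
qed

lemma mild_sol_eq:
  fixes f :: "('m, 'n) cmap"
  assumes f: "f \<in> LC U" "bc_compatible U bc f" and u: "mild_solution U bc T f z b u" and b: "0 < b" and t: "t \<in> {0..b}"
  shows "mild_sol U bc T f z t = u t"
  unfolding mild_sol_def
proof (rule the_equality)
  show "\<exists>\<delta> v. 0 < \<delta> \<and> t \<in> {0..\<delta>} \<and> mild_solution U bc T f z \<delta> v \<and> u t = v t"
    using u b t by blast
  fix w assume "\<exists>\<delta> v. 0 < \<delta> \<and> t \<in> {0..\<delta>} \<and> mild_solution U bc T f z \<delta> v \<and> w = v t"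
  then show "w = u t"
    using mild_solution_unique[OF f _ u _ t] by blast
qed

end

section \<open>Convergence of mild solutions\<close>

context equi
begin

text \<open>The order of choices avoids a circle. \<open>k\<close> depends only on \<open>R\<close>,
  the forcing is bounded through the optimal m-bounds at radius \<open>k\<close>, and the resulting
  bound on the solutions is then allowed to enlarge \<open>k\<close> to \<open>j\<close>.\<close>

lemma truncated_solution:
  fixes R b Z :: real
  assumes R: "0 \<le> R" and b: "0 \<le> b" and w: "\<And>n. fn n \<in> E" "\<And>n. zn n \<in> X" "\<And>n. xnorm U (zn n) \<le> Z"
  obtains j :: nat and un where "1 \<le> j" "R \<le> real j"
    "\<And>n. continuous_on {0..b} (un n)" "\<And>n t. t \<in> {0..b} \<Longrightarrow> un n t \<in> X"
    "\<And>n t. t \<in> {0..b} \<Longrightarrow> un n t = P t (zn n) + conv 0 t (\<lambda>s. nem U (fn n) s (trunc R (un n s)))"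
    "\<And>n t. t \<in> {0..b} \<Longrightarrow> xnorm U (un n t) \<le> real j"
    "\<And>n q1 q2. 0 \<le> q1 \<Longrightarrow> q2 \<le> b \<Longrightarrow> un n \<in> KI U bc T E j q1 q2"
proof -
  let ?N = "real CARD('n)"
  \<comment> \<open>The range of the cut-off has 1-norm up to \<open>CARD('n) * R\<close>, which
    therefore must fit below \<open>k\<close>.\<close>
  obtain k :: nat where k: "?N * R \<le> real k" "1 \<le> k"
  proof -
    obtain k0 :: nat where "?N * R \<le> real k0" using real_arch_simple by blast
    then show thesis by (intro that[of "Suc k0"]) auto
  qed
  obtain C where C: "\<And>g. g \<in> E \<Longrightarrow> (LINT t|lebesgue_on {0..b}. opt_bound U k g t) \<le> C"
    by (rule equi_bounded[OF k(2)]) (rule that)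
  \<comment> \<open>The first summand bounds the free evolution of the initial values, the second
    the Duhamel integral.\<close>
  obtain j0 :: nat where j0: "?N * Z + ?N * C \<le> real j0" using real_arch_simple by blast
  define j where "j = max k j0"
  have j: "1 \<le> j" "k \<le> j" "?N * Z + ?N * C \<le> real j" using k j0 by (auto simp: j_def)
  have Rj: "R \<le> real j"
  proof -
    have "1 * R \<le> ?N * R" using R card_ge_1 by (intro mult_right_mono)
    also have "\<dots> \<le> real j" using k(1) j(2) by linarith
    finally show ?thesis by simp
  qed
  have small: "xnorm U (trunc R z) \<le> real k" for z :: "('m, real ^ 'n) bfun"
    using xnorm_trunc[OF R, of z] k(1) by linarith
  have xF: "xint {0..b} (\<lambda>s. nem U (fn n) s (trunc R (u s)))"
    if "continuous_on {0..b} u" "\<And>t. t \<in> {0..b} \<Longrightarrow> u t \<in> X" for u n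
    using that by (intro xint_nem E_SC E_bc w continuous_on_trunc R trunc_X) auto
  have ex: "\<exists>u. continuous_on {0..b} u \<and> (\<forall>t\<in>{0..b}. u t \<in> X) \<and>
      (\<forall>t\<in>{0..b}. u t = P t (zn n) + conv 0 t (\<lambda>s. nem U (fn n) s (trunc R (u s))))" for n
  proof -
    obtain l where lb: "l_bound U (cball1 (real k)) (fn n) l"
      using LC_l_bound E_LC w(1) by blast
    have lip: "AE s in lebesgue. \<forall>z\<in>X. \<forall>z'\<in>X. xnorm U (nem U (fn n) s (trunc R z) - nem U (fn n) s (trunc R z')) \<le> l s * xnorm U (z - z')"
      using nem_lipschitz[OF E_SC[OF w(1)] lb]
    proof eventually_elim
      case (elim s)
      show ?case
      proof (intro ballI)
        fix z z' assume z: "z \<in> X" "z' \<in> X"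
        have "trunc R z \<in> CB U (real k)" "trunc R z' \<in> CB U (real k)"
          using small X_CU[OF trunc_X[OF R]] z by (auto simp: CB_iff)
        then have "xnorm U (nem U (fn n) s (trunc R z) - nem U (fn n) s (trunc R z')) \<le> l s * xnorm U (trunc R z - trunc R z')"
          using elim by (auto simp: CB_def)
        also have "\<dots> \<le> l s * xnorm U (z - z')"
          using lb by (intro mult_left_mono xnorm_trunc_diff R) (simp add: l_bound_def)
        finally show "xnorm U (nem U (fn n) s (trunc R z) - nem U (fn n) s (trunc R z')) \<le> l s * xnorm U (z - z')" .
      qed
    qed
    have l: "integrable (lebesgue_on {0..b}) l" "AE s in lebesgue. 0 \<le> l s"
      using lb by (auto simp: l_bound_def intro: L1loc_integrable)
    obtain u where "continuous_on {0..b} u" "\<And>t. t \<in> {0..b} \<Longrightarrow> u t \<in> X"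
      "\<And>t. t \<in> {0..b} \<Longrightarrow> u t = P t (zn n) + conv 0 t (\<lambda>s. nem U (fn n) s (trunc R (u s)))"
      by (rule global_existence[where F="\<lambda>s z. nem U (fn n) s (trunc R z)", OF b w(2)[of n] xF l lip])
        (assumption+, rule that)
    then show ?thesis by blast
  qed
  define un where "un n = (SOME u. continuous_on {0..b} u \<and> (\<forall>t\<in>{0..b}. u t \<in> X) \<and>
      (\<forall>t\<in>{0..b}. u t = P t (zn n) + conv 0 t (\<lambda>s. nem U (fn n) s (trunc R (u s)))))" for n
  have un: "continuous_on {0..b} (un n)" "\<And>t. t \<in> {0..b} \<Longrightarrow> un n t \<in> X"
    "\<And>t. t \<in> {0..b} \<Longrightarrow> un n t = P t (zn n) + conv 0 t (\<lambda>s. nem U (fn n) s (trunc R (un n s)))" for n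
    using someI_ex[OF ex[of n]] unfolding un_def[symmetric] by auto
  define g where "g n s = nem U (fn n) s (trunc R (un n s))" for n s
  have xg: "xint {0..b} (g n)" for n unfolding g_def by (intro xF un)
  have gk: "AE s in lebesgue_on {0..b}. xnorm U (g n s) \<le> opt_bound U k (fn n) s" for n
    using AE_lebesgue_on[OF nem_opt_bound[OF E_SC[OF w(1)], of k n], of "{0..b}", simplified] AE_mem_lebesgue_on
  proof eventually_elim
    case (elim s)
    then show ?case
      using small X_CU[OF trunc_X[OF R un(2)]] unfolding g_def by blast
  qed
  have un_le: "xnorm U (un n t) \<le> real j" if t: "t \<in> {0..b}" for n t
  proof -
    have "xnorm U (un n t) \<le> xnorm U (P t (zn n)) + xnorm U (conv 0 t (g n))"
      unfolding un(3)[OF t] g_def by (rule xnorm_triangle)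
    also have "xnorm U (P t (zn n)) \<le> ?N * Z"
      using t w by (intro order_trans[OF xnorm_P_le mult_left_mono]) auto
    also have "xnorm U (conv 0 t (g n)) \<le> ?N * (LINT s|lebesgue_on {0..t}. opt_bound U k (fn n) s)"
      using t by (intro conv_bound xint_mono[OF xg] E_integrable w AE_lebesgue_on_mono[OF gk]) auto
    also have "\<dots> \<le> ?N * C"
    proof (rule mult_left_mono)
      have "(LINT s|lebesgue_on {0..t}. opt_bound U k (fn n) s) \<le> (LINT s|lebesgue_on {0..b}. opt_bound U k (fn n) s)"
        using t by (intro LINT_mono_set E_integrable E_nonneg w) auto
      then show "(LINT s|lebesgue_on {0..t}. opt_bound U k (fn n) s) \<le> C" using C[OF w(1), of n] by linarith
    qed simp
    finally show ?thesis using j(3) by simp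
  qed
  have KI: "un n \<in> KI U bc T E j q1 q2" if "0 \<le> q1" "q2 \<le> b" for n q1 q2
  proof -
    interpret Fo: forced U bc T E j "fn n" b "g n" "un n" "zn n"
    proof unfold_locales
      \<comment> \<open>The forcing was estimated at radius \<open>k\<close>, while
        \<open>KI\<close> refers to the larger radius \<open>j\<close>.\<close>
      have "AE s in lebesgue_on {0..b}. opt_bound U k (fn n) s \<le> opt_bound U j (fn n) s"
        by (rule AE_lebesgue_on[OF opt_bound_mono[OF E_SC[OF w(1)] j(2)]]) simp
      with gk[of n] show "AE s in lebesgue_on {0..b}. xnorm U (g n s) \<le> opt_bound U j (fn n) s"
        by eventually_elim linarith
      show "un n t = P t (zn n) + conv 0 t (g n)" if "t \<in> {0..b}" for t
        using un(3)[OF that, of n] by (simp add: g_def[abs_def])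
    qed (use j w xg un_le in auto)
    show ?thesis by (rule Fo.v_KI[OF that])
  qed
  show thesis
    by (rule that[OF j(1) Rj un un_le KI])
qed

lemma mild_convergence:
  fixes f :: "('m, 'n) cmap" and fn :: "nat \<Rightarrow> ('m, 'n) cmap"
  assumes top: "\<T> \<in> {topology_sigma_Theta U bc T E, topology_Theta_R U bc T E, topology_Theta U bc T E, topology_B U}"
    and fn: "\<And>n. fn n \<in> E" and f: "f \<in> LC U" "bc_compatible U bc f"
    and lim: "limitin \<T> fn f sequentially"
    and zn: "\<And>n. zn n \<in> X" and z: "z \<in> X" and lim_z: "(\<lambda>n. xnorm U (zn n - z)) \<longlonglongrightarrow> 0"
    and \<tau>: "0 < \<tau>" and u: "mild_solution U bc T f z \<tau> u"
  obtains un where "\<forall>\<^sub>F n in sequentially. mild_solution U bc T (fn n) (zn n) \<tau> (un n)"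
    "\<And>e. 0 < e \<Longrightarrow> \<forall>\<^sub>F n in sequentially. \<forall>t\<in>{0..\<tau>}. xnorm U (un n t - u t) \<le> e"
proof -
  let ?N = "real CARD('n)"
  note fSC = LC_SC[OF f(1)]
  have u': "continuous_on {0..\<tau>} u" "\<And>t. t \<in> {0..\<tau>} \<Longrightarrow> u t \<in> X"
    "\<And>t. t \<in> {0..\<tau>} \<Longrightarrow> u t = P t z + conv 0 t (\<lambda>s. nem U f s (u s))"
    using u unfolding mild_solution_iff[OF fSC f(2)] by auto
  obtain R0 where R0: "\<And>t. t \<in> {0..\<tau>} \<Longrightarrow> xnorm U (u t) \<le> R0"
    by (rule continuous_bounded[OF u'(1)]) (rule that)
  \<comment> \<open>The margin 1 keeps \<open>u\<close> strictly below the cut-off level, so a curve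
    within \<open>1 / 2\<close> of \<open>u\<close> cannot reach that level.\<close>
  define R where "R = \<bar>R0\<bar> + 1"
  have R: "0 \<le> R" "\<And>t. t \<in> {0..\<tau>} \<Longrightarrow> xnorm U (u t) \<le> R - 1"
    using R0 by (fastforce simp: R_def)+
  have "Bseq (\<lambda>n. xnorm U (zn n - z))"
    using lim_z by (intro convergent_imp_Bseq convergentI)
  then obtain Z0 where Z0: "\<And>n. xnorm U (zn n - z) \<le> Z0"
    by (auto simp: Bseq_def)
  have Z: "xnorm U (zn n) \<le> Z0 + xnorm U z" for n
    using xnorm_triangle[of "zn n - z" z] Z0[of n] by simp
  \<comment> \<open>Rounding \<open>\<tau>\<close> up to an integer gives a rational endpoint for
    the grid. The truncated equations can be solved on the longer interval as well.\<close>
  define b where "b = real (nat \<lceil>\<tau>\<rceil>)"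
  have b: "0 < b" "b \<in> \<rat>" "\<tau> \<le> b" "0 \<le> b"
    using \<tau> by (auto simp: b_def)
  obtain j :: nat and un where j: "1 \<le> j" "R \<le> real j"
    and un: "\<And>n. continuous_on {0..b} (un n)" "\<And>n t. t \<in> {0..b} \<Longrightarrow> un n t \<in> X"
    "\<And>n t. t \<in> {0..b} \<Longrightarrow> un n t = P t (zn n) + conv 0 t (\<lambda>s. nem U (fn n) s (trunc R (un n s)))"
    "\<And>n t. t \<in> {0..b} \<Longrightarrow> xnorm U (un n t) \<le> real j"
    and KI: "\<And>n q1 q2. 0 \<le> q1 \<Longrightarrow> q2 \<le> b \<Longrightarrow> un n \<in> KI U bc T E j q1 q2"
    by (rule truncated_solution[OF R(1) b(4) fn zn Z]) (rule that)
  \<comment> \<open>The curve is inserted without truncation, because membership in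
    \<open>KI\<close> is known for \<open>un n\<close> itself; the two forcings agree while
    \<open>un n\<close> stays below \<open>R\<close>.\<close>
  define G where "G n s = nem U (fn n - f) s (un n s)" for n s
  have xG: "xint {0..b} (G n)" for n
    unfolding G_def by (intro xint_nem_diff E_SC E_bc fn fSC f(2) un)
  obtain B where B: "\<And>g. g \<in> E \<Longrightarrow> (LINT t|lebesgue_on {0..b}. opt_bound U j g t) \<le> B"
    by (rule equi_bounded[OF j(1)]) (rule that)
  have G_conv: "\<forall>\<^sub>F n in sequentially. \<forall>t\<in>{0..b}. xnorm U (conv 0 t (G n)) \<le> e" if e: "0 < e" for e
  proof (rule conv_uniform_limit[where \<mu>="\<lambda>n s. opt_bound U j (fn n) s + opt_bound U j f s", OF b(1,2) xG _ _ _ _ _ _ e])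
    show "integrable (lebesgue_on {0..b}) (\<lambda>s. opt_bound U j (fn n) s + opt_bound U j f s)" for n
      by (intro Bochner_Integration.integrable_add opt_bound_integrable E_SC fn fSC)
    show "AE s in lebesgue_on {0..b}. xnorm U (G n s) \<le> opt_bound U j (fn n) s + opt_bound U j f s" for n
      unfolding G_def by (rule nem_diff_le[OF E_SC[OF fn] fSC]) (use un X_CU in \<open>auto simp: CB_iff\<close>)
    show "AE s in lebesgue. 0 \<le> opt_bound U j (fn n) s + opt_bound U j f s" for n
      using E_nonneg[OF fn, of j n] opt_bound_nonneg[OF fSC, of j] by eventually_elim simp
    show "\<exists>\<eta>>0. \<forall>n a c. 0 \<le> a \<longrightarrow> a \<le> c \<longrightarrow> c \<le> b \<longrightarrow> c - a < \<eta> \<longrightarrow>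
        (LINT s|lebesgue_on {a..c}. opt_bound U j (fn n) s + opt_bound U j f s) < e" if "0 < e" for e
    proof -
      have e2: "0 < e / 2" using that by simp
      obtain d1 where d1: "0 < d1" "\<And>g t1 t2. g \<in> E \<Longrightarrow> - b \<le> t1 \<Longrightarrow> t1 \<le> t2 \<Longrightarrow> t2 \<le> b \<Longrightarrow> t2 - t1 < d1 \<Longrightarrow>
          (LINT t|lebesgue_on {t1..t2}. opt_bound U j g t) < e / 2"
        by (rule equi_small[OF j(1) b(1) e2]) (rule that)
      obtain d2 where d2: "0 < d2" "\<And>c d. 0 \<le> c \<Longrightarrow> c \<le> d \<Longrightarrow> d \<le> b \<Longrightarrow> d - c < d2 \<Longrightarrow>
          (LINT t|lebesgue_on {c..d}. opt_bound U j f t) < e / 2"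
        by (rule small_integral[OF opt_bound_integrable[OF fSC] e2]) (rule that)
      show ?thesis
      proof (intro exI[of _ "min d1 d2"] conjI allI impI)
        fix n a c assume ac: "0 \<le> a" "a \<le> c" "c \<le> b" "c - a < min d1 d2"
        have "(LINT s|lebesgue_on {a..c}. opt_bound U j (fn n) s + opt_bound U j f s) =
            (LINT s|lebesgue_on {a..c}. opt_bound U j (fn n) s) + (LINT s|lebesgue_on {a..c}. opt_bound U j f s)"
          by (intro Bochner_Integration.integral_add opt_bound_integrable E_SC fn fSC)
        moreover have "(LINT s|lebesgue_on {a..c}. opt_bound U j (fn n) s) < e / 2"
          using ac b by (intro d1(2) fn) auto
        moreover have "(LINT s|lebesgue_on {a..c}. opt_bound U j f s) < e / 2"
          using ac by (intro d2(2)) auto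
        ultimately show "(LINT s|lebesgue_on {a..c}. opt_bound U j (fn n) s + opt_bound U j f s) < e"
          by linarith
      qed (use d1 d2 in auto)
    qed
    show "(LINT s|lebesgue_on {0..b}. opt_bound U j (fn n) s + opt_bound U j f s) \<le>
        B + (LINT s|lebesgue_on {0..b}. opt_bound U j f s)" for n
      using B[OF fn, of n]
      by (subst Bochner_Integration.integral_add) (auto intro: opt_bound_integrable E_SC fn fSC)
    show "(\<lambda>n. xnorm U (bochner_integral {a..c} (G n))) \<longlonglongrightarrow> 0"
      if "a \<in> \<rat>" "c \<in> \<rat>" "0 \<le> a" "a < c" "c \<le> b" for a c
      unfolding G_def using that
      by (intro topologies_limit[OF top lim fSC E_SC[OF fn] j(1)] KI)
  qed
  obtain C where C: "0 \<le> C" "\<forall>u w a t0. 0 \<le> a \<and> 0 \<le> t0 \<and> t0 \<le> b \<and> continuous_on {0..t0} u \<and> continuous_on {0..t0} w \<and>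
      (\<forall>t\<in>{0..t0}. u t \<in> X \<and> xnorm U (u t) \<le> real j \<and> w t \<in> X \<and> xnorm U (w t) \<le> real j) \<and>
      (\<forall>t\<in>{0..t0}. xnorm U (u t - w t) \<le> a + xnorm U (conv 0 t (\<lambda>s. nem U f s (u s) - nem U f s (w s)))) \<longrightarrow>
      (\<forall>t\<in>{0..t0}. xnorm U (u t - w t) \<le> C * a)"
    using comparison[OF f b(4), of "real j"] by blast
  \<comment> \<open>The bound by \<open>R\<close> is required only strictly before
    \<open>t0\<close>, since it may fail at the first exit time; a single time does not affect the
    integrals.\<close>
  have close: "xnorm U (un n t - u t) \<le> C * a"
    if a: "?N * xnorm U (zn n - z) + e \<le> a" "0 \<le> a" and e: "\<forall>t\<in>{0..b}. xnorm U (conv 0 t (G n)) \<le> e"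
      and t0: "0 \<le> t0" "t0 \<le> \<tau>" and inside: "\<And>s. 0 \<le> s \<Longrightarrow> s < t0 \<Longrightarrow> xnorm U (un n s) \<le> R"
      and t: "t \<in> {0..t0}" for n a e t0 t
  proof -
    have cu: "continuous_on {0..t0} u" and cun: "continuous_on {0..t0} (un n)"
      using t0 b by (auto intro: continuous_on_subset[OF u'(1)] continuous_on_subset[OF un(1)])
    have "xnorm U (un n t - u t) \<le> a + xnorm U (conv 0 t (\<lambda>s. nem U f s (un n s) - nem U f s (u s)))"
      if t: "t \<in> {0..t0}" for t
    proof -
      have tb: "t \<in> {0..b}" "t \<in> {0..\<tau>}" using t t0 b by auto
      have cu': "continuous_on {0..t} u" and cun': "continuous_on {0..t} (un n)"
        using t by (auto intro: continuous_on_subset[OF cu] continuous_on_subset[OF cun])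
      have X': "un n s \<in> X" "u s \<in> X" if "s \<in> {0..t}" for s
        using that tb by (auto intro!: un(2) u'(2))
      have xfn: "xint {0..t} (\<lambda>s. nem U (fn n) s (un n s))" and xfu: "xint {0..t} (\<lambda>s. nem U f s (un n s))"
        and xf: "xint {0..t} (\<lambda>s. nem U f s (u s))"
        by (intro xint_nem E_SC E_bc fn fSC f(2) cu' cun' X'; assumption)+
      have xG': "xint {0..t} (G n)"
        by (rule xint_mono[OF xG]) (use tb in auto)
      have "conv 0 t (\<lambda>s. nem U (fn n) s (trunc R (un n s))) = conv 0 t (\<lambda>s. nem U (fn n) s (un n s))"
        unfolding conv_def
      proof (rule bochner_integral_cong_AE[symmetric])
        show "xint {0..t} (\<lambda>s. P (t - s) (nem U (fn n) s (un n s)))"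
          by (rule xint_conv[OF xfn]) auto
        have "AE s in lebesgue. s \<noteq> t" by (rule AE_completion[OF AE_lborel_singleton])
        then have "AE s in lebesgue_on {0..t}. s \<noteq> t" by (rule AE_lebesgue_on) simp
        then show "AE s in lebesgue_on {0..t}. P (t - s) (nem U (fn n) s (un n s)) = P (t - s) (nem U (fn n) s (trunc R (un n s)))"
          using AE_mem_lebesgue_on
        proof eventually_elim
          case (elim s)
          then have "trunc R (un n s) = un n s"
            using t inside[of s] X'(1)[of s] by (intro trunc_id R(1)) auto
          then show ?case by simp
        qed
      qed
      then have un_t: "un n t = P t (zn n) + conv 0 t (\<lambda>s. nem U (fn n) s (un n s))"
        using un(3)[OF tb(1), of n] by simp
      have "conv 0 t (\<lambda>s. nem U (fn n) s (un n s)) - conv 0 t (\<lambda>s. nem U f s (un n s)) =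
          conv 0 t (\<lambda>s. nem U (fn n) s (un n s) - nem U f s (un n s))"
        by (rule conv_diff[OF xfn xfu, symmetric])
      also have "\<dots> = conv 0 t (G n)"
        unfolding conv_def
      proof (rule bochner_integral_cong_AE[symmetric])
        show "xint {0..t} (\<lambda>s. P (t - s) (G n s))" by (rule xint_conv[OF xG']) auto
        show "AE s in lebesgue_on {0..t}. P (t - s) (G n s) = P (t - s) (nem U (fn n) s (un n s) - nem U f s (un n s))"
          using nem_diff_AE[OF E_SC[OF fn] fSC, of 0 t "un n" n] X'(1) X_CU
          unfolding G_def by (auto elim: eventually_mono)
      qed
      finally have d1: "conv 0 t (\<lambda>s. nem U (fn n) s (un n s)) = conv 0 t (G n) + conv 0 t (\<lambda>s. nem U f s (un n s))"
        by (simp add: algebra_simps)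
      have d2: "conv 0 t (\<lambda>s. nem U f s (un n s) - nem U f s (u s)) =
          conv 0 t (\<lambda>s. nem U f s (un n s)) - conv 0 t (\<lambda>s. nem U f s (u s))"
        by (rule conv_diff[OF xfu xf])
      have Pd: "P t (zn n - z) = P t (zn n) - P t z"
        using tb zn z by (intro P_diff) auto
      have "un n t - u t = P t (zn n - z) + conv 0 t (G n) + conv 0 t (\<lambda>s. nem U f s (un n s) - nem U f s (u s))"
        unfolding un_t u'(3)[OF tb(2)] d1 d2 Pd by simp
      then have "xnorm U (un n t - u t) \<le> xnorm U (P t (zn n - z)) + xnorm U (conv 0 t (G n))
          + xnorm U (conv 0 t (\<lambda>s. nem U f s (un n s) - nem U f s (u s)))"
        using xnorm_triangle[of "P t (zn n - z) + conv 0 t (G n)" "conv 0 t (\<lambda>s. nem U f s (un n s) - nem U f s (u s))"]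
          xnorm_triangle[of "P t (zn n - z)" "conv 0 t (G n)"] by simp
      moreover have "xnorm U (P t (zn n - z)) \<le> ?N * xnorm U (zn n - z)"
        using tb zn z by (intro xnorm_P_le X_diff) auto
      moreover have "xnorm U (conv 0 t (G n)) \<le> e" using e tb by blast
      ultimately show ?thesis using a by linarith
    qed
    moreover have "un n s \<in> X \<and> xnorm U (un n s) \<le> real j \<and> u s \<in> X \<and> xnorm U (u s) \<le> real j" if "s \<in> {0..t0}" for s
    proof -
      have "s \<in> {0..b}" "s \<in> {0..\<tau>}" using that t0 b by auto
      then show ?thesis using un(2,4) u'(2) R(2)[of s] j(2) by (meson diff_le_eq le_add_same_cancel1 order_trans zero_le_one)
    qed
    ultimately show ?thesis
      using C(2)[rule_format, of a t0 "un n" u t] a(2) t0 b cu cun t by auto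
  qed
  have key: "\<forall>\<^sub>F n in sequentially. (\<forall>t\<in>{0..\<tau>}. xnorm U (un n t) \<le> R) \<and> (\<forall>t\<in>{0..\<tau>}. xnorm U (un n t - u t) \<le> e)"
    if e: "0 < e" for e
  proof -
    \<comment> \<open>Capping at \<open>1 / 2\<close> stays within the margin 1 between
      \<open>u\<close> and the cut-off level.\<close>
    define e' where "e' = min e (1 / 2)"
    \<comment> \<open>This gives \<open>C * a \<le> e'\<close>, also for \<open>C = 0\<close>. Half
      of \<open>a\<close> is spent on the initial values and half on the Duhamel integral of
      \<open>G n\<close>.\<close>
    define a where "a = e' / (C + 1)"
    have e': "0 < e'" "e' \<le> e" "e' \<le> 1 / 2" using e by (auto simp: e'_def)
    have a: "0 < a" "C * a \<le> e'"
    proof -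
      show a0: "0 < a" using e' C(1) by (simp add: a_def)
      have "C * a \<le> (C + 1) * a" using a0 by (intro mult_right_mono) auto
      also have "\<dots> = e'" using C(1) by (simp add: a_def)
      finally show "C * a \<le> e'" .
    qed
    have "0 < a / (2 * ?N)" using a card_ge_1 by simp
    with lim_z have "\<forall>\<^sub>F n in sequentially. xnorm U (zn n - z) < a / (2 * ?N)"
      by (rule order_tendstoD)
    moreover have "\<forall>\<^sub>F n in sequentially. \<forall>t\<in>{0..b}. xnorm U (conv 0 t (G n)) \<le> a / 2"
      using a by (intro G_conv) simp
    ultimately show ?thesis
    proof eventually_elim
      case (elim n)
      have "?N * xnorm U (zn n - z) \<le> ?N * (a / (2 * ?N))"
        using elim(1) by (intro mult_left_mono) auto
      then have an: "?N * xnorm U (zn n - z) + a / 2 \<le> a"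
        using card_ge_1 by simp
      note close' = close[OF an less_imp_le[OF a(1)] elim(2)]
      \<comment> \<open>Exit times from the region where the cut-off is inactive. The non-strict
        inequality makes \<open>V\<close> closed, so a nonempty \<open>V\<close> has a first
        element, and at that time the estimate \<open>close\<close> contradicts the margin.\<close>
      define V where "V = {t \<in> {0..\<tau>}. R \<le> xnorm U (un n t)}"
      have "V = {}"
      proof (rule ccontr)
        assume "V \<noteq> {}"
        have "continuous_on {0..\<tau>} (\<lambda>t. xnorm U (un n t))"
          by (intro continuous_intros continuous_on_subset[OF un(1)]) (use b in auto)
        then have "closed ({0..\<tau>} \<inter> (\<lambda>t. xnorm U (un n t)) -` {R..})"
          by (rule continuous_closed_preimage) auto
        moreover have "{0..\<tau>} \<inter> (\<lambda>t. xnorm U (un n t)) -` {R..} = V" by (auto simp: V_def)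
        ultimately have "closed V" by simp
        moreover have "bounded V" by (rule bounded_subset[of "{0..\<tau>}"]) (auto simp: V_def)
        ultimately have "compact V" by (simp add: compact_eq_bounded_closed)
        from compact_attains_inf[OF this \<open>V \<noteq> {}\<close>]
        obtain t0 where t0: "t0 \<in> V" "\<forall>t\<in>V. t0 \<le> t" by blast
        have in\<tau>: "t0 \<in> {0..\<tau>}" "R \<le> xnorm U (un n t0)" using t0(1) by (auto simp: V_def)
        have "xnorm U (un n s) \<le> R" if "0 \<le> s" "s < t0" for s
        proof (rule ccontr)
          assume "\<not> xnorm U (un n s) \<le> R"
          then have "s \<in> V" using that in\<tau> by (simp add: V_def)
          then show False using t0(2) that(2) by auto
        qed
        then have "xnorm U (un n t0 - u t0) \<le> C * a"
          using in\<tau> by (intro close'[of t0]) auto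
        then have "xnorm U (un n t0) \<le> xnorm U (u t0) + 1 / 2"
          using xnorm_triangle[of "un n t0 - u t0" "u t0"] a(2) e'(3) by simp
        then show False using R(2)[OF in\<tau>(1)] in\<tau>(2) by linarith
      qed
      then have "t \<notin> V" for t by simp
      then have le: "xnorm U (un n t) \<le> R" if "t \<in> {0..\<tau>}" for t
        using that linear[of R "xnorm U (un n t)"] unfolding V_def by blast
      moreover have "xnorm U (un n t - u t) \<le> e" if "t \<in> {0..\<tau>}" for t
        using close'[of \<tau> t] that \<tau> le a(2) e'(2) by fastforce
      ultimately show ?case by blast
    qed
  qed
  show thesis
  proof (rule that[of un])
    show "\<forall>\<^sub>F n in sequentially. \<forall>t\<in>{0..\<tau>}. xnorm U (un n t - u t) \<le> e" if "0 < e" for e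
      using key[OF that] by eventually_elim blast
    show "\<forall>\<^sub>F n in sequentially. mild_solution U bc T (fn n) (zn n) \<tau> (un n)"
      using key[OF zero_less_one]
    proof eventually_elim
      case (elim n)
      have "un n t = P t (zn n) + conv 0 t (\<lambda>s. nem U (fn n) s (un n s))" if t: "t \<in> {0..\<tau>}" for t
      proof -
        have tb: "t \<in> {0..b}" using t b by auto
        have tr: "trunc R (un n s) = un n s" if "s \<in> {0..t}" for s
          using that t b elim by (intro trunc_id R(1) un(2)) auto
        have "xint {0..t} (\<lambda>s. P (t - s) (nem U (fn n) s (un n s)))"
          by (intro xint_conv xint_nem E_SC E_bc fn continuous_on_subset[OF un(1)] un(2)) (use tb in auto)
        then have "conv 0 t (\<lambda>s. nem U (fn n) s (un n s)) = conv 0 t (\<lambda>s. nem U (fn n) s (trunc R (un n s)))"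
          unfolding conv_def
        proof (rule bochner_integral_cong_AE)
          show "AE s in lebesgue_on {0..t}. P (t - s) (nem U (fn n) s (un n s)) = P (t - s) (nem U (fn n) s (trunc R (un n s)))"
            using AE_mem_lebesgue_on by eventually_elim (simp add: tr)
        qed
        then show ?thesis using un(3)[OF tb, of n] by simp
      qed
      moreover have "continuous_on {0..\<tau>} (un n)"
        by (rule continuous_on_subset[OF un(1)]) (use b in auto)
      moreover have "un n t \<in> X" if "t \<in> {0..\<tau>}" for t
        using that b by (intro un(2)) auto
      ultimately show ?case
        unfolding mild_solution_iff[OF E_SC[OF fn] E_bc[OF fn]] by blast
    qed
  qed
qed

end

theorem corollary4p9:
  fixes U :: "(real ^ 'm) set"
    and bc :: "('n::finite, real ^ 'm) bc"
    and T :: "'n \<Rightarrow> real \<Rightarrow> ('m::finite, real) bfun \<Rightarrow> ('m, real) bfun"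
    and E :: "('m, 'n) cmap set"
    and \<T> :: "('m, 'n) cmap topology"
    and fn :: "nat \<Rightarrow> ('m, 'n) cmap" and f :: "('m, 'n) cmap"
    and zn :: "nat \<Rightarrow> ('m, real ^ 'n) bfun" and z :: "('m, real ^ 'n) bfun"
    and \<tau> :: real
  assumes "open U" "bounded U" "connected U" "U \<noteq> {}" "C1_boundary U"
    and "admissible_bc U bc"
    and "\<And>i. heat_semigroup U bc i (T i)"
    and "E \<subseteq> LC U" "\<And>g. g \<in> E \<Longrightarrow> bc_compatible U bc g"
    and "equicontinuous_m_bounds U E"
    and "\<T> \<in> {topology_sigma_Theta U bc T E, topology_Theta_R U bc T E,
              topology_Theta U bc T E, topology_B U}"
    and "\<And>n. fn n \<in> E"
    and "f \<in> LC U" "bc_compatible U bc f"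
    and "limitin \<T> fn f sequentially"
    and "\<And>n. zn n \<in> state_space U bc" "z \<in> state_space U bc"
    and "(\<lambda>n. xnorm U (zn n - z)) \<longlonglongrightarrow> 0"
    and "0 \<le> \<tau>" "{0..\<tau>} \<subseteq> existence_interval U bc T f z"
  shows "uniformly_converge_on U bc T fn zn f z \<tau>"
proof -
  interpret equi U bc T E
    using assms by unfold_locales auto
  \<comment> \<open>Convergence is shown on an interval \<open>{0..\<delta>}\<close> with positive
    \<open>\<delta>\<close> that contains \<open>\<tau>\<close>, so \<open>\<tau> = 0\<close> needs
    no separate treatment.\<close>
  have "\<tau> \<in> existence_interval U bc T f z" using assms(19,20) by auto
  then obtain \<delta> u where \<delta>: "0 < \<delta>" "\<tau> \<le> \<delta>" and u: "mild_solution U bc T f z \<delta> u"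
    unfolding existence_interval_def by auto
  obtain un where un: "\<forall>\<^sub>F n in sequentially. mild_solution U bc T (fn n) (zn n) \<delta> (un n)"
    and cv: "\<And>e. 0 < e \<Longrightarrow> \<forall>\<^sub>F n in sequentially. \<forall>t\<in>{0..\<delta>}. xnorm U (un n t - u t) \<le> e"
    by (rule mild_convergence[OF assms(11-18) \<delta>(1) u]) (rule that)
  have fnLC: "fn n \<in> LC U" "bc_compatible U bc (fn n)" for n
    using assms(8,9,12) by auto
  show ?thesis
    unfolding uniformly_converge_on_def
  proof
    show "\<forall>\<^sub>F n in sequentially. {0..\<tau>} \<subseteq> existence_interval U bc T (fn n) (zn n)"
      using un
    proof eventually_elim
      case (elim n)
      then have "{0..\<delta>} \<subseteq> existence_interval U bc T (fn n) (zn n)"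
        unfolding existence_interval_def using \<delta>(1) by blast
      then show ?case using \<delta>(2) by auto
    qed
    let ?s = "\<lambda>n. SUP t\<in>{0..\<tau>}. xnorm U (mild_sol U bc T (fn n) (zn n) t - mild_sol U bc T f z t)"
    show "?s \<longlonglongrightarrow> 0"
    proof (rule tendstoI)
      fix e :: real assume e: "0 < e"
      then have "0 < e / 2" by simp
      from cv[OF this] un show "\<forall>\<^sub>F n in sequentially. dist (?s n) 0 < e"
      proof eventually_elim
        case (elim n)
        have eq: "xnorm U (mild_sol U bc T (fn n) (zn n) t - mild_sol U bc T f z t) \<le> e / 2" if "t \<in> {0..\<tau>}" for t
        proof -
          have t: "t \<in> {0..\<delta>}" using that \<delta>(2) by auto
          show ?thesis
            using elim(1) t by (simp add: mild_sol_eq[OF fnLC elim(2) \<delta>(1) t] mild_sol_eq[OF assms(13,14) u \<delta>(1) t])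
        qed
        have 0: "0 \<in> {0..\<tau>}" using assms(19) by simp
        have "?s n \<le> e / 2"
          using 0 eq by (intro cSUP_least) auto
        moreover have "0 \<le> ?s n"
          by (rule order_trans[OF xnorm_nonneg cSUP_upper[OF 0]])
            (rule bdd_aboveI2, rule eq)
        ultimately show ?case using e by simp
      qed
    qed
  qed
qed

end
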